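(* Let $m\in\mathbb{N}$ and let $F(\mathbf{x})=\sum f(\mathbf{n})\mathbf{x}^{\mathbf{n}}\in\bar{\mathbb{Q}}[[x_1,\ldots,x_m]]$ be the power series representation of a rational function. For $N\in\mathbb{N}_0$ put $h_N=\max\{h(f(\mathbf{n})):\ \Vert\mathbf{n}\Vert\le N\}$. If $h_N=o(N)$, then, up to scalar multiplication, every irreducible factor of the denominator of $F$ has the form $1-\zeta\mathbf{x}^{\mathbf{n}}$ where $\zeta$ is a root of unity and $\mathbf{n}\in\mathbb{N}_0^m\setminus\{0\}$.
   Context: $\mathbb{N}_0$ is the set of nonnegative integers; for $\mathbf{n}\in\mathbb{N}_0^m$, $\mathbf{x}^{\mathbf{n}}=x_1^{n_1}\cdots x_m^{n_m}$ and $\Vert\mathbf{n}\Vert=n_1+\cdots+n_m$. $h$ is the absolute logarithmic Weil height on $\bar{\mathbb{Q}}$. *)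

theory Defs
  imports "HOL-Analysis.Analysis" "HOL-Library.Poly_Mapping" "HOL-Library.Landau_Symbols"
    "HOL-Computational_Algebra.Polynomial" "HOL-Computational_Algebra.Factorial_Ring"
begin

text \<open>Exponent vectors (monomials) are finitely supported maps nat =>0 nat;
  the variables are x_0, ..., x_{m-1}.  Multivariate polynomials with complex
  coefficients are elements of (nat =>0 nat) =>0 complex (the ring structure of
  HOL-Library.Poly_Mapping is polynomial multiplication).\<close>

type_synonym monom = "nat \<Rightarrow>\<^sub>0 nat"
type_synonym mpoly = "monom \<Rightarrow>\<^sub>0 complex"

definition monom_in :: "nat \<Rightarrow> monom \<Rightarrow> bool" where
  "monom_in m n \<longleftrightarrow> Poly_Mapping.keys n \<subseteq> {..<m}"

definition alg_mpoly_in :: "nat \<Rightarrow> mpoly \<Rightarrow> bool" where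
  "alg_mpoly_in m P \<longleftrightarrow> (\<forall>n\<in>Poly_Mapping.keys P. monom_in m n \<and> algebraic (Poly_Mapping.lookup P n))"

definition mnorm :: "monom \<Rightarrow> nat" where
  "mnorm n = (\<Sum>i\<in>Poly_Mapping.keys n. Poly_Mapping.lookup n i)"

definition monom_le :: "monom \<Rightarrow> monom \<Rightarrow> bool" where
  "monom_le k n \<longleftrightarrow> (\<forall>i. Poly_Mapping.lookup k i \<le> Poly_Mapping.lookup n i)"

definition series_mult_coeff :: "mpoly \<Rightarrow> (monom \<Rightarrow> complex) \<Rightarrow> monom \<Rightarrow> complex" where
  "series_mult_coeff Q F n = (\<Sum>k\<in>{k\<in>Poly_Mapping.keys Q. monom_le k n}. Poly_Mapping.lookup Q k * F (n - k))"

definition xmon :: "monom \<Rightarrow> mpoly" where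
  "xmon n = Poly_Mapping.single n 1"

definition alg_dvd :: "nat \<Rightarrow> mpoly \<Rightarrow> mpoly \<Rightarrow> bool" where
  "alg_dvd m a b \<longleftrightarrow> (\<exists>c. alg_mpoly_in m c \<and> b = a * c)"

definition alg_unit :: "nat \<Rightarrow> mpoly \<Rightarrow> bool" where
  "alg_unit m a \<longleftrightarrow> alg_dvd m a 1"

definition alg_irreducible :: "nat \<Rightarrow> mpoly \<Rightarrow> bool" where
  "alg_irreducible m p \<longleftrightarrow> alg_mpoly_in m p \<and> p \<noteq> 0 \<and> \<not> alg_unit m p \<and>
     (\<forall>a b. alg_mpoly_in m a \<longrightarrow> alg_mpoly_in m b \<longrightarrow> p = a * b \<longrightarrow> alg_unit m a \<or> alg_unit m b)"

definition alg_coprime :: "nat \<Rightarrow> mpoly \<Rightarrow> mpoly \<Rightarrow> bool" where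
  "alg_coprime m a b \<longleftrightarrow> (\<forall>c. alg_mpoly_in m c \<longrightarrow> alg_dvd m c a \<longrightarrow> alg_dvd m c b \<longrightarrow> alg_unit m c)"

definition root_of_unity :: "complex \<Rightarrow> bool" where
  "root_of_unity z \<longleftrightarrow> (\<exists>k>0. z ^ k = 1)"

text \<open>Minimal polynomial over Z of an algebraic number: the irreducible integer polynomial
  with positive leading coefficient vanishing at the number (it is primitive).\<close>
definition min_int_poly :: "complex \<Rightarrow> int poly" where
  "min_int_poly a = (THE p. irreducible p \<and> lead_coeff p > 0 \<and> poly (map_poly of_int p) a = 0)"

text \<open>Absolute logarithmic Weil height, via the Mahler measure of the minimal polynomial:
  h(a) = (log|c| + sum over the complex roots z of log max(1,|z|)) / deg, where c is the leading
  coefficient of the minimal polynomial over Z (whose roots are simple).\<close>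
definition weil_height :: "complex \<Rightarrow> real" where
  "weil_height a = (let p = min_int_poly a in
     (ln (real_of_int (lead_coeff p)) +
      (\<Sum>z\<in>{z. poly (map_poly of_int p) z = 0}. ln (max 1 (cmod z)))) / real (degree p))"

definition height_bound :: "nat \<Rightarrow> (monom \<Rightarrow> complex) \<Rightarrow> nat \<Rightarrow> real" where
  "height_bound m f N = Max ((\<lambda>n. weil_height (f n)) ` {n. monom_in m n \<and> mnorm n \<le> N})"

end

theory Submission
  imports Defs "Jordan_Normal_Form.Char_Poly" "HOL-Real_Asymp.Real_Asymp"
    "HOL-Complex_Analysis.Cauchy_Integral_Formula"
begin

text \<open>Write F = P/Q and let g be an irreducible factor of Q. The coefficients of F generate a number
  field, have denominators dividing powers of a fixed integer, and all their conjugates are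
  exp(o(n)) because the heights are o(n). Hence the pigeonhole principle yields a nonzero multiple of
  Q/gcd(P,Q) whose coefficients lie in {-1,0,1}, and after a substitution making it univariate one sees
  that g, normalised by g(0) = 1, has algebraic integer coefficients. Every conjugate of F converges in
  the open unit polydisc, so P vanishes wherever g does; if g had a zero there, a Bezout relation between
  P and g over the other variables and continuity of roots would let the zero move freely in each
  coordinate, which is absurd. Therefore all conjugates of g are free of zeros in the polydisc, and the
  coefficients of the logarithmic derivative of g are algebraic integers, of bounded degree, with bounded
  conjugates. They take finitely many values, and comparing the derivatives with respect to the separate
  variables shows that only finitely many directions n/||n|| occur in their support. A direction of
  maximal norm is exposed, and the corresponding face part of g is a factor of g, hence equals g.
  So g is a univariate polynomial in one monomial, and by irreducibility a binomial 1 - z x^n; all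
  conjugates of the algebraic integer z have modulus at most 1, and Kronecker's theorem applies.\<close>

section \<open>Algebraic integers and bounded degree\<close>

text \<open>Zero-freeness is an analytic statement about the complex conjugates of \<open>g\<close>
  and says nothing about denominators. At the finite places integrality takes its role, and this is
  what the pigeonhole is for: annihilating the product of \<open>S\<close> and \<open>f\<close> on a
  shell around a box of side k costs O(k^(m-1)) conditions with exp(o(k)) possible values each,
  against 2^(k^m) choices. Since \<open>g\<close> is prime and does not divide \<open>P\<close>, the
  identity \<open>Q * C = S * P\<close> makes \<open>g\<close> a divisor of \<open>S\<close>.
  Bounded algebraic integers form a finite set only if the degree and all conjugates are bounded
  together. So every analytic estimate is made for all conjugates of \<open>g\<close> at once, and a
  single ring of bounded degree carries the coefficients of \<open>f\<close> and of
  \<open>g\<close>. Nothing is assumed about the value of \<open>Q\<close> at the origin; that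
  \<open>g\<close> does not vanish there is itself a case of zero-freeness. Power series in several
  variables are never summed: they are graded by total degree and restricted to rays, where
  one-variable theory applies.\<close>

lemma charpoly_root:
  fixes h :: "'a::comm_ring_1 \<Rightarrow> complex" and x :: complex
  assumes hom: "comm_ring_hom h" and v: "\<exists>i<n. v i \<noteq> 0"
    and ev: "\<And>i. i < n \<Longrightarrow> x * v i = (\<Sum>j<n. h (M i j) * v j)"
  shows "\<exists>p::'a poly. degree p = n \<and> lead_coeff p = 1 \<and> poly (map_poly h p) x = 0"
proof -
  interpret comm_ring_hom h by fact
  define A where "A = Matrix.mat n n (\<lambda>(i,j). M i j)"
  define w where "w = Matrix.vec n v"
  have A: "A \<in> carrier_mat n n" by (simp add: A_def)
  have hA: "map_mat h A \<in> carrier_mat n n" by (simp add: A_def)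
  have w0: "w \<noteq> 0\<^sub>v n"
  proof
    assume "w = 0\<^sub>v n"
    hence "vec_index w i = 0" if "i < n" for i using that by simp
    thus False using v by (auto simp: w_def)
  qed
  have "map_mat h A *\<^sub>v w = x \<cdot>\<^sub>v w"
    by (intro eq_vecI) (auto simp: A_def w_def scalar_prod_def ev atLeast0LessThan)
  hence "eigenvalue (map_mat h A) x"
    unfolding eigenvalue_def eigenvector_def using w0 by (intro exI[of _ w]) (auto simp: A_def w_def)
  hence "poly (char_poly (map_mat h A)) x = 0" using eigenvalue_root_char_poly[OF hA] by blast
  hence "poly (map_poly h (char_poly A)) x = 0" by (simp add: char_poly_hom[OF A])
  thus ?thesis using degree_monic_char_poly[OF A] by auto
qed

lemma module_hom_scale:
  assumes "comm_ring_hom (h :: 'a::comm_ring_1 \<Rightarrow> complex)"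
  shows "Modules.module (\<lambda>a x. h a * x)"
proof -
  interpret comm_ring_hom h by fact
  show ?thesis by unfold_locales (auto simp: algebra_simps hom_distribs)
qed

text \<open>The degree \<open>n\<close> is exact and common to all elements: it is the size of the
  matrix in \<open>charpoly_root\<close>. This uniformity is what later turns bounds on conjugates
  into finite counts. With \<open>'a\<close> equal to \<open>int\<close> or \<open>rat\<close>,
  integrality and algebraicity are treated together.\<close>

definition bounded_degree_ring :: "('a::comm_ring_1 \<Rightarrow> complex) \<Rightarrow> nat \<Rightarrow> complex set \<Rightarrow> bool" where
  "bounded_degree_ring h n R \<longleftrightarrow> n > 0 \<and> range h \<subseteq> R \<and> (\<forall>x\<in>R. \<forall>y\<in>R. x + y \<in> R \<and> x * y \<in> R) \<and>
    (\<forall>x\<in>R. \<exists>p::'a poly. degree p = n \<and> lead_coeff p = 1 \<and> poly (map_poly h p) x = 0)"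

text \<open>The ring consists of the elements that stabilise a suitable finitely generated module containing 1.\<close>
lemma integral_ring:
  fixes h :: "'a::comm_ring_1 \<Rightarrow> complex"
  assumes hom: "comm_ring_hom h" and fin: "finite T"
    and int: "\<And>t. t \<in> T \<Longrightarrow> \<exists>p::'a poly. lead_coeff p = 1 \<and> poly (map_poly h p) t = 0"
  obtains n R where "bounded_degree_ring h n R" "T \<subseteq> R"
proof -
  interpret comm_ring_hom h by fact
  interpret M: Modules.module "\<lambda>a x. h a * x" by (rule module_hom_scale[OF hom])
  have "\<exists>B. finite B \<and> 1 \<in> B \<and> (\<forall>t\<in>T. \<forall>b\<in>B. t * b \<in> M.span B)"
    using fin int
  proof (induction T)
    case empty
    show ?case by (rule exI[of _ "{1}"]) auto
  next
    case (insert t T)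
    then obtain B where B: "finite B" "1 \<in> B" "\<And>t b. t \<in> T \<Longrightarrow> b \<in> B \<Longrightarrow> t * b \<in> M.span B" by blast
    from insert.prems obtain p :: "'a poly" where p: "lead_coeff p = 1" "poly (map_poly h p) t = 0" by blast
    define d where "d = degree p"
    have lc: "coeff p d = 1" using p(1) by (simp add: d_def)
    have hp: "degree (map_poly h p) = d"
      unfolding d_def using lc by (intro degree_map_poly) (auto simp: d_def hom_one)
    have chp: "coeff (map_poly h p) j = h (coeff p j)" for j by (simp add: coeff_map_poly)
    have "0 = t ^ d + (\<Sum>j<d. h (coeff p j) * t ^ j)"
      using p(2) unfolding poly_altdef hp by (simp add: chp lc lessThan_Suc_atMost[symmetric] add.commute)
    hence td: "t ^ d = (\<Sum>j<d. h (- coeff p j) * t ^ j)"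
      by (simp add: hom_distribs sum_negf eq_neg_iff_add_eq_0)
    have d0: "d > 0" using td by (cases d) auto
    \<comment> \<open>The old generators are multiplied by the powers of \<open>t\<close> below
      \<open>d\<close>; multiplication by \<open>t\<close> leaves this range only at
      \<open>t ^ d\<close>, which the monic equation rewrites.\<close>
    define B' where "B' = (\<lambda>(b,j). b * t ^ j) ` (B \<times> {..<d})"
    have mem: "b * t ^ j \<in> B'" if "b \<in> B" "j < d" for b j using that by (auto simp: B'_def)
    have sp: "u * t ^ j \<in> M.span B'" if "u \<in> M.span B" "j < d" for u j
      using that(1)
    proof (induction rule: M.span_induct_alt)
      case base show ?case by (simp add: M.span_zero)
    next
      case (step c b u)
      have "h c * (b * t ^ j) + u * t ^ j \<in> M.span B'"
        by (intro M.span_add M.span_scale M.span_base mem step that)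
      thus ?case by (simp add: algebra_simps)
    qed
    show ?case
    proof (intro exI[of _ B'] conjI ballI)
      show "finite B'" using B by (simp add: B'_def)
      show "1 \<in> B'" using mem[OF B(2) d0] by simp
      fix s c assume s: "s \<in> insert t T" and "c \<in> B'"
      then obtain b j where c: "b \<in> B" "j < d" "c = b * t ^ j" by (auto simp: B'_def)
      show "s * c \<in> M.span B'"
      proof (cases "s = t")
        case False
        hence "s * b \<in> M.span B" using s c B by auto
        from sp[OF this c(2)] show ?thesis by (simp add: c algebra_simps)
      next
        case True
        show ?thesis
        proof (cases "Suc j < d")
          case True
          from sp[OF M.span_base[OF c(1)] this] show ?thesis using \<open>s = t\<close> by (simp add: c algebra_simps)
        next
          case False
          hence j: "d = Suc j" using c by simp
          have "(\<Sum>j<d. h (- coeff p j) * (b * t ^ j)) \<in> M.span B'"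
            by (intro M.span_sum M.span_scale M.span_base mem c) auto
          also have "(\<Sum>j<d. h (- coeff p j) * (b * t ^ j)) = b * (\<Sum>j<d. h (- coeff p j) * t ^ j)"
            by (simp add: sum_distrib_left algebra_simps)
          also have "\<dots> = s * c" unfolding td[symmetric] using \<open>s = t\<close> by (simp add: c j)
          finally show ?thesis .
        qed
      qed
    qed
  qed
  then obtain B where B: "finite B" "1 \<in> B" "\<And>t b. t \<in> T \<Longrightarrow> b \<in> B \<Longrightarrow> t * b \<in> M.span B" by blast
  define R where "R = {x. \<forall>b\<in>B. x * b \<in> M.span B}"
  have st: "x * u \<in> M.span B" if "x \<in> R" "u \<in> M.span B" for x u
    using that(2)
  proof (induction rule: M.span_induct_alt)
    case base show ?case by (simp add: M.span_zero)
  next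
    case (step c b u)
    have "h c * (x * b) + x * u \<in> M.span B"
      by (intro M.span_add M.span_scale step) (use that step in \<open>auto simp: R_def\<close>)
    thus ?case by (simp add: algebra_simps)
  qed
  define n where "n = card B"
  have n0: "n > 0" using B by (auto simp: n_def card_gt_0_iff)
  have root: "\<exists>p::'a poly. degree p = n \<and> lead_coeff p = 1 \<and> poly (map_poly h p) x = 0" if x: "x \<in> R" for x
  proof -
    obtain v where v: "bij_betw v {..<n} B"
      using B(1) unfolding n_def using ex_bij_betw_nat_finite[of B] by (auto simp: atLeast0LessThan)
    have "\<forall>i<n. \<exists>u. x * v i = (\<Sum>j<n. h (u j) * v j)"
    proof safe
      fix i assume "i < n"
      hence "v i \<in> B" using v by (auto simp: bij_betw_def)
      hence "x * v i \<in> M.span B" using x by (auto simp: R_def)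
      then obtain u where "x * v i = (\<Sum>b\<in>B. h (u b) * b)" using B(1) by (auto simp: M.span_finite)
      also have "\<dots> = (\<Sum>j<n. h (u (v j)) * v j)"
        by (rule sum.reindex_bij_betw[OF v, symmetric])
      finally show "\<exists>u. x * v i = (\<Sum>j<n. h (u j) * v j)" by (intro exI[of _ "\<lambda>j. u (v j)"])
    qed
    then obtain U where U: "\<And>i. i < n \<Longrightarrow> x * v i = (\<Sum>j<n. h (U i j) * v j)" by metis
    \<comment> \<open>The eigenvector does not vanish because \<open>1\<close> is among the
      generators.\<close>
    have "\<exists>i<n. v i \<noteq> 0" using v B(2) by (metis bij_betw_iff_bijections lessThan_iff zero_neq_one)
    from charpoly_root[OF hom this U] show ?thesis .
  qed
  show ?thesis
  proof (rule that[of n R])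
    show "T \<subseteq> R" using B by (auto simp: R_def)
    show "bounded_degree_ring h n R" unfolding bounded_degree_ring_def
    proof (intro conjI ballI root n0)
    show "range h \<subseteq> R" unfolding R_def by (blast intro: M.span_scale M.span_base)
    fix x y assume xy: "x \<in> R" "y \<in> R"
    show "x + y \<in> R" using xy by (auto simp: R_def distrib_right intro!: M.span_add)
    have "x * (y * b) \<in> M.span B" if "b \<in> B" for b by (rule st[OF xy(1)]) (use xy(2) that in \<open>auto simp: R_def\<close>)
    thus "x * y \<in> R" by (auto simp: R_def mult.assoc)
    qed auto
  qed
qed

lemma comm_ring_hom_of_rat: "comm_ring_hom (of_rat :: rat \<Rightarrow> complex)"
  by unfold_locales
lemma comm_ring_hom_of_int: "comm_ring_hom (of_int :: int \<Rightarrow> complex)"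
  by unfold_locales

lemma map_poly_preimage:
  fixes p :: "'b::zero poly" and h :: "'a::zero \<Rightarrow> 'b"
  assumes h: "\<And>x. h x = 0 \<longleftrightarrow> x = 0" and p: "\<And>i. coeff p i \<in> range h"
  obtains q where "p = map_poly h q"
proof -
  have "\<forall>i. \<exists>q. coeff p i = h q" using p by auto
  then obtain c where c: "\<And>i. coeff p i = h (c i)" by metis
  have "\<forall>\<^sub>\<infinity>i. coeff p i = 0" by (rule MOST_coeff_eq_0)
  hence "c \<in> {f. \<forall>\<^sub>\<infinity>n. f n = 0}" by (simp add: c h)
  hence "coeff (Abs_poly c) i = c i" for i by (simp add: Abs_poly_inverse)
  hence "p = map_poly h (Abs_poly c)" by (intro poly_eqI) (simp add: coeff_map_poly h c)
  thus ?thesis by (rule that)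
qed

lemma algebraic_iff_monic:
  "algebraic (x::complex) \<longleftrightarrow> (\<exists>p::rat poly. lead_coeff p = 1 \<and> poly (map_poly of_rat p) x = 0)"
proof
  assume "algebraic x"
  then obtain p where p: "\<And>i. coeff p i \<in> \<rat>" "p \<noteq> 0" "poly p x = 0" by (auto simp: algebraic_altdef)
  obtain q :: "rat poly" where pq: "p = map_poly of_rat q"
    by (rule map_poly_preimage[of of_rat p]) (use p in \<open>auto simp: Rats_def\<close>)
  hence "q \<noteq> 0" using p by auto
  hence "lead_coeff (Polynomial.smult (1 / lead_coeff q) q) = 1" by simp
  moreover have "poly (map_poly of_rat (Polynomial.smult (1 / lead_coeff q) q)) x = 0"
    using p by (simp add: pq of_rat_hom.map_poly_hom_smult)
  ultimately show "\<exists>p::rat poly. lead_coeff p = 1 \<and> poly (map_poly of_rat p) x = 0" by blast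
next
  assume "\<exists>p::rat poly. lead_coeff p = 1 \<and> poly (map_poly of_rat p) x = 0"
  then obtain p :: "rat poly" where p: "lead_coeff p = 1" "poly (map_poly of_rat p) x = 0" by blast
  thus "algebraic x" by (intro algebraicI'[of "map_poly of_rat p"]) (auto simp: coeff_map_poly)
qed

lemma algebraic_int_iff_monic:
  "algebraic_int (x::complex) \<longleftrightarrow> (\<exists>p::int poly. lead_coeff p = 1 \<and> poly (map_poly of_int p) x = 0)"
  by (auto simp: algebraic_int_altdef_ipoly)

lemma algebraic_add_mult:
  assumes "algebraic (x::complex)" "algebraic y"
  shows algebraic_add: "algebraic (x + y)" and algebraic_mult: "algebraic (x * y)"
proof -
  obtain n R where "bounded_degree_ring (of_rat :: rat \<Rightarrow> complex) n R" "{x,y} \<subseteq> R"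
    by (rule integral_ring[OF comm_ring_hom_of_rat, of "{x,y}"])
       (use assms in \<open>auto simp: algebraic_iff_monic\<close>)
  thus "algebraic (x + y)" "algebraic (x * y)"
    unfolding algebraic_iff_monic bounded_degree_ring_def by auto
qed

lemma algebraic_int_add_mult:
  assumes "algebraic_int (x::complex)" "algebraic_int y"
  shows algebraic_int_add: "algebraic_int (x + y)" and algebraic_int_mult: "algebraic_int (x * y)"
proof -
  obtain n R where "bounded_degree_ring (of_int :: int \<Rightarrow> complex) n R" "{x,y} \<subseteq> R"
    by (rule integral_ring[OF comm_ring_hom_of_int, of "{x,y}"])
       (use assms in \<open>auto simp: algebraic_int_iff_monic\<close>)
  thus "algebraic_int (x + y)" "algebraic_int (x * y)"
    unfolding algebraic_int_iff_monic bounded_degree_ring_def by auto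
qed

lemma algebraic_sum: "(\<And>i. i \<in> A \<Longrightarrow> algebraic (f i :: complex)) \<Longrightarrow> algebraic (sum f A)"
  by (induction A rule: infinite_finite_induct) (auto intro: algebraic_add)
lemma algebraic_power: "algebraic (x::complex) \<Longrightarrow> algebraic (x ^ k)"
  by (induction k) (auto intro: algebraic_mult simp: rat_imp_algebraic int_imp_algebraic_int)
lemma algebraic_int_diff: "algebraic_int (x::complex) \<Longrightarrow> algebraic_int y \<Longrightarrow> algebraic_int (x - y)"
  using algebraic_int_add[of x "-y"] by auto
lemma algebraic_int_sum: "(\<And>i. i \<in> A \<Longrightarrow> algebraic_int (f i :: complex)) \<Longrightarrow> algebraic_int (sum f A)"
  by (induction A rule: infinite_finite_induct) (auto intro: algebraic_int_add)
lemma algebraic_int_power: "algebraic_int (x::complex) \<Longrightarrow> algebraic_int (x ^ k)"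
  by (induction k) (auto intro: algebraic_int_mult simp: rat_imp_algebraic int_imp_algebraic_int)

lemma algebraic_iff_int_poly:
  "algebraic (x::complex) \<longleftrightarrow> (\<exists>p::int poly. p \<noteq> 0 \<and> poly (map_poly of_int p) x = 0)"
proof
  assume "algebraic x"
  then obtain p where p: "\<And>i. coeff p i \<in> \<int>" "p \<noteq> 0" "poly p x = 0" by (auto simp: algebraic_def)
  obtain q :: "int poly" where pq: "p = map_poly of_int q"
    by (rule map_poly_preimage[of of_int p]) (use p in \<open>auto simp: Ints_def\<close>)
  thus "\<exists>p::int poly. p \<noteq> 0 \<and> poly (map_poly of_int p) x = 0" using p by auto
next
  assume "\<exists>p::int poly. p \<noteq> 0 \<and> poly (map_poly of_int p) x = 0"
  then obtain p :: "int poly" where "p \<noteq> 0" "poly (map_poly of_int p) x = 0" by blast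
  thus "algebraic x" unfolding algebraic_def
    by (intro exI[of _ "map_poly of_int p"]) (auto simp: coeff_map_poly)
qed

abbreviation ipoly :: "int poly \<Rightarrow> complex \<Rightarrow> complex" where
  "ipoly p x \<equiv> poly (map_poly of_int p) x"

section \<open>Minimal polynomials and heights\<close>

lemma irreducible_root_degree:
  assumes "irreducible (p::int poly)" "ipoly p a = 0" shows "degree p > 0"
proof (rule ccontr)
  assume "\<not> degree p > 0"
  then obtain c where "p = [:c:]" by (auto elim: degree_eq_zeroE)
  thus False using assms by auto
qed

text \<open>Everything stays over the integers. Pseudo-division by a nonzero \<open>u\<close> of
  least degree vanishing at \<open>a\<close> shows that some constant multiple of each polynomial
  vanishing at \<open>a\<close> is a multiple of \<open>u\<close>. The prime \<open>p\<close> has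
  positive degree, so it divides no nonzero constant; comparing degrees in
  \<open>smult c p = u * s\<close>, it must divide \<open>u\<close> rather than
  \<open>s\<close>.\<close>

lemma irreducible_root_dvd:
  assumes p: "irreducible (p::int poly)" "ipoly p a = 0" and q: "ipoly q a = 0"
  shows "p dvd q"
proof -
  define P where "P = (\<lambda>d. \<exists>r::int poly. r \<noteq> 0 \<and> ipoly r a = 0 \<and> degree r = d)"
  have "P (degree p)" using p by (auto simp: P_def)
  from LeastI[of P, OF this] obtain u where u: "u \<noteq> 0" "ipoly u a = 0" "degree u = (LEAST d. P d)"
    by (auto simp: P_def)
  have min: "degree u \<le> degree r" if "r \<noteq> 0" "ipoly r a = 0" for r
    unfolding u(3) by (rule Least_le) (use that in \<open>auto simp: P_def\<close>)
  have pe: "prime_elem p" using p(1) by (rule irreducible_imp_prime_elem)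
  have dp: "degree p > 0" by (rule irreducible_root_degree[OF p])
  have dvd: "\<exists>c s. c \<noteq> 0 \<and> Polynomial.smult c r = u * s" if r: "ipoly r a = 0" for r
  proof -
    obtain s t where st: "pseudo_divmod r u = (s, t)" by fastforce
    define c where "c = lead_coeff u ^ (Suc (degree r) - degree u)"
    from pseudo_divmod[OF u(1) st] have 1: "Polynomial.smult c r = u * s + t" "t = 0 \<or> degree t < degree u"
      by (auto simp: c_def)
    have "ipoly (Polynomial.smult c r) a = 0" using r by (simp add: hom_distribs)
    hence "ipoly t a = 0" unfolding 1 using u(2) by (simp add: hom_distribs)
    hence "t = 0" using 1(2) min[of t] by force
    moreover have "c \<noteq> 0" using u(1) by (simp add: c_def)
    ultimately show ?thesis using 1 by auto
  qed
  have nc: "\<not> p dvd [:c:]" if "c \<noteq> 0" for c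
    using dvd_imp_degree_le[of p "[:c:]"] that dp by auto
  have key: "p dvd r" if "c \<noteq> 0" "p dvd Polynomial.smult c r" for c r
  proof -
    have "p dvd [:c:] * r" using that by simp
    thus ?thesis using prime_elem_dvd_multD[OF pe] nc[OF that(1)] by blast
  qed
  obtain c s where cs: "c \<noteq> 0" "Polynomial.smult c p = u * s" using dvd[OF p(2)] by blast
  have s0: "s \<noteq> 0" using cs p(1) by auto
  have deg: "degree p = degree u + degree s" using cs s0 u(1)
    by (metis degree_mult_eq degree_smult_eq)
  have "degree u > 0"
  proof (rule ccontr)
    assume "\<not> degree u > 0"
    then obtain c where "u = [:c:]" by (auto elim: degree_eq_zeroE)
    thus False using u by auto
  qed
  hence "\<not> p dvd s" using dvd_imp_degree_le[of p s] s0 deg by auto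
  moreover have "p dvd u * s" using dvd_smult[of p p c] cs(2) by simp
  ultimately have pu: "p dvd u" using prime_elem_dvd_multD[OF pe] by blast
  obtain c s where "c \<noteq> 0" "Polynomial.smult c q = u * s" using dvd[OF q] by blast
  thus ?thesis using pu key by (metis dvd_mult2)
qed

text \<open>The primitive part of a polynomial of least degree works: in a factorisation one factor
  vanishes at \<open>a\<close>, has full degree by minimality, and leaves a constant that divides
  the content 1. A sign makes the leading coefficient positive.\<close>

lemma irreducible_root_exists:
  assumes "algebraic a"
  shows "\<exists>p::int poly. irreducible p \<and> lead_coeff p > 0 \<and> ipoly p a = 0"
proof -
  define P where "P = (\<lambda>d. \<exists>r::int poly. r \<noteq> 0 \<and> ipoly r a = 0 \<and> degree r = d)"
  obtain p where p: "p \<noteq> 0" "ipoly p a = 0"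
    using assms unfolding algebraic_iff_int_poly by auto
  hence "P (degree p)" by (auto simp: P_def)
  from LeastI[of P, OF this] obtain u where u: "u \<noteq> 0" "ipoly u a = 0" "degree u = (LEAST d. P d)"
    by (auto simp: P_def)
  have min: "degree u \<le> degree r" if "r \<noteq> 0" "ipoly r a = 0" for r
    unfolding u(3) by (rule Least_le) (use that in \<open>auto simp: P_def\<close>)
  define w where "w = primitive_part u"
  have uw: "u = Polynomial.smult (content u) w" by (simp add: w_def)
  have w: "w \<noteq> 0" "content w = 1" "degree w = degree u" using u(1) by (auto simp: w_def content_primitive_part)
  have "ipoly (Polynomial.smult (content u) w) a = 0" using u(2) uw by simp
  hence wr: "ipoly w a = 0" using u(1) by (simp add: hom_distribs)
  have dw: "degree w > 0"
  proof (rule ccontr)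
    assume "\<not> degree w > 0"
    then obtain c where "w = [:c:]" by (auto elim: degree_eq_zeroE)
    thus False using w wr by auto
  qed
  have unit: "is_unit t" if st: "w = s * t" "ipoly s a = 0" for s t
  proof -
    have "s \<noteq> 0" "t \<noteq> 0" using st w by auto
    hence "degree t = 0" using min[of s] st w(3) by (simp add: degree_mult_eq)
    then obtain c where c: "t = [:c:]" by (auto elim: degree_eq_zeroE)
    hence "c dvd content w" using st by simp
    thus ?thesis using c w by auto
  qed
  have irr: "irreducible w"
  proof (rule irreducibleI)
    show "w \<noteq> 0" by (fact w)
    show "\<not> is_unit w" using dw by (auto simp: is_unit_poly_iff)
    fix s t assume st: "w = s * t"
    hence "ipoly s a = 0 \<or> ipoly t a = 0" using wr by (simp add: hom_distribs)
    thus "is_unit s \<or> is_unit t" using unit[of s t] unit[of t s] st by (auto simp: mult.commute)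
  qed
  show ?thesis
  proof (cases "lead_coeff w > 0")
    case True thus ?thesis using irr wr by blast
  next
    case False
    moreover have "lead_coeff w \<noteq> 0" using w(1) by (rule leading_coeff_neq_0)
    ultimately have "lead_coeff (-w) > 0" by (simp del: leading_coeff_0_iff)
    moreover have "irreducible (-w)" using irr irreducible_mult_unit_left[of "-1" w] by simp
    ultimately show ?thesis using wr by (intro exI[of _ "-w"]) (auto simp: hom_distribs)
  qed
qed

lemma irreducible_root_unique:
  assumes "irreducible (p::int poly)" "lead_coeff p > 0" "ipoly p a = 0"
    and "irreducible q" "lead_coeff q > 0" "ipoly q a = 0"
  shows "p = q"
proof -
  have "p dvd q" "q dvd p" using irreducible_root_dvd assms by auto
  then obtain s where s: "q = p * s" by (auto elim: dvdE)
  with \<open>q dvd p\<close> assms have "s dvd 1" by auto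
  then obtain c where c: "s = [:c:]" "c dvd 1" by (auto simp: is_unit_poly_iff)
  hence "c = 1 \<or> c = -1" by auto
  thus ?thesis using s c assms by auto
qed

lemma min_int_poly:
  assumes "algebraic a"
  shows "irreducible (min_int_poly a)" "lead_coeff (min_int_poly a) > 0" "ipoly (min_int_poly a) a = 0"
proof -
  have "\<exists>!p. irreducible p \<and> lead_coeff p > 0 \<and> ipoly p a = 0"
    using irreducible_root_exists[OF assms] irreducible_root_unique by blast
  from theI'[OF this] show "irreducible (min_int_poly a)" "lead_coeff (min_int_poly a) > 0" "ipoly (min_int_poly a) a = 0"
    unfolding min_int_poly_def by auto
qed

lemma min_int_poly_dvd:
  "algebraic a \<Longrightarrow> ipoly q a = 0 \<Longrightarrow> min_int_poly a dvd q"
  using irreducible_root_dvd min_int_poly by blast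

lemma degree_min_int_poly: "algebraic a \<Longrightarrow> degree (min_int_poly a) > 0"
  using irreducible_root_degree min_int_poly by blast

lemma algebraic_conj:
  assumes "algebraic a" "ipoly (min_int_poly a) b = 0" shows "algebraic b"
  unfolding algebraic_iff_int_poly using assms min_int_poly[OF assms(1)] by (intro exI[of _ "min_int_poly a"]) auto

lemma lead_coeff_algebraic_int:
  assumes "algebraic_int a" shows "lead_coeff (min_int_poly a) = 1"
proof -
  obtain q :: "int poly" where q: "lead_coeff q = 1" "ipoly q a = 0"
    using assms unfolding algebraic_int_iff_monic by auto
  have alg: "algebraic a" using assms by auto
  from min_int_poly_dvd[OF alg q(2)] have "lead_coeff (min_int_poly a) dvd lead_coeff q"
    by (auto simp: lead_coeff_mult)
  thus ?thesis using q(1) min_int_poly(2)[OF alg] by simp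
qed

lemma algebraic_int_lead_mult:
  assumes "ipoly p a = 0" "degree p > 0"
  shows "algebraic_int (of_int (lead_coeff p) * a)"
proof -
  define d l where "d = degree p" and "l = lead_coeff p"
  obtain e where e: "d = Suc e" using assms(2) by (cases d) (auto simp: d_def)
  \<comment> \<open>This is \<open>l ^ e * p(x / l)\<close>: monic of degree \<open>d\<close>, with
    integer coefficients, and \<open>l * a\<close> is a root.\<close>
  define q where "q = (\<Sum>i\<le>e. Polynomial.monom (coeff p i * l ^ (e - i)) i) + Polynomial.monom 1 d"
  have cq: "coeff q j = (if j \<le> e then coeff p j * l ^ (e - j) else if j = d then 1 else 0)" for j
    by (auto simp: q_def coeff_sum e)
  have dq: "degree q = d" by (rule antisym, rule degree_le, (use cq e in auto)[1], rule le_degree) (use cq e in auto)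
  have "ipoly q (of_int l * a) = (\<Sum>i\<le>d. of_int (coeff q i) * (of_int l * a) ^ i)"
    by (simp add: poly_altdef dq)
  also have "\<dots> = (\<Sum>i\<le>d. of_int l ^ e * (of_int (coeff p i) * a ^ i))"
  proof (rule sum.cong[OF refl])
    fix i assume "i \<in> {..d}"
    show "of_int (coeff q i) * (of_int l * a) ^ i = of_int l ^ e * (of_int (coeff p i) * a ^ i)"
    proof (cases "i \<le> e")
      case True
      hence "of_int l ^ e = (of_int l ^ (e - i) * of_int l ^ i :: complex)" by (simp flip: power_add)
      thus ?thesis using True by (simp add: cq power_mult_distrib)
    next
      case False
      hence "i = Suc e" using \<open>i \<in> {..d}\<close> e by auto
      moreover have "coeff p (Suc e) = l" by (simp add: l_def d_def[symmetric] e[symmetric])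
      ultimately show ?thesis using e by (simp add: cq power_mult_distrib)
    qed
  qed
  also have "\<dots> = of_int l ^ e * ipoly p a" by (simp add: poly_altdef sum_distrib_left d_def)
  finally show ?thesis unfolding algebraic_int_iff_monic l_def[symmetric]
    using assms dq cq e by (intro exI[of _ q]) auto
qed

text \<open>Every summand of the height is nonnegative, the leading coefficient being at least 1, so
  the whole dominates each summand.\<close>

lemma weil_height_bounds:
  assumes a: "algebraic a"
  shows ln_lead_le_height: "ln (real_of_int (lead_coeff (min_int_poly a))) \<le> degree (min_int_poly a) * weil_height a"
    and ln_conj_le_height: "\<And>b. ipoly (min_int_poly a) b = 0 \<Longrightarrow> ln (max 1 (cmod b)) \<le> degree (min_int_poly a) * weil_height a"
    and weil_height_nonneg: "weil_height a \<ge> 0"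
proof -
  define p where "p = min_int_poly a"
  have p: "irreducible p" "lead_coeff p > 0" "degree p > 0"
    using min_int_poly[OF a] degree_min_int_poly[OF a] by (auto simp: p_def)
  have l: "ln (real_of_int (lead_coeff p)) \<ge> 0" using p(2) by (intro ln_ge_zero) linarith
  define Z where "Z = {z. ipoly p z = 0}"
  have fin: "finite Z" unfolding Z_def using p by (intro poly_roots_finite) auto
  have nn: "ln (max 1 (cmod z)) \<ge> 0" for z by simp
  have eq: "degree p * weil_height a = ln (real_of_int (lead_coeff p)) + (\<Sum>z\<in>Z. ln (max 1 (cmod z)))"
    using p(3) unfolding weil_height_def Let_def p_def[symmetric] Z_def by simp
  have s: "(\<Sum>z\<in>Z. ln (max 1 (cmod z))) \<ge> 0" using nn by (intro sum_nonneg) auto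
  show "ln (real_of_int (lead_coeff (min_int_poly a))) \<le> degree (min_int_poly a) * weil_height a"
    using eq s by (simp add: p_def)
  show "ln (max 1 (cmod b)) \<le> degree (min_int_poly a) * weil_height a" if "ipoly (min_int_poly a) b = 0" for b
  proof -
    have "b \<in> Z" using that by (simp add: Z_def p_def)
    from member_le_sum[OF this _ fin, of "\<lambda>z. ln (max 1 (cmod z))"] nn show ?thesis using eq l by (simp add: p_def)
  qed
  have "degree p * weil_height a \<ge> 0" using eq s l by linarith
  thus "weil_height a \<ge> 0" using p(3) by (simp add: zero_le_mult_iff)
qed

section \<open>Conjugation of algebraic numbers\<close>

text \<open>An embedding of the field of algebraic numbers into the complex numbers, written as a
  total function with arbitrary values at transcendental arguments. Extension to an automorphism of
  all complex numbers is thereby avoided.\<close>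

definition alg_hom :: "(complex \<Rightarrow> complex) \<Rightarrow> bool" where
  "alg_hom s \<longleftrightarrow> s 1 = 1 \<and> (\<forall>a b. algebraic a \<longrightarrow> algebraic b \<longrightarrow> s (a + b) = s a + s b \<and> s (a * b) = s a * s b)"

text \<open>Partial homomorphisms are kept as graphs, so that unions of chains are immediate. Only
  the fibre over 0 is controlled; by additivity this already makes the graph single-valued.\<close>

definition hom_graph :: "(complex \<times> complex) set \<Rightarrow> bool" where
  "hom_graph G \<longleftrightarrow> (\<forall>x y. (x,y) \<in> G \<longrightarrow> algebraic x) \<and> (\<forall>q. (of_rat q, of_rat q) \<in> G) \<and>
     (\<forall>x y x' y'. (x,y) \<in> G \<longrightarrow> (x',y') \<in> G \<longrightarrow> (x + x', y + y') \<in> G \<and> (x * x', y * y') \<in> G) \<and>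
     (\<forall>y. (0,y) \<in> G \<longrightarrow> y = 0)"

lemma map_poly_of_rat_mult:
  "map_poly (of_rat :: rat \<Rightarrow> complex) (p * q) = map_poly of_rat p * map_poly of_rat q"
  by (intro poly_eqI) (simp add: coeff_map_poly coeff_mult of_rat_sum of_rat_mult)

lemma rat_poly_clear:
  "\<exists>k q. k > (0::int) \<and> (\<forall>x. ipoly q x = of_int k * poly (map_poly of_rat r) x)"
proof (induction r)
  case 0
  show ?case by (rule exI[of _ 1], rule exI[of _ 0]) auto
next
  case (pCons c r)
  then obtain k q where kq: "k > (0::int)" "\<And>x. ipoly q x = of_int k * poly (map_poly of_rat r) x" by blast
  obtain a b where ab: "quotient_of c = (a, b)" by fastforce
  have b: "b > 0" using quotient_of_denom_pos[OF ab] .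
  have c: "c = of_int a / of_int b" using quotient_of_div[OF ab] .
  show ?case
  proof (intro exI conjI allI)
    show "b * k > 0" using b kq by simp
    fix x
    show "ipoly (pCons (a * k) (Polynomial.smult b q)) x = of_int (b * k) * poly (map_poly of_rat (pCons c r)) x"
      using b by (simp add: hom_distribs kq(2) c of_rat_divide field_simps)
  qed
qed

section \<open>Maximal partial homomorphisms are defined at every algebraic number\<close>

locale maximal_hom_graph =
  fixes G assumes G: "hom_graph G" and max: "\<And>G'. hom_graph G' \<Longrightarrow> G \<subseteq> G' \<Longrightarrow> G' = G"
begin

definition "L = Domain G"
definition "s x = (if x \<in> L then SOME y. (x,y) \<in> G else 0)"

lemma G_add: "(x,y) \<in> G \<Longrightarrow> (x',y') \<in> G \<Longrightarrow> (x + x', y + y') \<in> G"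
  and G_mult: "(x,y) \<in> G \<Longrightarrow> (x',y') \<in> G \<Longrightarrow> (x * x', y * y') \<in> G"
  and G_rat: "(of_rat q, of_rat q) \<in> G"
  and G_0: "(0,y) \<in> G \<Longrightarrow> y = 0"
  and G_alg: "(x,y) \<in> G \<Longrightarrow> algebraic x"
  using G unfolding hom_graph_def by (simp, simp, simp, simp, blast)

lemma single_valued: assumes "(x,y) \<in> G" "(x,y') \<in> G" shows "y = y'"
proof -
  have "(-1 * x, -1 * y') \<in> G" using G_mult[OF G_rat[of "-1"] assms(2)] by simp
  from G_0[OF G_add[OF assms(1) this, simplified]] show ?thesis by simp
qed

lemma s_eq: "(x,y) \<in> G \<Longrightarrow> s x = y"
  unfolding s_def L_def by (metis Domain.DomainI single_valued someI)
lemma s_in: "x \<in> L \<Longrightarrow> (x, s x) \<in> G"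
  using s_eq unfolding L_def by blast
lemma L_add: "x \<in> L \<Longrightarrow> y \<in> L \<Longrightarrow> x + y \<in> L" and L_mult: "x \<in> L \<Longrightarrow> y \<in> L \<Longrightarrow> x * y \<in> L"
  using G_add G_mult unfolding L_def by (blast, blast)
lemma L_rat: "of_rat q \<in> L" using G_rat unfolding L_def by blast
lemma L_0: "0 \<in> L" and L_1: "1 \<in> L" using L_rat[of 0] L_rat[of 1] by auto
lemma L_uminus: "x \<in> L \<Longrightarrow> - x \<in> L" using L_mult[OF L_rat[of "-1"], of x] by simp
lemma L_sum: "(\<And>i. i \<in> A \<Longrightarrow> f i \<in> L) \<Longrightarrow> sum f A \<in> L"
  by (induction A rule: infinite_finite_induct) (auto intro: L_add L_0)
lemma s_add: "x \<in> L \<Longrightarrow> y \<in> L \<Longrightarrow> s (x + y) = s x + s y"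
  and s_mult: "x \<in> L \<Longrightarrow> y \<in> L \<Longrightarrow> s (x * y) = s x * s y"
  and s_rat: "s (of_rat q) = of_rat q"
  by (intro s_eq G_add G_mult G_rat s_in; assumption)+
lemma s_0 [simp]: "s 0 = 0" and s_1: "s 1 = 1" using s_rat[of 0] s_rat[of 1] by auto
lemma s_sum: "(\<And>i. i \<in> A \<Longrightarrow> f i \<in> L) \<Longrightarrow> s (sum f A) = (\<Sum>i\<in>A. s (f i))"
  by (induction A rule: infinite_finite_induct) (auto simp: s_add L_sum)

lemma L_ipoly: "x \<in> L \<Longrightarrow> ipoly p x \<in> L"
proof (induction p)
  case (pCons c p)
  have "of_int c \<in> L" using L_rat[of "of_int c"] by simp
  thus ?case using pCons by (simp add: hom_distribs L_add L_mult)
qed (simp add: L_0)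

text \<open>The minimal polynomial \<open>pCons c r\<close> has \<open>c\<close> nonzero, since
  otherwise irreducibility leaves only a unit multiple of the indeterminate and
  \<open>x = 0\<close>. Then \<open>x * r(x) = - c\<close> expresses the inverse as a rational
  polynomial in \<open>x\<close>.\<close>

lemma L_inverse: assumes "x \<in> L" shows "inverse x \<in> L"
proof (cases "x = 0")
  case False
  have alg: "algebraic x" using G_alg s_in[OF assms] by blast
  define p where "p = min_int_poly x"
  have p: "irreducible p" "ipoly p x = 0" using min_int_poly[OF alg] by (auto simp: p_def)
  obtain c r where cr: "p = pCons c r" by (cases p)
  have "c \<noteq> 0"
  proof
    assume "c = 0"
    hence "p = [:0,1:] * r" by (simp add: cr)
    hence "is_unit [:0,1::int:] \<or> is_unit r" using p(1) unfolding irreducible_def by blast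
    hence "is_unit r" by (auto simp: is_unit_poly_iff)
    then obtain d where "r = [:d:]" "is_unit d" by (auto simp: is_unit_poly_iff)
    thus False using p(2) False by (auto simp: cr \<open>c = 0\<close>)
  qed
  moreover have "x * ipoly r x = - of_int c" using p(2) by (simp add: cr hom_distribs eq_neg_iff_add_eq_0 add.commute)
  ultimately have "inverse x = - ipoly r x * of_rat (1 / of_int c)"
    using False by (simp add: field_simps of_rat_divide)
  thus ?thesis using assms by (auto intro!: L_mult L_uminus L_ipoly L_rat)
qed (simp add: L_0)

definition "PL = {p. \<forall>i. coeff p i \<in> L}"

lemma PL_add: "p \<in> PL \<Longrightarrow> q \<in> PL \<Longrightarrow> p + q \<in> PL" and PL_mult: "p \<in> PL \<Longrightarrow> q \<in> PL \<Longrightarrow> p * q \<in> PL"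
  by (auto simp: PL_def L_add coeff_mult intro!: L_sum L_mult)
lemma map_add: "p \<in> PL \<Longrightarrow> q \<in> PL \<Longrightarrow> map_poly s (p + q) = map_poly s p + map_poly s q"
  by (intro poly_eqI) (simp add: coeff_map_poly PL_def s_add)
lemma map_mult: "p \<in> PL \<Longrightarrow> q \<in> PL \<Longrightarrow> map_poly s (p * q) = map_poly s p * map_poly s q"
  by (intro poly_eqI) (simp add: coeff_map_poly PL_def coeff_mult s_sum L_mult s_mult)

text \<open>The step of the classical extension theorem. Let \<open>u\<close> be monic of least
  degree over the field \<open>L\<close> with \<open>u(b) = 0\<close>, and let \<open>c\<close> be a
  root of its image under \<open>s\<close>. Sending \<open>p(b)\<close> to the value at
  \<open>c\<close> of the image of \<open>p\<close> is well defined and extends \<open>G\<close>, so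
  maximality puts \<open>b\<close> into the domain.\<close>

lemma extend: assumes b: "algebraic b" shows "b \<in> L"
proof -
  define P where "P = (\<lambda>d. \<exists>r\<in>PL. r \<noteq> 0 \<and> poly r b = 0 \<and> degree r = d)"
  obtain p0 :: "rat poly" where p0: "lead_coeff p0 = 1" "poly (map_poly of_rat p0) b = 0"
    using b unfolding algebraic_iff_monic by blast
  hence "P (degree (map_poly of_rat p0 :: complex poly))" unfolding P_def
    by (intro bexI[of _ "map_poly of_rat p0"]) (auto simp: PL_def coeff_map_poly L_rat)
  from LeastI[of P, OF this] obtain v where v: "v \<in> PL" "v \<noteq> 0" "poly v b = 0" "degree v = (LEAST d. P d)"
    by (auto simp: P_def)
  have min: "degree v \<le> degree r" if "r \<noteq> 0" "poly r b = 0" "r \<in> PL" for r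
    unfolding v(4) by (rule Least_le) (use that in \<open>auto simp: P_def\<close>)
  define u where "u = Polynomial.smult (inverse (lead_coeff v)) v"
  have u: "u \<in> PL" "poly u b = 0" "lead_coeff u = 1" "degree u = degree v"
    using v(1-3) leading_coeff_neq_0[OF v(2)]
    by (simp_all add: u_def PL_def L_mult L_inverse del: leading_coeff_0_iff)
  have du: "degree u > 0"
  proof (rule ccontr)
    assume "\<not> degree u > 0"
    hence "u = [:lead_coeff u:]" by (auto elim: degree_eq_zeroE)
    hence "poly u b = lead_coeff u" by (metis poly_const_conv)
    thus False using u by auto
  qed
  define u' where "u' = map_poly s u"
  have "coeff u' (degree u) = 1" using u by (simp add: u'_def coeff_map_poly s_1)
  hence "degree u' > 0" using du le_degree[of u' "degree u"] by auto
  then obtain c where c: "poly u' c = 0"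
    using Fundamental_Theorem_Algebra.fundamental_theorem_of_algebra[of u'] by (auto simp: constant_degree)
  \<comment> \<open>Well-definedness: subtracting multiples of the monic \<open>u\<close> lowers the
    degree and keeps the value at \<open>b\<close>, and below the degree of \<open>u\<close> only 0
    vanishes at \<open>b\<close>.\<close>
  have vanish: "poly (map_poly s p) c = 0" if "p \<in> PL" "poly p b = 0" for p
    using that
  proof (induction "degree p" arbitrary: p rule: less_induct)
    case less
    show ?case
    proof (cases "p = 0")
      case False
      define e where "e = degree p - degree u"
      have de: "degree p = e + degree u" using min[OF False less.prems(2,1)] u(4) by (simp add: e_def)
      define t where "t = Polynomial.monom (lead_coeff p) e"
      have t: "t \<in> PL" using less.prems by (auto simp: t_def PL_def L_0)
      define q where "q = p - t * u"
      have q: "q = p + (- t) * u" by (simp add: q_def)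
      have mt: "-t \<in> PL" using t by (auto simp: PL_def L_uminus)
      have qP: "q \<in> PL" unfolding q using less.prems mt u by (intro PL_add PL_mult)
      have q0: "poly q b = 0" using less.prems u by (simp add: q_def)
      have lp: "lead_coeff p \<noteq> 0" using False by (rule leading_coeff_neq_0)
      hence dt: "degree t = e" "lead_coeff t = lead_coeff p" by (simp_all add: t_def degree_monom_eq)
      have t0: "t \<noteq> 0" "u \<noteq> 0" using dt(2) lp u(3) by auto
      have tu: "degree (t * u) = degree p" by (simp add: degree_mult_eq[OF t0] de dt)
      have "lead_coeff (t * u) = lead_coeff p" by (simp add: lead_coeff_mult u(3) dt(2))
      hence tu2: "coeff (t * u) (degree p) = lead_coeff p" by (simp add: tu)
      have "q = 0 \<or> degree q < degree p"
      proof (cases "degree p = 0")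
        case True thus ?thesis using de du by simp
      next
        case F: False
        have "degree q \<le> degree p" unfolding q_def by (rule degree_diff_le) (auto simp: tu)
        moreover have "coeff q (degree p) = 0" using tu2 by (simp add: q_def)
        ultimately show ?thesis by (metis le_neq_implies_less leading_coeff_0_iff)
      qed
      hence "poly (map_poly s q) c = 0" using less.hyps[of q] qP q0 by auto
      moreover have "p = q + t * u" by (simp add: q_def)
      hence "map_poly s p = map_poly s q + map_poly s t * u'" unfolding u'_def
        by (metis map_add map_mult PL_mult qP t u(1))
      ultimately show ?thesis using c by simp
    qed simp
  qed
  define G' where "G' = (\<lambda>p. (poly p b, poly (map_poly s p) c)) ` PL"
  have G'I: "p \<in> PL \<Longrightarrow> (poly p b, poly (map_poly s p) c) \<in> G'" for p by (auto simp: G'_def)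
  have const: "x \<in> L \<Longrightarrow> [:x:] \<in> PL" for x by (auto simp: PL_def coeff_pCons L_0 split: nat.splits)
  have sub: "G \<subseteq> G'"
  proof
    fix z assume "z \<in> G"
    then obtain x y where z: "z = (x,y)" "(x,y) \<in> G" by (cases z) auto
    have "x \<in> L" using z by (auto simp: L_def)
    from G'I[OF const[OF this]] show "z \<in> G'" using z s_eq[OF z(2)] by (cases "x = 0") (simp_all add: map_poly_pCons)
  qed
  have L_alg: "algebraic x" if "x \<in> L" for x using G_alg s_in[OF that] by blast
  have PL_alg: "algebraic (poly p b)" if "p \<in> PL" for p
    unfolding poly_altdef using that
    by (intro algebraic_sum algebraic_mult algebraic_power b L_alg) (auto simp: PL_def)
  have "hom_graph G'" unfolding hom_graph_def
  proof (intro conjI allI impI)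
    show "algebraic x" if "(x,y) \<in> G'" for x y using that PL_alg by (auto simp: G'_def)
    show "(of_rat q, of_rat q) \<in> G'" for q using sub G_rat by blast
    show "y = 0" if "(0,y) \<in> G'" for y using that vanish by (auto simp: G'_def)
    fix x y x' y' assume "(x,y) \<in> G'" "(x',y') \<in> G'"
      then obtain p q where pq: "p \<in> PL" "q \<in> PL" "x = poly p b" "y = poly (map_poly s p) c"
        "x' = poly q b" "y' = poly (map_poly s q) c" by (auto simp: G'_def)
      show "(x + x', y + y') \<in> G'" using G'I[OF PL_add[OF pq(1,2)]] pq by (simp add: map_add)
      show "(x * x', y * y') \<in> G'" using G'I[OF PL_mult[OF pq(1,2)]] pq by (simp add: map_mult)
  qed
  from max[OF this sub] have "G' = G" .
  moreover have "[:0,1:] \<in> PL" by (auto simp: PL_def coeff_pCons L_0 L_1 split: nat.splits)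
  from G'I[OF this] have "b \<in> Domain G'" by auto
  ultimately show ?thesis by (simp add: L_def)
qed

lemma alg_hom_s: "alg_hom s"
  unfolding alg_hom_def using s_1 s_add s_mult extend by blast

end

text \<open>Sending \<open>r(a)\<close> to \<open>r(b)\<close> for rational polynomials
  \<open>r\<close> is a partial homomorphism, because \<open>min_int_poly a\<close> divides every
  integer polynomial that vanishes at \<open>a\<close>. Zorn's lemma extends it to a maximal
  one.\<close>

lemma alg_hom_conj_exists:
  assumes a: "algebraic a" and b: "ipoly (min_int_poly a) b = 0"
  obtains s where "alg_hom s" "s a = b"
proof -
  define G0 where "G0 = range (\<lambda>r::rat poly. (poly (map_poly of_rat r) a, poly (map_poly of_rat r) b))"
  have G0I: "(poly (map_poly of_rat r) a, poly (map_poly of_rat r) b) \<in> G0" for r by (auto simp: G0_def)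
  have "hom_graph G0" unfolding hom_graph_def
  proof (intro conjI allI impI)
    show "algebraic x" if "(x,y) \<in> G0" for x y using that
      by (auto simp: G0_def poly_altdef coeff_map_poly intro!: algebraic_sum algebraic_mult[OF rat_imp_algebraic algebraic_power[OF a]])
    show "(of_rat q, of_rat q) \<in> G0" for q using G0I[of "[:q:]"] by (simp add: hom_distribs)
    show "y = 0" if y: "(0,y) \<in> G0" for y
    proof -
      obtain r where r: "poly (map_poly of_rat r) a = 0" "y = poly (map_poly of_rat r) b"
        using y by (auto simp: G0_def)
      obtain k q where kq: "k > (0::int)" "\<And>x. ipoly q x = of_int k * poly (map_poly of_rat r) x"
        using rat_poly_clear by blast
      have "min_int_poly a dvd q" using min_int_poly_dvd[OF a, of q] kq r by simp
      then obtain t where "q = min_int_poly a * t" by (auto elim: dvdE)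
      hence "ipoly q b = 0" using b by (simp add: hom_distribs)
      thus ?thesis using kq r by simp
    qed
    fix x y x' y' assume "(x,y) \<in> G0" "(x',y') \<in> G0"
      then obtain p q where pq: "x = poly (map_poly of_rat p) a" "y = poly (map_poly of_rat p) b"
        "x' = poly (map_poly of_rat q) a" "y' = poly (map_poly of_rat q) b" by (auto simp: G0_def)
      show "(x + x', y + y') \<in> G0" using G0I[of "p + q"] pq by (simp add: hom_distribs)
      show "(x * x', y * y') \<in> G0" using G0I[of "p * q"] pq by (simp add: map_poly_of_rat_mult)
  qed
  have "\<exists>M\<in>{G. hom_graph G \<and> G0 \<subseteq> G}. \<forall>X\<in>{G. hom_graph G \<and> G0 \<subseteq> G}. M \<subseteq> X \<longrightarrow> X = M"
  proof (rule subset_Zorn_nonempty)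
    show "{G. hom_graph G \<and> G0 \<subseteq> G} \<noteq> {}" using \<open>hom_graph G0\<close> by auto
    fix C assume C: "C \<noteq> {}" "subset.chain {G. hom_graph G \<and> G0 \<subseteq> G} C"
    have hg: "hom_graph G" if "G \<in> C" for G using C that by (auto simp: subset_chain_def)
    have tot: "\<exists>G\<in>C. z \<in> G \<and> z' \<in> G" if "z \<in> \<Union>C" "z' \<in> \<Union>C" for z z'
    proof -
      obtain X Y where XY: "X \<in> C" "z \<in> X" "Y \<in> C" "z' \<in> Y" using \<open>z \<in> \<Union>C\<close> \<open>z' \<in> \<Union>C\<close> by blast
      hence "X \<subseteq> Y \<or> Y \<subseteq> X" using C(2) unfolding subset_chain_def by blast
      thus ?thesis using XY by blast
    qed
    have "hom_graph (\<Union>C)" unfolding hom_graph_def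
    proof (intro conjI allI impI)
      show "algebraic x" if "(x,y) \<in> \<Union>C" for x y using hg that unfolding hom_graph_def by blast
      show "(of_rat q, of_rat q) \<in> \<Union>C" for q using hg C(1) unfolding hom_graph_def by blast
      show "y = 0" if "(0,y) \<in> \<Union>C" for y using hg that unfolding hom_graph_def by blast
      fix x y x' y' assume "(x,y) \<in> \<Union>C" "(x',y') \<in> \<Union>C"
      from tot[OF this] obtain G where G: "G \<in> C" "(x,y) \<in> G" "(x',y') \<in> G" by blast
      hence "(x + x', y + y') \<in> G \<and> (x * x', y * y') \<in> G"
        using hg[of G] unfolding hom_graph_def by blast
      thus "(x + x', y + y') \<in> \<Union>C" "(x * x', y * y') \<in> \<Union>C" using G(1) by blast+
    qed
    moreover have "G0 \<subseteq> \<Union>C" using C unfolding subset_chain_def by blast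
    ultimately show "\<Union>C \<in> {G. hom_graph G \<and> G0 \<subseteq> G}" by simp
  qed
  then obtain M where M1: "M \<in> {G. hom_graph G \<and> G0 \<subseteq> G}"
    and M2: "\<forall>X\<in>{G. hom_graph G \<and> G0 \<subseteq> G}. M \<subseteq> X \<longrightarrow> X = M" by (rule bexE)
  hence M: "hom_graph M" "G0 \<subseteq> M" by simp_all
  interpret maximal_hom_graph M
  proof
    show "X = M" if "hom_graph X" "M \<subseteq> X" for X
      using bspec[OF M2, of X] that order_trans[OF M(2) that(2)] by simp
  qed (rule M(1))
  have "(a,b) \<in> G0" using G0I[of "[:0,1:]"] by (simp add: hom_distribs)
  hence "s a = b" using M(2) by (intro s_eq) auto
  thus ?thesis using that alg_hom_s by blast
qed

context
  fixes s assumes s: "alg_hom s"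
begin

lemma alg_hom_1: "s 1 = 1" and alg_hom_add: "algebraic a \<Longrightarrow> algebraic b \<Longrightarrow> s (a + b) = s a + s b"
  and alg_hom_mult: "algebraic a \<Longrightarrow> algebraic b \<Longrightarrow> s (a * b) = s a * s b"
  using s by (auto simp: alg_hom_def)

lemma alg_hom_0: "s 0 = 0" using alg_hom_add[of 0 0] by simp

lemma alg_hom_uminus: "algebraic a \<Longrightarrow> s (- a) = - s a"
  using alg_hom_add[of a "-a"] alg_hom_0 by (simp add: add_eq_0_iff)

lemma alg_hom_sum: "(\<And>i. i \<in> A \<Longrightarrow> algebraic (f i)) \<Longrightarrow> s (sum f A) = (\<Sum>i\<in>A. s (f i))"
  by (induction A rule: infinite_finite_induct) (auto simp: alg_hom_0 alg_hom_add algebraic_sum)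

lemma alg_hom_power: "algebraic a \<Longrightarrow> s (a ^ k) = s a ^ k"
  by (induction k) (auto simp: alg_hom_1 alg_hom_mult algebraic_power)

lemma alg_hom_of_nat: "s (of_nat k) = of_nat k"
  by (induction k) (auto simp: alg_hom_0 alg_hom_1 alg_hom_add rat_imp_algebraic)

lemma alg_hom_of_int: "s (of_int k) = of_int k"
  by (cases k rule: int_cases2) (auto simp: alg_hom_of_nat alg_hom_uminus rat_imp_algebraic)

lemma alg_hom_ipoly: "algebraic a \<Longrightarrow> s (ipoly p a) = ipoly p (s a)"
  by (simp add: poly_altdef alg_hom_sum alg_hom_mult algebraic_mult algebraic_power alg_hom_of_int
      alg_hom_power rat_imp_algebraic)

lemma alg_hom_conj: "algebraic a \<Longrightarrow> ipoly (min_int_poly a) (s a) = 0"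
  using alg_hom_ipoly[of a "min_int_poly a"] min_int_poly[of a] alg_hom_0 by simp

lemma alg_hom_algebraic: "algebraic a \<Longrightarrow> algebraic (s a)"
  using alg_hom_conj algebraic_conj by blast

lemma alg_hom_eq_0: "algebraic a \<Longrightarrow> s a = 0 \<longleftrightarrow> a = 0"
proof -
  assume a: "algebraic a"
  have "a = 0" if "s a = 0"
  proof (rule ccontr)
    assume "a \<noteq> 0"
    hence "s (a * inverse a) = 1" by (simp add: alg_hom_1)
    moreover have "s (a * inverse a) = s a * s (inverse a)" using a by (intro alg_hom_mult) auto
    ultimately show False using that by simp
  qed
  thus ?thesis using alg_hom_0 by auto
qed

end

lemma alg_hom_id: "alg_hom id" by (simp add: alg_hom_def)

section \<open>Counting algebraic integers\<close>

text \<open>Each linear factor with a root of modulus at most \<open>B\<close> multiplies the bound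
  on the coefficients by at most \<open>1 + B\<close>.\<close>

lemma coeff_bound_by_roots:
  fixes p :: "complex poly" and B :: real
  assumes "\<And>z. poly p z = 0 \<Longrightarrow> cmod z \<le> B" "B \<ge> 0" "p \<noteq> 0"
  shows "cmod (coeff p i) \<le> cmod (lead_coeff p) * (1 + B) ^ degree p"
  using assms
proof (induction "degree p" arbitrary: p i)
  case 0
  then obtain c where "p = [:c:]" by (metis degree_eq_zeroE)
  thus ?case by (cases i) auto
next
  case (Suc d)
  hence "\<not> constant (poly p)" by (simp add: constant_degree)
  then obtain z where z: "poly p z = 0" using Fundamental_Theorem_Algebra.fundamental_theorem_of_algebra by blast
  then obtain q where q: "p = [:-z, 1:] * q" by (auto simp: poly_eq_0_iff_dvd elim: dvdE)
  have q0: "q \<noteq> 0" using q Suc by auto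
  have dp: "degree p = Suc (degree q)" unfolding q using q0 by (subst degree_mult_eq) auto
  have lp: "lead_coeff p = lead_coeff q" unfolding q by (simp add: lead_coeff_mult del: mult_pCons_left)
  define K where "K = cmod (lead_coeff q) * (1 + B) ^ degree q"
  have cq: "cmod (coeff q j) \<le> K" for j unfolding K_def
    using Suc.hyps(1)[of q j] Suc.hyps(2) Suc.prems q q0 dp by auto
  have K0: "K \<ge> 0" using cq[of 0] norm_ge_zero order_trans by blast
  have zB: "cmod z \<le> B" using Suc.prems z by auto
  have "coeff p i = (case i of 0 \<Rightarrow> 0 | Suc j \<Rightarrow> coeff q j) - z * coeff q i"
    by (simp add: q coeff_pCons split: nat.splits)
  hence "cmod (coeff p i) \<le> cmod (case i of 0 \<Rightarrow> 0 | Suc j \<Rightarrow> coeff q j) + cmod z * cmod (coeff q i)"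
    by (metis norm_mult norm_triangle_ineq4)
  also have "cmod (case i of 0 \<Rightarrow> 0 | Suc j \<Rightarrow> coeff q j) \<le> K" using cq K0 by (auto split: nat.splits)
  also have "cmod z * cmod (coeff q i) \<le> B * K" using zB cq K0 Suc.prems by (intro mult_mono) auto
  also have "K + B * K = cmod (lead_coeff p) * (1 + B) ^ degree p"
    unfolding lp unfolding K_def dp power_Suc by (simp add: algebra_simps)
  finally show ?case by simp
qed

definition bounded_ints :: "nat \<Rightarrow> real \<Rightarrow> complex set" where
  "bounded_ints d B = {x. algebraic_int x \<and> degree (min_int_poly x) \<le> d \<and> (\<forall>s. alg_hom s \<longrightarrow> cmod (s x) \<le> B)}"

text \<open>Northcott's theorem with a count: the minimal polynomials are monic of degree at most
  \<open>d\<close>, their \<open>Suc d\<close> coefficients lie between \<open>-M\<close> and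
  \<open>M\<close>, and each has at most \<open>d\<close> roots. Bounds on all \<open>s x\<close>
  control all roots of the minimal polynomial, since each root arises from some
  \<open>alg_hom\<close>.\<close>

lemma bounded_ints_card:
  assumes B: "B \<ge> 1"
  shows "finite (bounded_ints d B)" "real (card (bounded_ints d B)) \<le> d * (2 * (1 + B) ^ d + 1) ^ Suc d"
proof -
  define M where "M = \<lfloor>(1 + B) ^ d\<rfloor>"
  have "(1 + B) ^ d \<ge> 1" using B by simp
  hence M0: "M \<ge> 0" "real_of_int M \<le> (1 + B) ^ d" unfolding M_def by linarith+
  define LL where "LL = {xs :: int list. set xs \<subseteq> {-M..M} \<and> length xs = Suc d}"
  define PP where "PP = Poly ` LL \<inter> {p. p \<noteq> 0 \<and> degree p \<le> d}"
  have fLL: "finite LL" unfolding LL_def by (rule finite_lists_length_eq) simp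
  have "card LL = card {-M..M} ^ Suc d" unfolding LL_def by (rule card_lists_length_eq) simp
  hence cLL: "real (card LL) = (2 * M + 1) ^ Suc d" using M0 by simp
  have fPP: "finite PP" unfolding PP_def using fLL by auto
  have cPP: "card PP \<le> card LL" unfolding PP_def
    by (rule order_trans[OF card_mono card_image_le]) (use fLL in auto)
  have sub: "bounded_ints d B \<subseteq> (\<Union>p\<in>PP. {x. ipoly p x = 0})"
  proof
    fix x assume x: "x \<in> bounded_ints d B"
    define p where "p = min_int_poly x"
    have ai: "algebraic_int x" and alg: "algebraic x" using x by (auto simp: bounded_ints_def)
    have deg: "degree p \<le> d" using x by (auto simp: bounded_ints_def p_def)
    have lead: "lead_coeff p = 1" using lead_coeff_algebraic_int[OF ai] by (simp add: p_def)
    have p: "p \<noteq> 0" "ipoly p x = 0" using min_int_poly[OF alg] by (auto simp: p_def)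
    have rb: "cmod z \<le> B" if z: "ipoly p z = 0" for z
    proof -
      obtain s where "alg_hom s" "s x = z" using alg_hom_conj_exists[OF alg, of z] z by (auto simp: p_def)
      thus ?thesis using x by (auto simp: bounded_ints_def)
    qed
    have cb: "\<bar>coeff p i\<bar> \<le> M" for i
    proof -
      have "cmod (coeff (map_poly of_int p) i) \<le> cmod (lead_coeff (map_poly of_int p)) * (1 + B) ^ degree (map_poly of_int p :: complex poly)"
        by (rule coeff_bound_by_roots) (use rb B p in auto)
      hence "real_of_int \<bar>coeff p i\<bar> \<le> (1 + B) ^ degree p" by (simp add: lead)
      also have "\<dots> \<le> (1 + B) ^ d" using B deg by (intro power_increasing) auto
      finally show ?thesis unfolding M_def by linarith
    qed
    have "p = Poly (map (coeff p) [0..<Suc d])"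
      using deg by (intro poly_eqI) (auto simp: nth_default_def coeff_eq_0 simp del: upt_Suc)
    moreover have "map (coeff p) [0..<Suc d] \<in> LL" using cb M0 by (auto simp: LL_def abs_le_iff minus_le_iff simp del: upt_Suc)
    ultimately have "p \<in> PP" using p(1) deg unfolding PP_def by blast
    thus "x \<in> (\<Union>p\<in>PP. {x. ipoly p x = 0})" using p(2) by blast
  qed
  have fr: "finite {x. ipoly p x = 0}" "card {x. ipoly p x = 0} \<le> d" if "p \<in> PP" for p
  proof -
    have p: "map_poly of_int p \<noteq> (0::complex poly)" "degree p \<le> d" using that by (auto simp: PP_def)
    show "finite {x. ipoly p x = 0}" by (rule poly_roots_finite[OF p(1)])
    have "card {x. ipoly p x = 0} \<le> degree (map_poly of_int p :: complex poly)"
      by (rule poly_roots_degree[OF p(1)])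
    thus "card {x. ipoly p x = 0} \<le> d" using p(2) by simp
  qed
  have fU: "finite (\<Union>p\<in>PP. {x. ipoly p x = 0})" using fPP fr by auto
  show "finite (bounded_ints d B)" using finite_subset[OF sub fU] .
  have "card (bounded_ints d B) \<le> card (\<Union>p\<in>PP. {x. ipoly p x = 0})" by (rule card_mono[OF fU sub])
  also have "\<dots> \<le> (\<Sum>p\<in>PP. card {x. ipoly p x = 0})" by (rule card_UN_le[OF fPP])
  also have "\<dots> \<le> (\<Sum>p\<in>PP. d)" by (intro sum_mono fr)
  also have "\<dots> \<le> card LL * d" using cPP by simp
  finally have "real (card (bounded_ints d B)) \<le> real (card LL * d)" by (simp only: of_nat_le_iff)
  also have "\<dots> = (2 * real_of_int M + 1) ^ Suc d * d" by (simp add: cLL del: power_Suc)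
  also have "\<dots> \<le> (2 * (1 + B) ^ d + 1) ^ Suc d * d"
    using M0 by (intro mult_right_mono power_mono) auto
  finally show "real (card (bounded_ints d B)) \<le> d * (2 * (1 + B) ^ d + 1) ^ Suc d" by (simp add: mult.commute)
qed

lemma bounded_degree:
  assumes R: "bounded_degree_ring (of_rat :: rat \<Rightarrow> complex) n R" and x: "x \<in> R"
  shows "algebraic x" "degree (min_int_poly x) \<le> n"
proof -
  obtain p :: "rat poly" where p: "degree p = n" "lead_coeff p = 1" "poly (map_poly of_rat p) x = 0"
    using R x unfolding bounded_degree_ring_def by blast
  show alg: "algebraic x" using p by (auto simp: algebraic_iff_monic)
  obtain k q where kq: "k > (0::int)" "\<And>x. ipoly q x = of_int k * poly (map_poly of_rat p) x"
    using rat_poly_clear by blast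
  have "poly (map_poly of_int q) = poly (Polynomial.smult (of_int k) (map_poly of_rat p :: complex poly))"
    using kq by (intro ext) simp
  hence eq: "map_poly of_int q = Polynomial.smult (of_int k) (map_poly of_rat p :: complex poly)"
    by (simp only: poly_eq_poly_eq_iff)
  have "degree q = degree (map_poly of_int q :: complex poly)" by simp
  also have "\<dots> = n" unfolding eq using kq(1) p(1) by simp
  finally have dq: "degree q = n" .
  have "q \<noteq> 0" using eq kq(1) p(2) by auto
  moreover have "min_int_poly x dvd q" using min_int_poly_dvd[OF alg, of q] kq p by simp
  ultimately show "degree (min_int_poly x) \<le> n" using dvd_imp_degree_le dq by blast
qed

context
  fixes n R assumes R: "bounded_degree_ring (of_rat :: rat \<Rightarrow> complex) n R"
begin

lemma bdr_add: "x \<in> R \<Longrightarrow> y \<in> R \<Longrightarrow> x + y \<in> R" and bdr_mult: "x \<in> R \<Longrightarrow> y \<in> R \<Longrightarrow> x * y \<in> R"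
  and bdr_rat: "of_rat q \<in> R"
  using R unfolding bounded_degree_ring_def by auto

lemma bdr_0: "0 \<in> R" and bdr_1: "1 \<in> R" and bdr_of_nat: "of_nat k \<in> R"
  using bdr_rat[of 0] bdr_rat[of 1] bdr_rat[of "of_nat k"] by auto

lemma bdr_uminus: "x \<in> R \<Longrightarrow> - x \<in> R"
  using bdr_mult[OF bdr_rat[of "-1"], of x] by simp

lemma bdr_diff: "x \<in> R \<Longrightarrow> y \<in> R \<Longrightarrow> x - y \<in> R"
  using bdr_add[OF _ bdr_uminus, of x y] by simp

lemma bdr_sum: "(\<And>i. i \<in> A \<Longrightarrow> f i \<in> R) \<Longrightarrow> sum f A \<in> R"
  by (induction A rule: infinite_finite_induct) (auto intro: bdr_0 bdr_add)

lemma bdr_power: "x \<in> R \<Longrightarrow> x ^ k \<in> R"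
  by (induction k) (auto intro: bdr_1 bdr_mult)

end

text \<open>All powers of \<open>x\<close> obey the same bounds on degree and conjugates, so two of
  them agree.\<close>

lemma kronecker_root_of_unity:
  assumes R: "bounded_degree_ring (of_rat :: rat \<Rightarrow> complex) n R" and x: "x \<in> R" "algebraic_int x" "x \<noteq> 0"
    and conj: "\<And>s. alg_hom s \<Longrightarrow> cmod (s x) \<le> 1"
  shows "root_of_unity x"
proof -
  have pw: "x ^ k \<in> R" for k using bdr_power[OF R x(1)] .
  have alg: "algebraic x" using x by auto
  have "range (\<lambda>k. x ^ k) \<subseteq> bounded_ints n 1"
    using bounded_degree[OF R pw] x(2) conj
    by (auto simp: alg bounded_ints_def algebraic_int_power alg_hom_power norm_power intro!: power_le_one)
  hence "finite (range (\<lambda>k. x ^ k))" using bounded_ints_card(1)[of 1 n] finite_subset by auto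
  hence "\<not> inj (\<lambda>k. x ^ k)" using finite_imageD by auto
  then obtain i j where "i \<noteq> j" "x ^ i = x ^ j" unfolding inj_def by blast
  then obtain i j where ij: "i < j" "x ^ i = x ^ j" by (metis linorder_neqE_nat)
  hence "x ^ i * x ^ (j - i) = x ^ i * 1" by (metis le_add_diff_inverse less_imp_le mult.right_neutral power_add)
  hence "x ^ (j - i) = 1" using x(3) by simp
  thus ?thesis unfolding root_of_unity_def using ij(1) by (intro exI[of _ "j - i"]) auto
qed

section \<open>Factorial subrings and polynomials over them\<close>

text \<open>Ring theory is relative to a subset of a type: the rings of polynomials with algebraic
  coefficients in different sets of variables are all subsets of the one type \<open>mpoly\<close>,
  and induction on the variables moves between them.\<close>

definition is_subring :: "'a::comm_ring_1 set \<Rightarrow> bool" where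
  "is_subring S \<longleftrightarrow> 0 \<in> S \<and> 1 \<in> S \<and> (\<forall>a\<in>S. \<forall>b\<in>S. a + b \<in> S \<and> a * b \<in> S \<and> a - b \<in> S)"

definition dvd_in :: "'a::comm_ring_1 set \<Rightarrow> 'a \<Rightarrow> 'a \<Rightarrow> bool" where
  "dvd_in S a b \<longleftrightarrow> (\<exists>c\<in>S. b = a * c)"

definition irreducible_in :: "'a::comm_ring_1 set \<Rightarrow> 'a \<Rightarrow> bool" where
  "irreducible_in S p \<longleftrightarrow> p \<in> S \<and> p \<noteq> 0 \<and> \<not> dvd_in S p 1 \<and>
     (\<forall>a\<in>S. \<forall>b\<in>S. p = a * b \<longrightarrow> dvd_in S a 1 \<or> dvd_in S b 1)"

definition prime_in :: "'a::comm_ring_1 set \<Rightarrow> 'a \<Rightarrow> bool" where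
  "prime_in S p \<longleftrightarrow> p \<in> S \<and> p \<noteq> 0 \<and> \<not> dvd_in S p 1 \<and>
     (\<forall>a\<in>S. \<forall>b\<in>S. dvd_in S p (a * b) \<longrightarrow> dvd_in S p a \<or> dvd_in S p b)"

definition atomic_ring :: "'a::comm_ring_1 set \<Rightarrow> bool" where
  "atomic_ring S \<longleftrightarrow> (\<forall>a\<in>S. a \<noteq> 0 \<longrightarrow> (\<exists>ps u. a = u * prod_list ps \<and> u \<in> S \<and> dvd_in S u 1 \<and> (\<forall>p\<in>set ps. irreducible_in S p)))"

definition irreducibles_prime :: "'a::comm_ring_1 set \<Rightarrow> bool" where
  "irreducibles_prime S \<longleftrightarrow> (\<forall>p. irreducible_in S p \<longrightarrow> prime_in S p)"

definition poly_over :: "'a::comm_ring_1 set \<Rightarrow> 'a poly set" where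
  "poly_over S = {p. \<forall>i. coeff p i \<in> S}"

locale factorial_subring =
  fixes S :: "'a::idom set"
  assumes S: "is_subring S" and atomic: "atomic_ring S" and ip: "irreducibles_prime S"
begin

abbreviation "T \<equiv> poly_over S"

lemma S_0: "0 \<in> S" and S_1: "1 \<in> S" and S_add: "a \<in> S \<Longrightarrow> b \<in> S \<Longrightarrow> a + b \<in> S"
  and S_mult: "a \<in> S \<Longrightarrow> b \<in> S \<Longrightarrow> a * b \<in> S" and S_diff: "a \<in> S \<Longrightarrow> b \<in> S \<Longrightarrow> a - b \<in> S"
  using S by (auto simp: is_subring_def)

lemma S_sum: "(\<And>i. i \<in> A \<Longrightarrow> f i \<in> S) \<Longrightarrow> sum f A \<in> S"
  by (induction A rule: infinite_finite_induct) (auto intro: S_0 S_add)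

lemma T_add: "a \<in> T \<Longrightarrow> b \<in> T \<Longrightarrow> a + b \<in> T" and T_diff: "a \<in> T \<Longrightarrow> b \<in> T \<Longrightarrow> a - b \<in> T"
  and T_mult: "a \<in> T \<Longrightarrow> b \<in> T \<Longrightarrow> a * b \<in> T"
  and T_const: "c \<in> S \<Longrightarrow> [:c:] \<in> T" and T_smult: "c \<in> S \<Longrightarrow> a \<in> T \<Longrightarrow> Polynomial.smult c a \<in> T"
  and T_monom: "c \<in> S \<Longrightarrow> Polynomial.monom c i \<in> T"
  by (auto simp: poly_over_def S_add S_diff S_0 S_mult coeff_mult coeff_pCons intro!: S_sum split: nat.splits)

lemma T_0: "0 \<in> T" and T_1: "1 \<in> T" using T_const[OF S_0] T_const[OF S_1] by (auto simp: one_pCons)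

lemma const_dvd_iff:
  assumes "a \<in> T" shows "dvd_in T [:c:] a \<longleftrightarrow> (\<forall>i. dvd_in S c (coeff a i))"
proof
  assume "dvd_in T [:c:] a"
  thus "\<forall>i. dvd_in S c (coeff a i)" by (auto simp: dvd_in_def poly_over_def)
next
  assume *: "\<forall>i. dvd_in S c (coeff a i)"
  show "dvd_in T [:c:] a"
  proof (cases "c = 0")
    case True
    hence "a = 0" using * by (auto simp: dvd_in_def poly_eq_iff)
    thus ?thesis using T_0 by (auto simp: dvd_in_def)
  next
    case False
    obtain f where f: "\<And>i. f i \<in> S" "\<And>i. coeff a i = c * f i" using * unfolding dvd_in_def by metis
    have "\<forall>\<^sub>\<infinity>i. coeff a i = 0" by (rule MOST_coeff_eq_0)
    hence "f \<in> {f. \<forall>\<^sub>\<infinity>n. f n = 0}" using f(2) False by simp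
    hence "coeff (Abs_poly f) i = f i" for i by (simp add: Abs_poly_inverse)
    hence "Abs_poly f \<in> T" "a = [:c:] * Abs_poly f" using f by (auto simp: poly_over_def intro!: poly_eqI)
    thus ?thesis unfolding dvd_in_def by blast
  qed
qed

text \<open>Gauss's argument: with \<open>i\<close> and \<open>j\<close> the first indices at which
  the coefficients of \<open>a\<close> and \<open>b\<close> are not divisible by \<open>p\<close>,
  the coefficient of index \<open>i + j\<close> in the product is
  \<open>coeff a i * coeff b j\<close> modulo \<open>p\<close>.\<close>

lemma prime_const:
  assumes p: "prime_in S p" and a: "a \<in> T" "b \<in> T" and dvd: "dvd_in T [:p:] (a * b)"
  shows "dvd_in T [:p:] a \<or> dvd_in T [:p:] b"
proof (rule ccontr)
  assume neg: "\<not> (dvd_in T [:p:] a \<or> dvd_in T [:p:] b)"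
  define A where "A = (\<lambda>i. \<not> dvd_in S p (coeff a i))"
  define B where "B = (\<lambda>i. \<not> dvd_in S p (coeff b i))"
  have "\<exists>i. A i" "\<exists>i. B i" using neg const_dvd_iff a by (auto simp: A_def B_def)
  then obtain i j where i: "A i" "\<And>k. k < i \<Longrightarrow> \<not> A k" and j: "B j" "\<And>k. k < j \<Longrightarrow> \<not> B k"
    by (metis LeastI_ex not_less_Least)
  have d0: "dvd_in S p (x + y)" if "dvd_in S p x" "dvd_in S p y" for x y
    using that unfolding dvd_in_def by (metis S_add distrib_left)
  have d1: "dvd_in S p (x - y)" if "dvd_in S p x" "dvd_in S p y" for x y
    using that unfolding dvd_in_def by (metis S_diff right_diff_distrib)
  have d2: "dvd_in S p (x * y)" "dvd_in S p (y * x)" if "dvd_in S p x" "y \<in> S" for x y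
    using that S_mult unfolding dvd_in_def by (metis mult.assoc mult.commute)+
  have dz: "dvd_in S p 0" using S_0 by (auto simp: dvd_in_def)
  have ds: "dvd_in S p (sum f M)" if "\<And>k. k \<in> M \<Longrightarrow> dvd_in S p (f k)" for f and M :: "nat set"
    using that by (induction M rule: infinite_finite_induct) (auto intro: d0 dz)
  have cS: "coeff a k \<in> S" "coeff b k \<in> S" for k using a by (auto simp: poly_over_def)
  have "coeff (a * b) (i + j) = coeff a i * coeff b j + (\<Sum>k\<in>{..i+j}-{i}. coeff a k * coeff b (i + j - k))"
    unfolding coeff_mult by (subst sum.remove[of _ i]) auto
  moreover have "dvd_in S p (\<Sum>k\<in>{..i+j}-{i}. coeff a k * coeff b (i + j - k))"
  proof (rule ds)
    fix k assume "k \<in> {..i+j}-{i}"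
    hence "k < i \<or> i + j - k < j" by auto
    hence "dvd_in S p (coeff a k) \<or> dvd_in S p (coeff b (i + j - k))" using i(2) j(2) by (auto simp: A_def B_def)
    thus "dvd_in S p (coeff a k * coeff b (i + j - k))" using d2 cS by blast
  qed
  moreover have "dvd_in S p (coeff (a * b) (i + j))"
    using dvd const_dvd_iff[OF T_mult[OF a]] by blast
  ultimately have "dvd_in S p (coeff a i * coeff b j)"
    using d1[of "coeff (a * b) (i + j)" "\<Sum>k\<in>{..i+j}-{i}. coeff a k * coeff b (i + j - k)"] by simp
  thus False using p cS i(1) j(1) unfolding prime_in_def A_def B_def by blast
qed

text \<open>Gauss's lemma in a form that avoids contents and greatest common divisors: each prime of
  the constant on the left divides \<open>h\<close> or \<open>t\<close> and is cancelled
  there.\<close>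

lemma cancel_prime_list:
  assumes "\<forall>p\<in>set ps. irreducible_in S p" "a \<in> T" "h \<in> T" "t \<in> T"
    and "[:prod_list ps:] * a = h * t"
  shows "\<exists>c1 c2 h' t'. c1 \<in> S \<and> c2 \<in> S \<and> h' \<in> T \<and> t' \<in> T \<and> h = [:c1:] * h' \<and> t = [:c2:] * t' \<and> a = h' * t'"
  using assms
proof (induction ps arbitrary: h t)
  case Nil
  have "[:prod_list []:] * a = a" "h = [:1::'a:] * h" "t = [:1::'a:] * t" by simp_all
  with Nil S_1 show ?case by metis
next
  case (Cons p ps)
  have p: "prime_in S p" using Cons.prems ip by (auto simp: irreducibles_prime_def)
  hence p0: "p \<noteq> 0" "p \<in> S" by (auto simp: prime_in_def)
  have psS: "prod_list ps \<in> S" using Cons.prems(1) by (induction ps) (auto intro: S_1 S_mult simp: irreducible_in_def)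
  have eq: "[:p:] * ([:prod_list ps:] * a) = h * t" using Cons.prems(5) by (simp add: mult.commute)
  hence "dvd_in T [:p:] (h * t)" unfolding dvd_in_def
    by (intro bexI[of _ "[:prod_list ps:] * a"]) (auto intro!: T_mult T_smult T_const Cons.prems psS)
  hence "dvd_in T [:p:] h \<or> dvd_in T [:p:] t" by (rule prime_const[OF p Cons.prems(3,4)])
  thus ?case
  proof
    assume "dvd_in T [:p:] h"
    then obtain h1 where h1: "h1 \<in> T" "h = [:p:] * h1" by (auto simp: dvd_in_def)
    have "[:p:] * ([:prod_list ps:] * a) = [:p:] * (h1 * t)" using eq unfolding h1(2) by (simp only: mult.assoc)
    hence "[:prod_list ps:] * a = h1 * t" using p0(1) by (simp only: mult_cancel_left) simp
    from Cons.IH[OF _ Cons.prems(2) h1(1) Cons.prems(4) this] Cons.prems(1)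
    obtain c1 c2 h' t' where *: "c1 \<in> S" "c2 \<in> S" "h' \<in> T" "t' \<in> T" "h1 = [:c1:] * h'" "t = [:c2:] * t'" "a = h' * t'"
      by auto
    show ?thesis
      by (rule exI[of _ "p * c1"], rule exI[of _ c2], rule exI[of _ h'], rule exI[of _ t']) (use * h1 p0 S_mult in \<open>auto simp: mult.commute\<close>)
  next
    assume "dvd_in T [:p:] t"
    then obtain t1 where t1: "t1 \<in> T" "t = [:p:] * t1" by (auto simp: dvd_in_def)
    have "[:p:] * ([:prod_list ps:] * a) = [:p:] * (h * t1)" using eq unfolding t1(2) by (simp only: mult.left_commute)
    hence "[:prod_list ps:] * a = h * t1" using p0(1) by (simp only: mult_cancel_left) simp
    from Cons.IH[OF _ Cons.prems(2) Cons.prems(3) t1(1) this] Cons.prems(1)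
    obtain c1 c2 h' t' where *: "c1 \<in> S" "c2 \<in> S" "h' \<in> T" "t' \<in> T" "h = [:c1:] * h'" "t1 = [:c2:] * t'" "a = h' * t'"
      by auto
    show ?thesis
      by (rule exI[of _ "c1"], rule exI[of _ "p * c2"], rule exI[of _ h'], rule exI[of _ t']) (use * t1 p0 S_mult in \<open>auto simp: mult.commute\<close>)
  qed
qed

lemma cancel_const:
  assumes c: "c \<in> S" "c \<noteq> 0" and T: "a \<in> T" "h \<in> T" "t \<in> T" and eq: "[:c:] * a = h * t"
  shows "\<exists>c1 c2 h' t'. c1 \<in> S \<and> c2 \<in> S \<and> h' \<in> T \<and> t' \<in> T \<and> h = [:c1:] * h' \<and> t = [:c2:] * t' \<and> a = h' * t'"
proof -
  obtain ps u where ps: "c = u * prod_list ps" "u \<in> S" "dvd_in S u 1" "\<forall>p\<in>set ps. irreducible_in S p"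
    using atomic c unfolding atomic_ring_def by meson
  have "[:prod_list ps:] * ([:u:] * a) = h * t" using eq ps(1) by (simp add: mult.commute)
  from cancel_prime_list[OF ps(4) _ T(2,3) this] T_mult[OF T_const[OF ps(2)] T(1)]
  obtain c1 c2 h' t' where *: "c1 \<in> S" "c2 \<in> S" "h' \<in> T" "t' \<in> T" "h = [:c1:] * h'" "t = [:c2:] * t'"
    "[:u:] * a = h' * t'" by blast
  obtain v where v: "v \<in> S" "u * v = 1" using ps(3) by (auto simp: dvd_in_def)
  have "a = [:v:] * ([:u:] * a)" using v(2) by (simp add: mult.commute)
  also have "\<dots> = h' * ([:v:] * t')" unfolding *(7) by (simp only: mult.left_commute)
  finally have "a = h' * ([:v:] * t')" .
  moreover have "t = [:c2 * u:] * ([:v:] * t')" using *(6) v(2)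
    by (simp add: mult.assoc mult.commute[of v])
  moreover have "c2 * u \<in> S" "[:v:] * t' \<in> T" using * v ps(2) by (blast intro: S_mult T_mult T_const)+
  ultimately show ?thesis using *(1,3,5)
    by (intro exI[of _ c1] exI[where x = "c2 * u"] exI[where x = h'] exI[where x = "[:v:] * t'"] conjI)
qed

lemma pseudo_division:
  assumes "h \<in> T" "h \<noteq> 0" "p \<in> T"
  shows "\<exists>c q r. c \<in> S \<and> c \<noteq> 0 \<and> q \<in> T \<and> r \<in> T \<and> [:c:] * p = h * q + r \<and> (r = 0 \<or> degree r < degree h)"
  using assms(3)
proof (induction "degree p" arbitrary: p rule: less_induct)
  case less
  show ?case
  proof (cases "p = 0 \<or> degree p < degree h")
    case True
    have "[:1::'a:] * p = h * 0 + p" by simp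
    with True less.prems S_1 T_0 show ?thesis by (metis degree_0 zero_neq_one)
  next
    case False
    define e where "e = degree p - degree h"
    have dp: "degree p = e + degree h" using False by (simp add: e_def)
    define m where "m = Polynomial.monom (lead_coeff p) e"
    define l where "l = lead_coeff h"
    have lS: "l \<in> S" "l \<noteq> 0" using assms by (auto simp: l_def poly_over_def)
    have mT: "m \<in> T" using less.prems by (auto simp: m_def poly_over_def S_0)
    define p' where "p' = [:l:] * p - h * m"
    have p'T: "p' \<in> T" unfolding p'_def by (intro T_diff T_mult T_const lS less.prems assms mT)
    have lp: "lead_coeff p \<noteq> 0" using False by auto
    have m0: "m \<noteq> 0" "degree m = e" "lead_coeff m = lead_coeff p" using lp by (simp_all add: m_def degree_monom_eq)
    have dhm: "degree (h * m) = degree p" using m0 assms by (simp add: degree_mult_eq dp)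
    have "coeff (h * m) (degree p) = l * lead_coeff p"
      using lead_coeff_mult[of h m] unfolding dhm m0(3) l_def by simp
    hence z: "coeff p' (degree p) = 0" by (simp add: p'_def)
    have "degree p' \<le> degree p" unfolding p'_def by (rule degree_diff_le) (auto simp: dhm degree_smult_le)
    hence "p' = 0 \<or> degree p' < degree p" using z by (metis le_neq_implies_less leading_coeff_0_iff)
    hence "\<exists>c q r. c \<in> S \<and> c \<noteq> 0 \<and> q \<in> T \<and> r \<in> T \<and> [:c:] * p' = h * q + r \<and> (r = 0 \<or> degree r < degree h)"
    proof
      assume "p' = 0"
      hence "[:1::'a:] * p' = h * 0 + 0" by simp
      with S_1 T_0 show ?thesis by (metis zero_neq_one)
    next
      assume "degree p' < degree p"
      from less.hyps[OF this p'T] show ?thesis .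
    qed
    then obtain c q r where *: "c \<in> S" "c \<noteq> 0" "q \<in> T" "r \<in> T" "[:c:] * p' = h * q + r" "r = 0 \<or> degree r < degree h" by blast
    have "[:c * l:] * p = [:c:] * p' + h * ([:c:] * m)" by (simp add: p'_def smult_diff_right)
    also have "\<dots> = h * (q + [:c:] * m) + r" using *(5) by (simp add: algebra_simps)
    finally have "[:c * l:] * p = h * (q + [:c:] * m) + r" .
    moreover have "c * l \<in> S \<and> c * l \<noteq> 0" using * lS S_mult by auto
    moreover have "q + [:c:] * m \<in> T" by (intro T_add T_mult T_const * mT)
    ultimately show ?thesis using *(4,6)
      by (intro exI[of _ "c * l"] exI[where x = "q + [:c:] * m"] exI[where x = r] conjI) simp_all
  qed
qed

lemma unit_degree: assumes "dvd_in T p 1" shows "degree p = 0"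
  using assms degree_mult_eq[of p] by (metis add_is_0 degree_1 dvd_in_def mult_eq_0_iff zero_neq_one)

text \<open>Take \<open>h\<close> of least degree in the ideal generated by \<open>a\<close> and
  \<open>g\<close>. If it is a constant, it is the wanted elimination relation. Otherwise
  pseudo-division makes \<open>h\<close> a divisor of constant multiples of \<open>g\<close> and of
  \<open>a\<close>; after cancelling the constants, irreducibility forces \<open>h\<close> to agree
  with \<open>g\<close> up to constant factors, and then \<open>g\<close> divides
  \<open>a\<close>.\<close>

lemma irreducible_dvd_or_bezout:
  assumes g: "irreducible_in T g" "degree g > 0" and a: "a \<in> T" and ndvd: "\<not> dvd_in T g a"
  shows "\<exists>c u v. c \<in> S \<and> c \<noteq> 0 \<and> u \<in> T \<and> v \<in> T \<and> [:c:] = u * a + v * g"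
proof -
  have gT: "g \<in> T" "g \<noteq> 0" using g by (auto simp: irreducible_in_def)
  define J where "J = {h. \<exists>u\<in>T. \<exists>v\<in>T. h = u * a + v * g}"
  have JT: "J \<subseteq> T" unfolding J_def by (blast intro: T_add T_mult a gT(1))
  have gJ: "g \<in> J" unfolding J_def
    by (rule CollectI, rule bexI[OF _ T_0], rule bexI[OF _ T_1]) simp
  have aJ: "a \<in> J" unfolding J_def
    by (rule CollectI, rule bexI[OF _ T_1], rule bexI[OF _ T_0]) simp
  define P where "P = (\<lambda>d. \<exists>h\<in>J. h \<noteq> 0 \<and> degree h = d)"
  have "P (degree g)" using gJ gT by (auto simp: P_def)
  from LeastI[of P, OF this] obtain h where h: "h \<in> J" "h \<noteq> 0" "degree h = (LEAST d. P d)"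
    by (auto simp: P_def)
  have min: "degree h \<le> degree r" if "r \<noteq> 0" "r \<in> J" for r
    unfolding h(3) by (rule Least_le) (use that in \<open>auto simp: P_def\<close>)
  have hT: "h \<in> T" using h JT by auto
  show ?thesis
  proof (cases "degree h = 0")
    case True
    then obtain c where "h = [:c:]" by (metis degree_eq_zeroE)
    note c = this
    have "coeff h 0 \<in> S" using hT by (simp add: poly_over_def)
    hence "c \<in> S" "c \<noteq> 0" using h(2) by (auto simp: c)
    thus ?thesis using h(1) unfolding J_def c by blast
  next
    case False
    have div: "\<exists>c q. c \<in> S \<and> c \<noteq> 0 \<and> q \<in> T \<and> [:c:] * x = h * q" if x: "x \<in> J" for x
    proof -
      obtain c q r where *: "c \<in> S" "c \<noteq> 0" "q \<in> T" "r \<in> T" "[:c:] * x = h * q + r" "r = 0 \<or> degree r < degree h"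
        using pseudo_division[OF hT h(2) subsetD[OF JT x]] by blast
      obtain u v where uv: "u \<in> T" "v \<in> T" "h = u * a + v * g" using h(1) by (auto simp: J_def)
      obtain u' v' where uv': "u' \<in> T" "v' \<in> T" "x = u' * a + v' * g" using x by (auto simp: J_def)
      have "r = [:c:] * x - h * q" using *(5) by simp
      also have "\<dots> = ([:c:] * u' - u * q) * a + ([:c:] * v' - v * q) * g"
        unfolding uv(3) uv'(3) by (simp add: algebra_simps smult_add_right)
      finally have "r = ([:c:] * u' - u * q) * a + ([:c:] * v' - v * q) * g" .
      moreover have "[:c:] * u' - u * q \<in> T" "[:c:] * v' - v * q \<in> T"
        by (intro T_diff T_mult T_const *(1,3) uv(1,2) uv'(1,2))+
      ultimately have "r \<in> J" unfolding J_def by blast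
      hence "r = 0" using *(6) min[of r] by fastforce
      thus ?thesis using * by auto
    qed
    obtain c q where cq: "c \<in> S" "c \<noteq> 0" "q \<in> T" "[:c:] * g = h * q" using div[OF gJ] by blast
    from cancel_const[OF cq(1,2) gT(1) hT cq(3,4)]
    obtain c1 c2 h' q' where 1: "c1 \<in> S" "c2 \<in> S" "h' \<in> T" "q' \<in> T" "h = [:c1:] * h'" "q = [:c2:] * q'" "g = h' * q'" by blast
    have "degree h' > 0" using False 1(5) by (auto split: if_splits)
    hence "\<not> dvd_in T h' 1" using unit_degree by auto
    hence "dvd_in T q' 1" using g(1) 1(3,4,7) unfolding irreducible_in_def by blast
    then obtain w where w: "w \<in> T" "q' * w = 1" by (auto simp: dvd_in_def)
    have h': "h' = g * w" using 1(7) w(2) by (simp add: mult.assoc)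
    obtain c' q2 where cq2: "c' \<in> S" "c' \<noteq> 0" "q2 \<in> T" "[:c':] * a = h * q2" using div[OF aJ] by blast
    have "[:c':] * a = g * ([:c1:] * w * q2)" unfolding cq2(4) 1(5) h' by (simp only: mult_ac)
    from cancel_const[OF cq2(1,2) a gT(1) _ this]
      T_mult[OF T_mult[OF T_const[OF 1(1)] w(1)] cq2(3)]
    obtain d1 d2 g' t' where 2: "d1 \<in> S" "g' \<in> T" "t' \<in> T" "g = [:d1:] * g'" "a = g' * t'" by blast
    have "degree g' > 0" using g(2) 2(4) by (auto split: if_splits)
    hence "\<not> dvd_in T g' 1" using unit_degree by auto
    hence "dvd_in T [:d1:] 1" using g(1) 2(2,4) T_const[OF 2(1)] unfolding irreducible_in_def by blast
    then obtain w' where w': "w' \<in> T" "[:d1:] * w' = 1" by (auto simp: dvd_in_def)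
    have "g * (w' * t') = ([:d1:] * w') * (g' * t')" unfolding 2(4) by (simp only: mult_ac)
    hence "g * (w' * t') = a" unfolding w'(2) 2(5) by simp
    hence "a = g * (w' * t')" by (rule sym)
    hence "dvd_in T g a" unfolding dvd_in_def using T_mult[OF w'(1) 2(3)] by blast
    thus ?thesis using ndvd by blast
  qed
qed

text \<open>Gauss's theorem. An irreducible constant is prime by \<open>prime_const\<close>. In
  positive degree, the elimination relation for \<open>a\<close> and \<open>g\<close>, multiplied by
  \<open>b\<close>, exhibits a constant multiple of \<open>b\<close> as a multiple of
  \<open>g\<close>, and the constant can be cancelled.\<close>

lemma irreducible_prime_poly:
  assumes g: "irreducible_in T g" shows "prime_in T g"
proof (cases "degree g = 0")
  case True
  then obtain p where p: "g = [:p:]" by (metis degree_eq_zeroE)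
  have "coeff g 0 \<in> S" "g \<noteq> 0" using g by (auto simp: irreducible_in_def poly_over_def)
  hence pS: "p \<in> S" "p \<noteq> 0" by (auto simp: p)
  have cu: "dvd_in T [:c:] 1 \<longleftrightarrow> dvd_in S c 1" if "c \<in> S" for c
    using const_dvd_iff[OF T_1, of c] S_0 by (auto simp: dvd_in_def coeff_1)
  have "irreducible_in S p"
    unfolding irreducible_in_def
  proof (intro conjI ballI impI pS)
    show "\<not> dvd_in S p 1" using g cu[OF pS(1)] by (auto simp: irreducible_in_def p)
    fix a b assume ab: "a \<in> S" "b \<in> S" "p = a * b"
    hence "g = [:a:] * [:b:]" by (simp add: p)
    hence "dvd_in T [:a:] 1 \<or> dvd_in T [:b:] 1"
      using g T_const[OF ab(1)] T_const[OF ab(2)] unfolding irreducible_in_def by blast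
    thus "dvd_in S a 1 \<or> dvd_in S b 1" using cu ab by simp
  qed
  hence "prime_in S p" using ip by (auto simp: irreducibles_prime_def)
  from prime_const[OF this] g show ?thesis unfolding prime_in_def[of T] irreducible_in_def p by simp
next
  case False
  have gT: "g \<in> T" "g \<noteq> 0" using g by (auto simp: irreducible_in_def)
  show ?thesis unfolding prime_in_def
  proof (intro conjI ballI impI gT)
    show "\<not> dvd_in T g 1" using g by (auto simp: irreducible_in_def)
    fix a b assume ab: "a \<in> T" "b \<in> T" "dvd_in T g (a * b)"
    show "dvd_in T g a \<or> dvd_in T g b"
    proof (rule ccontr)
      assume n: "\<not> (dvd_in T g a \<or> dvd_in T g b)"
      then obtain c u v where c: "c \<in> S" "c \<noteq> 0" "u \<in> T" "v \<in> T" "[:c:] = u * a + v * g"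
        using irreducible_dvd_or_bezout[OF g _ ab(1)] False by blast
      obtain w where w: "w \<in> T" "a * b = g * w" using ab(3) by (auto simp: dvd_in_def)
      have "[:c:] * b = u * (a * b) + v * g * b" unfolding c(5) by (simp add: algebra_simps)
      also have "\<dots> = g * (u * w + v * b)" unfolding w(2) by (simp add: algebra_simps)
      finally have "[:c:] * b = g * (u * w + v * b)" .
      from cancel_const[OF c(1,2) ab(2) gT(1) _ this]
        T_add[OF T_mult[OF c(3) w(1)] T_mult[OF c(4) ab(2)]]
      obtain d1 d2 g' t' where 2: "d1 \<in> S" "g' \<in> T" "t' \<in> T" "g = [:d1:] * g'" "b = g' * t'" by blast
      have "degree g' > 0" using False 2(4) by (auto split: if_splits)
      hence "\<not> dvd_in T g' 1" using unit_degree by auto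
      hence "dvd_in T [:d1:] 1" using g(1) 2(2,4) T_const[OF 2(1)] unfolding irreducible_in_def by blast
      then obtain w' where w': "w' \<in> T" "[:d1:] * w' = 1" by (auto simp: dvd_in_def)
      have "g * (w' * t') = ([:d1:] * w') * (g' * t')" unfolding 2(4) by (simp only: mult_ac)
      hence "g * (w' * t') = b" unfolding w'(2) 2(5) by simp
    hence "b = g * (w' * t')" by (rule sym)
      hence "dvd_in T g b" unfolding dvd_in_def using T_mult[OF w'(1) 2(3)] by blast
      thus False using n by blast
    qed
  qed
qed

end

section \<open>Multivariate polynomials\<close>

abbreviation (input) "lookup \<equiv> Poly_Mapping.lookup"
abbreviation (input) "keys \<equiv> Poly_Mapping.keys"

lemma pm_sum_singles: "(a :: 'k \<Rightarrow>\<^sub>0 'b::comm_monoid_add) = (\<Sum>n\<in>keys a. Poly_Mapping.single n (lookup a n))"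
proof (rule poly_mapping_eqI)
  fix k
  have "lookup (\<Sum>n\<in>keys a. Poly_Mapping.single n (lookup a n)) k
      = (\<Sum>n\<in>keys a. if n = k then lookup a n else 0)"
    by (auto simp: lookup_sum lookup_single when_def intro!: sum.cong)
  also have "\<dots> = lookup a k" by (simp add: in_keys_iff)
  finally show "lookup a k = lookup (\<Sum>n\<in>keys a. Poly_Mapping.single n (lookup a n)) k" by simp
qed

lemma pm_mult_expand:
  fixes a b :: "'k::monoid_add \<Rightarrow>\<^sub>0 'b::semiring_0"
  shows "a * b = (\<Sum>k\<in>keys a. \<Sum>l\<in>keys b. Poly_Mapping.single (k + l) (lookup a k * lookup b l))"
  by (subst pm_sum_singles[of a], subst pm_sum_singles[of b]) (simp add: sum_product mult_single)

lemma lookup_mult_keys: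
  fixes a b :: "'k::monoid_add \<Rightarrow>\<^sub>0 'b::semiring_0"
  shows "lookup (a * b) n = (\<Sum>k\<in>keys a. \<Sum>l\<in>keys b. if k + l = n then lookup a k * lookup b l else 0)"
  by (subst pm_mult_expand) (auto simp: lookup_sum lookup_single when_def intro!: sum.cong)

lemma lookup_single_mult:
  fixes a :: "'k::cancel_comm_monoid_add \<Rightarrow>\<^sub>0 'b::semiring_0"
  shows "lookup (Poly_Mapping.single t c * a) (t + n) = c * lookup a n"
proof (cases "c = 0")
  case False
  hence "lookup (Poly_Mapping.single t c * a) (t + n) = (\<Sum>l\<in>keys a. if l = n then c * lookup a l else 0)"
    by (simp add: lookup_mult_keys)
  also have "\<dots> = c * lookup a n" by (simp add: in_keys_iff)
  finally show ?thesis .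
qed simp

lemma lookup_single_mult_0:
  fixes a :: "'k::comm_monoid_add \<Rightarrow>\<^sub>0 'b::semiring_0"
  assumes "\<And>n'. n \<noteq> t + n'"
  shows "lookup (Poly_Mapping.single t c * a) n = 0"
  unfolding lookup_mult_keys by (intro sum.neutral ballI) (use assms in \<open>auto split: if_splits\<close>)

lemma lookup_const_mult:
  fixes a :: "'k::cancel_comm_monoid_add \<Rightarrow>\<^sub>0 'b::semiring_0"
  shows "lookup (Poly_Mapping.single 0 c * a) n = c * lookup a n"
  using lookup_single_mult[of 0 c a n] by simp

text \<open>One substitution principle with two multiplicative ingredients, \<open>h\<close> on
  coefficients and \<open>w\<close> on monomials. It has three instances: evaluation at a point,
  restriction to a polynomial curve, and the grading by total degree.\<close>

locale coeff_hom =
  fixes h :: "'b::comm_ring_1 \<Rightarrow> 'r::comm_ring_1" and w :: "'k::cancel_comm_monoid_add \<Rightarrow> 'r"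
  assumes h_0: "h 0 = 0" and h_1: "h 1 = 1" and h_add: "h (a + b) = h a + h b"
    and h_mult: "h (a * b) = h a * h b"
    and w_0: "w 0 = 1" and w_add: "w (m + n) = w m * w n"
begin

definition msub :: "('k \<Rightarrow>\<^sub>0 'b) \<Rightarrow> 'r" where
  "msub p = (\<Sum>n\<in>keys p. h (lookup p n) * w n)"

lemma msub_superset:
  "finite K \<Longrightarrow> keys p \<subseteq> K \<Longrightarrow> msub p = (\<Sum>n\<in>K. h (lookup p n) * w n)"
  unfolding msub_def by (rule sum.mono_neutral_left) (auto simp: in_keys_iff h_0)

lemma msub_0: "msub 0 = 0" by (simp add: msub_def)

lemma msub_single: "msub (Poly_Mapping.single n c) = h c * w n"
  by (cases "c = 0") (auto simp: msub_def h_0)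

lemma msub_1: "msub 1 = 1"
  using msub_single[of 0 1] by (simp add: h_1 w_0)

lemma msub_add: "msub (p + q) = msub p + msub q"
proof -
  let ?K = "keys p \<union> keys q"
  have "msub (p + q) = (\<Sum>n\<in>?K. h (lookup (p + q) n) * w n)"
    by (rule msub_superset) (simp_all add: Poly_Mapping.keys_add)
  also have "\<dots> = (\<Sum>n\<in>?K. h (lookup p n) * w n) + (\<Sum>n\<in>?K. h (lookup q n) * w n)"
    by (simp add: lookup_add h_add distrib_right sum.distrib)
  also have "\<dots> = msub p + msub q" by (subst (1 2) msub_superset[of ?K]) auto
  finally show ?thesis .
qed

lemma msub_sum: "msub (sum f I) = (\<Sum>i\<in>I. msub (f i))"
  by (induction I rule: infinite_finite_induct) (auto simp: msub_0 msub_add)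

lemma msub_mult: "msub (p * q) = msub p * msub q"
proof -
  have "msub (p * q) = (\<Sum>k\<in>keys p. \<Sum>l\<in>keys q. msub (Poly_Mapping.single (k + l) (lookup p k * lookup q l)))"
    by (subst pm_mult_expand) (simp add: msub_sum)
  also have "\<dots> = (\<Sum>k\<in>keys p. \<Sum>l\<in>keys q. (h (lookup p k) * w k) * (h (lookup q l) * w l))"
    by (intro sum.cong refl) (simp add: msub_single h_mult w_add mult_ac)
  also have "\<dots> = msub p * msub q" by (simp add: msub_def sum_product)
  finally show ?thesis .
qed

end

section \<open>Monomials at a point and linear forms on exponents\<close>

definition wt :: "(nat \<Rightarrow> 'r::comm_monoid_mult) \<Rightarrow> monom \<Rightarrow> 'r" where
  "wt z n = (\<Prod>i\<in>keys n. z i ^ lookup n i)"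

lemma wt_superset: "finite K \<Longrightarrow> keys n \<subseteq> K \<Longrightarrow> wt z n = (\<Prod>i\<in>K. z i ^ lookup n i)"
  unfolding wt_def by (rule prod.mono_neutral_left) (auto simp: in_keys_iff)

lemma wt_0 [simp]: "wt z 0 = 1" by (simp add: wt_def)

lemma wt_add: "wt z (m + n) = wt z m * wt z n"
proof -
  let ?K = "keys m \<union> keys n"
  have "wt z (m + n) = (\<Prod>i\<in>?K. z i ^ lookup (m + n) i)"
    by (rule wt_superset) (simp_all add: Poly_Mapping.keys_add)
  also have "\<dots> = (\<Prod>i\<in>?K. z i ^ lookup m i) * (\<Prod>i\<in>?K. z i ^ lookup n i)"
    by (simp add: lookup_add power_add prod.distrib)
  also have "\<dots> = wt z m * wt z n" by (subst (1 2) wt_superset[of ?K]) auto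
  finally show ?thesis .
qed

text \<open>A linear form on exponent vectors over an arbitrary semiring: natural weights serve
  one-variable substitutions, real weights cut out faces.\<close>

definition wdeg :: "(nat \<Rightarrow> 'r::comm_semiring_1) \<Rightarrow> monom \<Rightarrow> 'r" where
  "wdeg a n = (\<Sum>i\<in>keys n. a i * of_nat (lookup n i))"

lemma wdeg_superset: "finite K \<Longrightarrow> keys n \<subseteq> K \<Longrightarrow> wdeg a n = (\<Sum>i\<in>K. a i * of_nat (lookup n i))"
  unfolding wdeg_def by (rule sum.mono_neutral_left) (auto simp: in_keys_iff)

lemma wdeg_0 [simp]: "wdeg a 0 = 0" by (simp add: wdeg_def)

lemma wdeg_add: "wdeg a (m + n) = wdeg a m + wdeg a n"
proof -
  let ?K = "keys m \<union> keys n"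
  have "wdeg a (m + n) = (\<Sum>i\<in>?K. a i * of_nat (lookup (m + n) i))"
    by (rule wdeg_superset) (simp_all add: Poly_Mapping.keys_add)
  also have "\<dots> = (\<Sum>i\<in>?K. a i * of_nat (lookup m i)) + (\<Sum>i\<in>?K. a i * of_nat (lookup n i))"
    by (simp add: lookup_add distrib_left sum.distrib)
  also have "\<dots> = wdeg a m + wdeg a n" by (subst (1 2) wdeg_superset[of ?K]) auto
  finally show ?thesis .
qed

lemma mnorm_wdeg: "mnorm n = wdeg (\<lambda>_. 1) n" by (simp add: mnorm_def wdeg_def)
lemma mnorm_0 [simp]: "mnorm 0 = 0" by (simp add: mnorm_def)
lemma mnorm_add: "mnorm (m + n) = mnorm m + mnorm n" by (simp add: mnorm_wdeg wdeg_add)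
lemma mnorm_eq_0: "mnorm n = 0 \<longleftrightarrow> n = 0"
  by (auto simp: mnorm_def in_keys_iff poly_mapping_eq_iff fun_eq_iff)
lemma mnorm_superset: "finite K \<Longrightarrow> keys n \<subseteq> K \<Longrightarrow> mnorm n = (\<Sum>i\<in>K. lookup n i)"
  by (simp add: mnorm_wdeg wdeg_superset)
lemma lookup_le_mnorm: "lookup n i \<le> mnorm n"
  by (cases "i \<in> keys n") (auto simp: mnorm_def in_keys_iff intro!: member_le_sum)

lemma keys_add_monom: "keys (m + n :: monom) = keys m \<union> keys n"
  by (auto simp: in_keys_iff lookup_add)
lemma monom_in_add: "monom_in k (m + n) \<longleftrightarrow> monom_in k m \<and> monom_in k n"
  by (auto simp: monom_in_def keys_add_monom)

lemma monom_le_iff: "monom_le k n \<longleftrightarrow> (\<exists>l. n = k + l)"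
proof
  assume "monom_le k n"
  hence "n = k + (n - k)" by (intro poly_mapping_eqI) (auto simp: monom_le_def lookup_add lookup_minus)
  thus "\<exists>l. n = k + l" ..
qed (auto simp: monom_le_def lookup_add)

section \<open>Evaluation and the rings of polynomials with algebraic coefficients\<close>

interpretation ev: coeff_hom "\<lambda>c::complex. c" "wt z" for z :: "nat \<Rightarrow> complex"
  by unfold_locales (auto simp: wt_add)

abbreviation meval :: "(nat \<Rightarrow> complex) \<Rightarrow> mpoly \<Rightarrow> complex" where "meval z \<equiv> ev.msub z"

lemmas meval_simps = ev.msub_0 ev.msub_1 ev.msub_add ev.msub_mult ev.msub_single

text \<open>Here \<open>V\<close> is a set of variables rather than a number of them, so that a
  single variable can be adjoined or eliminated.\<close>

definition mp :: "nat set \<Rightarrow> mpoly set" where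
  "mp V = {p. (\<forall>n\<in>keys p. keys n \<subseteq> V \<and> algebraic (lookup p n))}"

lemma alg_mpoly_in_mp: "alg_mpoly_in m p \<longleftrightarrow> p \<in> mp {..<m}"
  by (auto simp: alg_mpoly_in_def mp_def monom_in_def)

lemma mp_algebraic: "p \<in> mp V \<Longrightarrow> algebraic (lookup p n)"
  by (cases "n \<in> keys p") (auto simp: mp_def in_keys_iff)

lemma mp_keys: "p \<in> mp V \<Longrightarrow> lookup p n \<noteq> 0 \<Longrightarrow> keys n \<subseteq> V"
  by (auto simp: mp_def in_keys_iff)

lemma mpI: "(\<And>n. lookup p n \<noteq> 0 \<Longrightarrow> keys n \<subseteq> V \<and> algebraic (lookup p n)) \<Longrightarrow> p \<in> mp V"
  by (auto simp: mp_def in_keys_iff)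

lemma mp_0: "0 \<in> mp V" by (simp add: mp_def)

lemma mp_single: "keys n \<subseteq> V \<Longrightarrow> algebraic c \<Longrightarrow> Poly_Mapping.single n c \<in> mp V"
  by (auto simp: mp_def lookup_single split: if_splits)

lemma mp_1: "1 \<in> mp V"
  using mp_single[of 0 V 1] by (simp add: rat_imp_algebraic)

lemma mp_add: "p \<in> mp V \<Longrightarrow> q \<in> mp V \<Longrightarrow> p + q \<in> mp V"
  by (rule mpI) (metis add.right_neutral add.left_neutral lookup_add algebraic_add mp_algebraic mp_keys)

lemma mp_uminus: "p \<in> mp V \<Longrightarrow> - p \<in> mp V"
  by (auto simp: mp_def)

lemma mp_diff: "p \<in> mp V \<Longrightarrow> q \<in> mp V \<Longrightarrow> p - q \<in> mp V"
  using mp_add[OF _ mp_uminus, of p V q] by simp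

lemma mp_sum: "(\<And>i. i \<in> I \<Longrightarrow> f i \<in> mp V) \<Longrightarrow> sum f I \<in> mp V"
  by (induction I rule: infinite_finite_induct) (auto intro: mp_0 mp_add)

lemma mp_mult: "p \<in> mp V \<Longrightarrow> q \<in> mp V \<Longrightarrow> p * q \<in> mp V"
  by (subst pm_mult_expand, intro mp_sum mp_single)
     (auto simp: keys_add_monom mp_def intro!: algebraic_mult)

lemma mp_subring: "is_subring (mp V)"
  by (simp add: is_subring_def mp_0 mp_1 mp_add mp_mult mp_diff)

lemma mp_mono: "V \<subseteq> W \<Longrightarrow> mp V \<subseteq> mp W" by (auto simp: mp_def)

text \<open>The coefficient of degree k of the image is the homogeneous part of degree k.\<close>
interpretation hom: coeff_hom "\<lambda>c::complex. [:Poly_Mapping.single (0::monom) c:]"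
    "\<lambda>n. Polynomial.monom (Poly_Mapping.single n (1::complex)) (mnorm n)"
proof unfold_locales
  fix a b :: complex
  show "[:Poly_Mapping.single (0::monom) (a * b):] = [:Poly_Mapping.single 0 a:] * [:Poly_Mapping.single 0 b:]"
    by (simp add: mult_single mult.commute)
qed (auto simp: single_add mult_single mult_monom mnorm_add one_pCons[symmetric] monom_0 simp flip: single_one)

abbreviation hompoly :: "mpoly \<Rightarrow> mpoly poly" where "hompoly \<equiv> hom.msub"

lemma hompoly_mult: "hompoly (p * q) = hompoly p * hompoly q"
  and hompoly_add: "hompoly (p + q) = hompoly p + hompoly q"
  by (simp_all add: hom.msub_mult hom.msub_add)

lemma lookup_hompoly: "lookup (coeff (hompoly p) k) n = (if mnorm n = k then lookup p n else 0)"
proof -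
  have "coeff (hompoly p) k = (\<Sum>n\<in>keys p. if mnorm n = k then Poly_Mapping.single n (lookup p n) else 0)"
    unfolding hom.msub_def coeff_sum by (intro sum.cong refl) (auto simp: mult_single)
  hence "lookup (coeff (hompoly p) k) n = (\<Sum>l\<in>keys p. lookup (if mnorm l = k then Poly_Mapping.single l (lookup p l) else 0) n)"
    by (simp only: lookup_sum)
  also have "\<dots> = (\<Sum>l\<in>keys p. if l = n then (if mnorm n = k then lookup p n else 0) else 0)"
    by (intro sum.cong refl) (auto simp: lookup_single when_def)
  also have "\<dots> = (if mnorm n = k then lookup p n else 0)" by (simp add: in_keys_iff)
  finally show ?thesis .
qed

lemma hompoly_inj: assumes "hompoly p = hompoly q" shows "p = q"
proof (rule poly_mapping_eqI)
  fix n
  from assms show "lookup p n = lookup q n"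
    using lookup_hompoly[of p "mnorm n" n] lookup_hompoly[of q "mnorm n" n] by simp
qed

lemma hompoly_eq_0: "hompoly p = 0 \<longleftrightarrow> p = 0"
  using hompoly_inj[of p 0] hom.msub_0 by auto

text \<open>The total degree, read off from the one-variable image, so that additivity on products
  is that of one-variable polynomials over a domain.\<close>

definition tdeg :: "mpoly \<Rightarrow> nat" where "tdeg p = degree (hompoly p)"

lemma tdeg_mult: "p \<noteq> 0 \<Longrightarrow> q \<noteq> 0 \<Longrightarrow> tdeg (p * q) = tdeg p + tdeg q"
  by (simp add: tdeg_def hompoly_mult degree_mult_eq hompoly_eq_0)

lemma mnorm_le_tdeg: "lookup p n \<noteq> 0 \<Longrightarrow> mnorm n \<le> tdeg p"
  using lookup_hompoly[of p "mnorm n" n] unfolding tdeg_def by (intro le_degree) auto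

lemma tdeg_0_const: "tdeg p = 0 \<Longrightarrow> p = Poly_Mapping.single 0 (lookup p 0)"
  using mnorm_le_tdeg[of p] by (intro poly_mapping_eqI) (auto simp: lookup_single when_def mnorm_eq_0)

lemma tdeg_single_0: "tdeg (Poly_Mapping.single 0 c) = 0"
  by (simp add: tdeg_def hom.msub_single monom_0)

lemma mp_unit_iff: "p \<in> mp V \<Longrightarrow> dvd_in (mp V) p 1 \<longleftrightarrow> p \<noteq> 0 \<and> tdeg p = 0"
proof (intro iffI conjI)
  assume p: "p \<in> mp V"
  show "p \<noteq> 0" if "dvd_in (mp V) p 1" using that by (auto simp: dvd_in_def)
  show "tdeg p = 0" if unit: "dvd_in (mp V) p 1"
  proof -
    obtain q where "1 = p * q" using unit unfolding dvd_in_def by blast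
    hence q: "p * q = 1" by (rule sym)
    hence "tdeg p + tdeg q = tdeg 1" by (metis mult_eq_0_iff tdeg_mult zero_neq_one)
    thus ?thesis using tdeg_single_0[of 1] by simp
  qed
  show "dvd_in (mp V) p 1" if "p \<noteq> 0 \<and> tdeg p = 0"
  proof -
    define c where "c = lookup p 0"
    have pc: "p = Poly_Mapping.single 0 c" using tdeg_0_const[of p] that by (simp add: c_def)
    hence "c \<noteq> 0" using that by auto
    moreover have "algebraic c" using mp_algebraic[OF p] by (simp add: c_def)
    ultimately have "1 = p * Poly_Mapping.single 0 (inverse c)" "Poly_Mapping.single 0 (inverse c) \<in> mp V"
      unfolding pc by (auto simp: mult_single intro!: mp_single)
    thus ?thesis unfolding dvd_in_def by blast
  qed
qed

text \<open>Induction on the total degree, which drops for both factors of a proper factorisation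
  because the units are exactly the nonzero constants.\<close>

lemma mp_atomic: "atomic_ring (mp V)"
proof -
  have "\<exists>ps u. a = u * prod_list ps \<and> u \<in> mp V \<and> dvd_in (mp V) u 1 \<and> (\<forall>p\<in>set ps. irreducible_in (mp V) p)"
    if "a \<in> mp V" "a \<noteq> 0" for a using that
  proof (induction "tdeg a" arbitrary: a rule: less_induct)
    case less
    show ?case
    proof (cases "tdeg a = 0")
      case True
      thus ?thesis using less.prems mp_unit_iff by (intro exI[of _ "[]"] exI[of _ a]) auto
    next
      case False
      show ?thesis
      proof (cases "irreducible_in (mp V) a")
        case True
        thus ?thesis using mp_1 mp_unit_iff[OF mp_1] tdeg_single_0[of 1]
          by (intro exI[of _ "[a]"] exI[of _ 1]) auto
      next
        case nirr: False
        have "\<not> dvd_in (mp V) a 1" using False mp_unit_iff[OF less.prems(1)] by simp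
        hence "\<not> (\<forall>b\<in>mp V. \<forall>c\<in>mp V. a = b * c \<longrightarrow> dvd_in (mp V) b 1 \<or> dvd_in (mp V) c 1)"
          using nirr less.prems unfolding irreducible_in_def by simp
        then obtain b c where bc: "b \<in> mp V" "c \<in> mp V" "a = b * c" "\<not> dvd_in (mp V) b 1" "\<not> dvd_in (mp V) c 1"
          by blast
        have nz: "b \<noteq> 0" "c \<noteq> 0" using bc less.prems by auto
        have "tdeg b > 0" "tdeg c > 0" using bc nz mp_unit_iff by auto
        hence lt: "tdeg b < tdeg a" "tdeg c < tdeg a" using tdeg_mult[OF nz] bc by auto
        obtain ps u where 1: "b = u * prod_list ps" "u \<in> mp V" "dvd_in (mp V) u 1" "\<forall>p\<in>set ps. irreducible_in (mp V) p"
          using less.hyps[OF lt(1) bc(1) nz(1)] by blast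
        obtain qs v where 2: "c = v * prod_list qs" "v \<in> mp V" "dvd_in (mp V) v 1" "\<forall>p\<in>set qs. irreducible_in (mp V) p"
          using less.hyps[OF lt(2) bc(2) nz(2)] by blast
        have "u \<noteq> 0" "v \<noteq> 0" using 1 2 nz by auto
        hence "dvd_in (mp V) (u * v) 1" using 1 2 mp_unit_iff tdeg_mult mp_mult by auto
        moreover have "a = (u * v) * prod_list (ps @ qs)" by (simp add: bc(3) 1(1) 2(1) mult_ac)
        ultimately show ?thesis using 1 2 mp_mult by (intro exI[of _ "ps @ qs"] exI[of _ "u * v"]) auto
      qed
    qed
  qed
  thus ?thesis unfolding atomic_ring_def by blast
qed

section \<open>Polynomial rings as iterated one-variable polynomial rings\<close>

locale ring_iso_on =
  fixes T :: "'a::comm_ring_1 set" and M :: "'b::comm_ring_1 set" and f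
  assumes bij: "bij_betw f T M" and T_1: "1 \<in> T" and T_0: "0 \<in> T" and T_mult: "a \<in> T \<Longrightarrow> b \<in> T \<Longrightarrow> a * b \<in> T"
    and f_mult: "f (a * b) = f a * f b" and f_1: "f 1 = 1" and f_0: "f 0 = 0"
begin

lemma f_in: "a \<in> T \<Longrightarrow> f a \<in> M" and f_inj: "a \<in> T \<Longrightarrow> b \<in> T \<Longrightarrow> f a = f b \<longleftrightarrow> a = b"
  and f_surj: "y \<in> M \<Longrightarrow> \<exists>x\<in>T. y = f x"
  using bij by (auto simp: bij_betw_def inj_on_eq_iff)

lemma dvd_iff: "a \<in> T \<Longrightarrow> b \<in> T \<Longrightarrow> dvd_in M (f a) (f b) \<longleftrightarrow> dvd_in T a b"
  unfolding dvd_in_def using f_in f_inj f_surj T_mult f_mult by metis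

lemma irreducible_iff: assumes a: "a \<in> T" and irr: "irreducible_in M (f a)" shows "irreducible_in T a"
proof -
  have 1: "a \<noteq> 0" using irr f_0 by (auto simp: irreducible_in_def)
  have 2: "dvd_in M (f b) 1 \<longleftrightarrow> dvd_in T b 1" if "b \<in> T" for b using dvd_iff[OF that T_1] f_1 by simp
  show ?thesis unfolding irreducible_in_def
  proof (intro conjI ballI impI a 1)
    show "\<not> dvd_in T a 1" using irr 2[OF a] by (simp add: irreducible_in_def)
    fix x y assume "x \<in> T" "y \<in> T" "a = x * y"
    thus "dvd_in T x 1 \<or> dvd_in T y 1" using irr 2 f_in f_mult unfolding irreducible_in_def by metis
  qed
qed

lemma prime_iff: assumes a: "prime_in T a" shows "prime_in M (f a)"
proof -
  have aT: "a \<in> T" using a by (simp add: prime_in_def)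
  have 1: "f a \<noteq> 0" using a f_inj[OF aT T_0] f_0 by (simp add: prime_in_def)
  show ?thesis unfolding prime_in_def
  proof (intro conjI ballI impI f_in aT 1)
    show "\<not> dvd_in M (f a) 1" using a dvd_iff[OF aT T_1] f_1 by (simp add: prime_in_def)
    fix x y assume "x \<in> M" "y \<in> M" and d: "dvd_in M (f a) (x * y)"
    then obtain u v where uv: "u \<in> T" "v \<in> T" "x = f u" "y = f v" using f_surj by metis
    hence "dvd_in T a (u * v)" using d dvd_iff[OF aT T_mult[OF uv(1,2)]] by (simp add: f_mult)
    thus "dvd_in M (f a) x \<or> dvd_in M (f a) y" using a uv dvd_iff[OF aT] unfolding prime_in_def by metis
  qed
qed

end

definition var :: "nat \<Rightarrow> mpoly" where "var i = Poly_Mapping.single (Poly_Mapping.single i 1) 1"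

lemma var_power: "var i ^ j = Poly_Mapping.single (Poly_Mapping.single i j) 1"
  by (induction j) (auto simp: var_def mult_single single_add[symmetric])

lemma poly_var_in:
  assumes "p \<in> poly_over (mp V)" shows "poly p (var i) \<in> mp (insert i V)"
  unfolding poly_altdef var_power
proof (intro mp_sum mp_mult mp_single)
  show "coeff p j \<in> mp (insert i V)" for j
    using assms mp_mono[of V "insert i V"] by (auto simp: poly_over_def)
qed (auto simp: rat_imp_algebraic)

lemma lookup_poly_var:
  assumes p: "p \<in> poly_over (mp V)" and i: "i \<notin> V" and n: "keys n \<subseteq> V"
  shows "lookup (poly p (var i)) (Poly_Mapping.single i j + n) = lookup (coeff p j) n"
proof -
  have *: "lookup (coeff p k * var i ^ k) (Poly_Mapping.single i j + n) = (if k = j then lookup (coeff p j) n else 0)" for k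
  proof (cases "k = j")
    case True
    thus ?thesis using lookup_single_mult[of "Poly_Mapping.single i j" 1 "coeff p j" n]
      by (simp add: var_power mult.commute)
  next
    case False
    show ?thesis
    proof (cases "\<exists>n'. Poly_Mapping.single i j + n = Poly_Mapping.single i k + n'")
      case True
      then obtain n' where n': "Poly_Mapping.single i j + n = Poly_Mapping.single i k + n'" by blast
      hence "lookup (Poly_Mapping.single i j + n) i = lookup (Poly_Mapping.single i k + n') i" by simp
      moreover have "lookup n i = 0" using n i by (auto simp: in_keys_iff)
      ultimately have "lookup n' i \<noteq> 0" using False by (simp add: lookup_add)
      hence "i \<in> keys n'" by (simp add: in_keys_iff)
      hence "\<not> keys n' \<subseteq> V" using i by blast
      hence "lookup (coeff p k) n' = 0" using p mp_keys[of "coeff p k" V n'] by (auto simp: poly_over_def)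
      thus ?thesis using False lookup_single_mult[of "Poly_Mapping.single i k" 1 "coeff p k" n']
        by (simp add: var_power mult.commute n')
    next
      case F: False
      thus ?thesis using False lookup_single_mult_0[of "Poly_Mapping.single i j + n" "Poly_Mapping.single i k" 1 "coeff p k"]
        by (simp add: var_power mult.commute)
    qed
  qed
  show ?thesis unfolding poly_altdef lookup_sum * by (auto simp: coeff_eq_0)
qed

lemma poly_var_surj:
  assumes p: "p \<in> mp (insert i V)" and i: "i \<notin> V"
  shows "\<exists>q\<in>poly_over (mp V). p = poly q (var i)"
proof -
  define r where "r n = n - Poly_Mapping.single i (lookup n i)" for n :: monom
  define q where "q = (\<Sum>n\<in>keys p. Polynomial.monom (Poly_Mapping.single (r n) (lookup p n)) (lookup n i))"
  have r: "n = r n + Poly_Mapping.single i (lookup n i)" for n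
    by (rule poly_mapping_eqI) (auto simp: r_def lookup_add lookup_minus lookup_single when_def)
  have rV: "keys (r n) \<subseteq> V" if "n \<in> keys p" for n
  proof -
    have "keys n \<subseteq> insert i V" using p that by (auto simp: mp_def)
    moreover have "keys (r n) \<subseteq> keys n" "i \<notin> keys (r n)"
      by (auto simp: r_def in_keys_iff lookup_minus lookup_single when_def)
    ultimately show ?thesis by blast
  qed
  have "coeff q j \<in> mp V" for j unfolding q_def coeff_sum
    by (intro mp_sum) (auto simp: mp_0 intro!: mp_single rV mp_algebraic[OF p] subsetD[OF rV])
  moreover have "poly q (var i) = p"
  proof -
    have "poly q (var i) = (\<Sum>n\<in>keys p. Poly_Mapping.single n (lookup p n))"
      unfolding q_def poly_sum by (intro sum.cong refl) (simp add: poly_monom var_power mult_single r[symmetric])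
    thus ?thesis using pm_sum_singles[of p] by simp
  qed
  ultimately show ?thesis by (intro bexI[of _ q]) (auto simp: poly_over_def)
qed

lemma poly_var_iso:
  assumes i: "i \<notin> V" shows "ring_iso_on (poly_over (mp V)) (mp (insert i V)) (\<lambda>p. poly p (var i))"
proof
  show "bij_betw (\<lambda>p. poly p (var i)) (poly_over (mp V)) (mp (insert i V))"
    unfolding bij_betw_def
  proof
    show "inj_on (\<lambda>p. poly p (var i)) (poly_over (mp V))"
    proof (rule inj_onI, rule ccontr)
      fix p q assume pq: "p \<in> poly_over (mp V)" "q \<in> poly_over (mp V)" "poly p (var i) = poly q (var i)" "p \<noteq> q"
      then obtain j where j: "coeff p j \<noteq> coeff q j" by (auto simp: poly_eq_iff)
      have "coeff p j = coeff q j"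
      proof (rule poly_mapping_eqI)
        fix n
        show "lookup (coeff p j) n = lookup (coeff q j) n"
        proof (cases "keys n \<subseteq> V")
          case True
          thus ?thesis using lookup_poly_var[OF pq(1) i True, of j] lookup_poly_var[OF pq(2) i True, of j] pq(3) by simp
        next
          case False
          hence "lookup (coeff p j) n = 0" "lookup (coeff q j) n = 0"
            using pq(1,2) mp_keys unfolding poly_over_def by blast+
          thus ?thesis by simp
        qed
      qed
      thus False using j by simp
    qed
    show "(\<lambda>p. poly p (var i)) ` poly_over (mp V) = mp (insert i V)"
      using poly_var_in poly_var_surj[OF _ i] by (auto simp: image_iff)
  qed
  show "1 \<in> poly_over (mp V)" "0 \<in> poly_over (mp V)" by (auto simp: poly_over_def mp_0 mp_1 coeff_1)
  show "a * b \<in> poly_over (mp V)" if "a \<in> poly_over (mp V)" "b \<in> poly_over (mp V)" for a b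
    using that by (auto simp: poly_over_def coeff_mult intro!: mp_sum mp_mult)
qed auto

text \<open>Induction on the variables, with Gauss's theorem as the step. Without variables the ring
  is the field of algebraic numbers, where nothing is irreducible.\<close>

lemma mp_irreducibles_prime: "finite V \<Longrightarrow> irreducibles_prime (mp V)"
proof (induction V rule: finite_induct)
  case empty
  have "\<not> irreducible_in (mp {}) p" for p
  proof
    assume p: "irreducible_in (mp {}) p"
    hence p0: "p \<in> mp {}" "p \<noteq> 0" by (auto simp: irreducible_in_def)
    \<comment> \<open>Without variables only degree 0 occurs, so the graded image is constant and
      \<open>p\<close> is a unit.\<close>
    have "hompoly p = [:coeff (hompoly p) 0:]"
    proof (rule poly_eqI, rule poly_mapping_eqI)
      fix k n
      show "lookup (coeff (hompoly p) k) n = lookup (coeff [:coeff (hompoly p) 0:] k) n"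
      proof (cases "lookup p n = 0")
        case True
        thus ?thesis by (cases k) (simp_all add: lookup_hompoly)
      next
        case False
        have "keys n \<subseteq> {}" by (rule mp_keys[OF _ False]) (use p in \<open>simp add: irreducible_in_def\<close>)
        hence "mnorm n = 0" by (simp add: mnorm_def)
        thus ?thesis by (cases k) (simp_all add: lookup_hompoly)
      qed
    qed
    from arg_cong[OF this, of degree] have "tdeg p = 0" unfolding tdeg_def degree_pCons_0 .
    hence "dvd_in (mp {}) p 1" using mp_unit_iff[OF p0(1)] p0(2) by simp
    thus False using p unfolding irreducible_in_def by blast
  qed
  thus ?case by (simp add: irreducibles_prime_def)
next
  case (insert i V)
  interpret factorial_subring "mp V"
    by unfold_locales (rule mp_subring mp_atomic insert.IH)+
  interpret iso: ring_iso_on "poly_over (mp V)" "mp (insert i V)" "\<lambda>p. poly p (var i)"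
    by (rule poly_var_iso[OF insert(2)])
  show ?case unfolding irreducibles_prime_def
  proof (intro allI impI)
    fix g assume g: "irreducible_in (mp (insert i V)) g"
    hence "g \<in> mp (insert i V)" by (simp add: irreducible_in_def)
    then obtain p where p: "p \<in> poly_over (mp V)" "g = poly p (var i)"
      using iso.f_surj by blast
    show "prime_in (mp (insert i V)) g" unfolding p(2)
      by (rule iso.prime_iff[OF irreducible_prime_poly[OF iso.irreducible_iff[OF p(1) g[unfolded p(2)]]]])
  qed
qed

text \<open>View \<open>g\<close> and \<open>a\<close> as polynomials in the variable
  \<open>i\<close> over the remaining variables. As \<open>i\<close> occurs in \<open>g\<close>, its
  degree there is positive, and the one-variable relation yields a nonzero combination
  \<open>c\<close> from which \<open>i\<close> has been eliminated.\<close>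

lemma mp_bezout:
  assumes g: "irreducible_in (mp V) g" and V: "finite V" "i \<in> V" and occ: "lookup g n \<noteq> 0" "lookup n i \<noteq> 0"
    and a: "a \<in> mp V" "\<not> dvd_in (mp V) g a"
  shows "\<exists>c u v. c \<in> mp (V - {i}) \<and> c \<noteq> 0 \<and> u \<in> mp V \<and> v \<in> mp V \<and> c = u * a + v * g"
proof -
  define W where "W = V - {i}"
  have W: "insert i W = V" "i \<notin> W" "finite W" using V unfolding W_def by blast+
  interpret factorial_subring "mp W"
    by unfold_locales (rule mp_subring mp_atomic mp_irreducibles_prime[OF W(3)])+
  interpret iso: ring_iso_on "poly_over (mp W)" "mp V" "\<lambda>p. poly p (var i)"
    by (rule poly_var_iso[OF W(2), unfolded W(1)])
  have "g \<in> mp V" using g by (simp add: irreducible_in_def)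
  then obtain p where p: "p \<in> poly_over (mp W)" "g = poly p (var i)"
    using iso.f_surj by blast
  obtain b where b: "b \<in> poly_over (mp W)" "a = poly b (var i)" using iso.f_surj[OF a(1)] by blast
  have "degree p > 0"
  proof (rule ccontr)
    assume "\<not> degree p > 0"
    then obtain c where c: "p = [:c:]" by (auto elim: degree_eq_zeroE)
    hence "g = c" unfolding p(2) by simp
    moreover have "coeff p 0 \<in> mp W" using p(1) by (simp add: poly_over_def)
    ultimately have "g \<in> mp W" by (simp add: c)
    hence "keys n \<subseteq> W" using occ(1) by (rule mp_keys)
    moreover have "i \<in> keys n" using occ(2) by (simp add: in_keys_iff)
    ultimately show False using W(2) by blast
  qed
  moreover have "\<not> dvd_in (poly_over (mp W)) p b" using a(2) iso.dvd_iff[OF p(1) b(1)] unfolding p(2) b(2) by simp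
  ultimately obtain c u v where c: "c \<in> mp W" "c \<noteq> 0" "u \<in> poly_over (mp W)" "v \<in> poly_over (mp W)" "[:c:] = u * b + v * p"
    using irreducible_dvd_or_bezout[OF iso.irreducible_iff[OF p(1) g[unfolded p(2)]] _ b(1)] by blast
  have "poly [:c:] (var i) = poly (u * b + v * p) (var i)" using c(5) by simp
  hence "c = poly u (var i) * a + poly v (var i) * g" unfolding p(2) b(2) by simp
  moreover have "poly u (var i) \<in> mp V" "poly v (var i) \<in> mp V" using iso.f_in c(3,4) by simp_all
  ultimately show ?thesis using c(1,2) unfolding W_def by blast
qed

section \<open>The coefficients of a rational series\<close>

text \<open>The weights are \<open>B ^ i\<close> as in Kronecker's substitution, with
  \<open>B\<close> larger than all integer roots of the finitely many difference polynomials, so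
  that distinct exponent vectors in \<open>N\<close> get distinct weights. Positive weights ensure
  later that the substitution maps the unit disc into the polydisc.\<close>

lemma exists_injective_weight:
  assumes "finite N" "\<And>n. n \<in> N \<Longrightarrow> monom_in m n"
  shows "\<exists>a::nat \<Rightarrow> nat. (\<forall>i. a i > 0) \<and> inj_on (wdeg a) N"
proof -
  define d where "d n n' = (\<Sum>i<m. Polynomial.monom (int (lookup n i) - int (lookup n' i)) i)" for n n'
  have cd: "coeff (d n n') i = (if i < m then int (lookup n i) - int (lookup n' i) else 0)" for n n' i
    by (simp add: d_def coeff_sum)
  have d0: "d n n' \<noteq> 0" if "n \<in> N" "n' \<in> N" "n \<noteq> n'" for n n'
  proof
    assume "d n n' = 0"
    have "lookup n i = lookup n' i" for i
    proof (cases "i < m")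
      case True
      thus ?thesis using cd[of n n' i] \<open>d n n' = 0\<close> by simp
    next
      case False
      hence "i \<notin> keys n" "i \<notin> keys n'" using that assms(2) by (auto simp: monom_in_def)
      thus ?thesis by (simp add: in_keys_iff)
    qed
    thus False using that by (auto intro: poly_mapping_eqI)
  qed
  define Z where "Z = (\<Union>(n,n')\<in>N \<times> N - Id. {x. poly (d n n') x = 0})"
  have "finite Z" unfolding Z_def using assms(1) d0 by (intro finite_UN_I) (auto intro!: poly_roots_finite)
  define M where "M = Max (insert 0 Z) + 1"
  have M: "x < M" if "x \<in> Z" for x
    using Max_ge[of "insert 0 Z" x] that \<open>finite Z\<close> by (simp add: M_def)
  define B where "B = nat (max M 1)"
  have B: "B > 0" "int B \<notin> Z" using M[of "int B"] by (auto simp: B_def)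
  have wd: "int (wdeg (\<lambda>i. B ^ i) n) = (\<Sum>i<m. int (lookup n i) * int B ^ i)" if "n \<in> N" for n
    using wdeg_superset[of "{..<m}" n "\<lambda>i. B ^ i"] assms(2)[OF that] by (simp add: monom_in_def mult.commute)
  have "inj_on (wdeg (\<lambda>i. B ^ i)) N"
  proof (rule inj_onI, rule ccontr)
    fix n n' assume n: "n \<in> N" "n' \<in> N" "wdeg (\<lambda>i. B ^ i) n = wdeg (\<lambda>i. B ^ i) n'" "n \<noteq> n'"
    have "poly (d n n') (int B) = int (wdeg (\<lambda>i. B ^ i) n) - int (wdeg (\<lambda>i. B ^ i) n')"
      unfolding wd[OF n(1)] wd[OF n(2)] by (simp add: d_def poly_sum poly_monom sum_subtractf[symmetric] left_diff_distrib)
    hence "int B \<in> Z" using n unfolding Z_def by auto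
    thus False using B by simp
  qed
  thus ?thesis using B(1) by (intro exI[of _ "\<lambda>i. B ^ i"]) auto
qed

section \<open>Denominators of algebraic numbers\<close>

lemma algebraic_int_of_int_mult: "algebraic_int x \<Longrightarrow> algebraic_int (of_int c * x :: complex)"
  by (rule algebraic_int_mult) (auto intro: int_imp_algebraic_int)

lemma algebraic_int_of_nat_mult: "algebraic_int x \<Longrightarrow> algebraic_int (of_nat c * x :: complex)"
  using algebraic_int_of_int_mult[of x "int c"] by simp

lemma algebraic_int_multiple:
  fixes x :: complex
  assumes "algebraic x" shows "\<exists>c::nat. c > 0 \<and> algebraic_int (of_nat c * x)"
proof -
  define c where "c = lead_coeff (min_int_poly x)"
  have "c > 0" "algebraic_int (of_int c * x)"
    using min_int_poly[OF assms] degree_min_int_poly[OF assms] algebraic_int_lead_mult by (auto simp: c_def)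
  thus ?thesis by (intro exI[of _ "nat c"]) auto
qed

lemma common_denominator:
  assumes "finite T" "\<And>t. t \<in> T \<Longrightarrow> algebraic (t::complex)"
  shows "\<exists>c::nat. c > 0 \<and> (\<forall>t\<in>T. algebraic_int (of_nat c * t))"
  using assms
proof (induction T)
  case empty
  show ?case by auto
next
  case (insert x T)
  obtain c where c: "c > 0" "\<And>t. t \<in> T \<Longrightarrow> algebraic_int (of_nat c * t)" using insert by auto
  obtain b :: nat where b: "b > 0" "algebraic_int (of_nat b * x)" using algebraic_int_multiple insert by blast
  have "algebraic_int (of_nat (b * c) * t)" if "t \<in> insert x T" for t
  proof (cases "t = x")
    case True
    have "algebraic_int (of_nat c * (of_nat b * x))" by (intro algebraic_int_of_nat_mult b)
    thus ?thesis by (simp add: True mult_ac)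
  next
    case False
    have "algebraic_int (of_nat b * (of_nat c * t))"
      by (intro algebraic_int_of_nat_mult c) (use that False in auto)
    thus ?thesis by (simp add: mult_ac)
  qed
  thus ?case using b c by (intro exI[of _ "b * c"]) auto
qed

text \<open>Only primes dividing \<open>A\<close> occur in \<open>e\<close>, and each with
  multiplicity at most \<open>L\<close>, since 2 raised to that multiplicity is at most
  \<open>e\<close> and hence below \<open>2 ^ Suc L\<close>.\<close>

lemma dvd_power_of_small:
  fixes e A L :: nat
  assumes "e dvd A ^ j" "e < 2 ^ Suc L" "e > 0" "A > 0"
  shows "e dvd A ^ L"
proof (rule multiplicity_le_imp_dvd)
  show "e \<noteq> 0" using assms by simp
  fix p :: nat assume p: "prime p"
  show "multiplicity p e \<le> multiplicity p (A ^ L)"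
  proof (cases "p dvd A")
    case True
    have "multiplicity p A > 0"
      by (subst prime_multiplicity_gt_zero_iff) (use p assms True in auto)
    hence "multiplicity p A \<ge> 1" by simp
    moreover have "multiplicity p (A ^ L) = L * multiplicity p A"
      using p assms by (simp add: prime_elem_multiplicity_power_distrib)
    ultimately have 1: "multiplicity p (A ^ L) \<ge> L" by simp
    have "(2::nat) ^ multiplicity p e \<le> p ^ multiplicity p e" using prime_ge_2_nat[OF p] by (simp add: power_mono)
    also have "\<dots> \<le> e" using assms by (intro dvd_imp_le multiplicity_dvd) auto
    also have "\<dots> < 2 ^ Suc L" by fact
    finally have "multiplicity p e < Suc L" by (rule power_less_imp_less_exp[rotated]) simp
    thus ?thesis using 1 by simp
  next
    case False
    hence "\<not> p dvd A ^ j" using p prime_dvd_power by blast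
    hence "\<not> p dvd e" using assms(1) dvd_trans by blast
    thus ?thesis by (simp add: not_dvd_imp_multiplicity_0)
  qed
qed

lemma algebraic_int_gcd_mult:
  fixes a b :: int and x :: complex
  assumes "algebraic_int (of_int a * x)" "algebraic_int (of_int b * x)"
  shows "algebraic_int (of_int (gcd a b) * x)"
proof -
  obtain u v where "u * a + v * b = gcd a b" using bezout_int by blast
  from arg_cong[OF this, of "\<lambda>c. of_int c * x"]
  have "of_int (gcd a b) * x = of_int u * (of_int a * x) + of_int v * (of_int b * x)"
    by (simp add: algebra_simps)
  thus ?thesis using assms by (auto intro!: algebraic_int_add algebraic_int_of_int_mult)
qed

text \<open>The exponent \<open>j\<close> may be large, but the leading coefficient of the minimal
  polynomial also clears the denominator of \<open>x\<close>, and by the height it is below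
  \<open>2 ^ Suc L\<close>. Its gcd with \<open>A ^ j\<close> clears the denominator too, is just as
  small, and divides \<open>A ^ L\<close>.\<close>

lemma algebraic_int_scaled:
  assumes x: "algebraic x" and deg: "degree (min_int_poly x) \<le> d" and A: "A > 0" "algebraic_int (of_nat (A ^ j) * x)"
    and h: "real d * weil_height x < real (Suc L) * ln 2"
  shows "algebraic_int (of_nat (A ^ L) * x)"
proof -
  define c where "c = lead_coeff (min_int_poly x)"
  have c0: "c > 0" "algebraic_int (of_int c * x)"
    using min_int_poly[OF x] degree_min_int_poly[OF x] algebraic_int_lead_mult by (auto simp: c_def)
  have "ln (real_of_int c) \<le> degree (min_int_poly x) * weil_height x"
    unfolding c_def by (rule ln_lead_le_height[OF x])
  also have "\<dots> \<le> d * weil_height x" using deg weil_height_nonneg[OF x] by (intro mult_right_mono) auto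
  also have "\<dots> < real (Suc L) * ln 2" by (rule h)
  also have "\<dots> = ln (2 ^ Suc L)" by (simp only: ln_realpow zero_less_numeral)
  finally have "ln (real_of_int c) < ln (2 ^ Suc L)" .
  moreover have "real_of_int c > 0" "(2::real) ^ Suc L > 0" using c0 by simp_all
  ultimately have "real_of_int c < 2 ^ Suc L" by (simp only: ln_less_cancel_iff)
  also have "\<dots> = real_of_int (2 ^ Suc L)" by simp
  finally have c2: "c < 2 ^ Suc L" by (simp only: of_int_less_iff)
  define e where "e = gcd c (int (A ^ j))"
  have e: "algebraic_int (of_int e * x)"
    unfolding e_def by (rule algebraic_int_gcd_mult[OF c0(2)]) (use A(2) in simp)
  have e0: "e > 0" "e \<le> c" using c0 by (auto simp: e_def intro!: zdvd_imp_le)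
  have "e dvd int (A ^ j)" unfolding e_def by (rule gcd_dvd2)
  moreover have "int (nat e) = e" using e0 by simp
  ultimately have "int (nat e) dvd int (A ^ j)" by (simp only:)
  hence "nat e dvd A ^ j" by (simp only: int_dvd_int_iff)
  moreover have "nat e < 2 ^ Suc L" using e0 c2 by (simp add: nat_less_iff)
  ultimately have "nat e dvd A ^ L" by (rule dvd_power_of_small) (use e0 A in simp_all)
  then obtain k where k: "A ^ L = nat e * k" by (auto elim: dvdE)
  have "of_nat (A ^ L) * x = of_nat k * (of_int e * x)" unfolding k using e0 by simp
  thus ?thesis using algebraic_int_of_nat_mult[OF e, of k] by (simp only:)
qed

text \<open>The coefficients are normalised to vanish at exponents outside the first
  \<open>m\<close> variables, so that the defining identity can be stated for every exponent
  vector.\<close>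

locale rational_series =
  fixes m :: nat and P Q :: mpoly and f :: "monom \<Rightarrow> complex"
  assumes P: "P \<in> mp {..<m}" and Q: "Q \<in> mp {..<m}" and Q0: "Q \<noteq> 0"
    and f_alg: "algebraic (f n)" and f_supported: "\<not> monom_in m n \<Longrightarrow> f n = 0"
    and rat: "series_mult_coeff Q f n = lookup P n"
begin

text \<open>\<open>Q\<close> may vanish at the origin, so its lowest term is found with an injective
  weight: \<open>s\<close> is the exponent of least weight, and the identity at \<open>n + s\<close>
  determines \<open>f n\<close> from values of \<open>f\<close> at exponents of smaller
  weight.\<close>

lemma recursion:
  obtains a :: "nat \<Rightarrow> nat" and s where "s \<in> keys Q"
    "\<And>n. monom_in m n \<Longrightarrow> f n = lookup P (n + s) / lookup Q s
       - (\<Sum>k\<in>{k\<in>keys Q. monom_le k (n + s)} - {s}. lookup Q k / lookup Q s * f (n + s - k))"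
    "\<And>n k. monom_in m n \<Longrightarrow> k \<in> {k\<in>keys Q. monom_le k (n + s)} - {s} \<Longrightarrow>
       wdeg a (n + s - k) < wdeg a n"
proof -
  have "monom_in m n" if "n \<in> keys Q" for n using Q that by (auto simp: mp_def monom_in_def)
  then obtain a :: "nat \<Rightarrow> nat" where a: "inj_on (wdeg a) (keys Q)"
    using exists_injective_weight[of "keys Q" m] by auto
  have ne: "keys Q \<noteq> {}" using Q0 by simp
  have "Min (wdeg a ` keys Q) \<in> wdeg a ` keys Q" using ne by simp
  then obtain s where s: "s \<in> keys Q" "Min (wdeg a ` keys Q) = wdeg a s" by blast
  have smin: "wdeg a s \<le> wdeg a k" if "k \<in> keys Q" for k
    unfolding s(2)[symmetric] using that by simp
  have less: "wdeg a s < wdeg a k" if "k \<in> keys Q" "k \<noteq> s" for k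
    using smin[OF that(1)] inj_onD[OF a _ that(1) s(1)] that(2) by fastforce
  show ?thesis
  proof (rule that[OF s(1)])
    fix n assume n: "monom_in m n"
    let ?K = "{k\<in>keys Q. monom_le k (n + s)}"
    have q: "lookup Q s \<noteq> 0" using s(1) by (simp add: in_keys_iff)
    have "s \<in> ?K" using s(1) by (auto simp: monom_le_def lookup_add)
    hence "lookup P (n + s) = lookup Q s * f n + (\<Sum>k\<in>?K - {s}. lookup Q k * f (n + s - k))"
      unfolding rat[symmetric] series_mult_coeff_def by (subst sum.remove[of _ s]) auto
    thus "f n = lookup P (n + s) / lookup Q s - (\<Sum>k\<in>?K - {s}. lookup Q k / lookup Q s * f (n + s - k))"
      using q by (simp add: field_simps sum_divide_distrib[symmetric])
  next
    fix n k assume k: "k \<in> {k\<in>keys Q. monom_le k (n + s)} - {s}"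
    then obtain l where "n + s = k + l" by (auto simp: monom_le_iff)
    hence "wdeg a n + wdeg a s = wdeg a k + wdeg a l" and "n + s - k = l"
      by (metis wdeg_add, simp)
    thus "wdeg a (n + s - k) < wdeg a n" using less[of k] k by auto
  qed
qed

text \<open>By the recursion every \<open>f n\<close> is an integer polynomial in the finitely many
  numbers of \<open>T\<close>, so a common denominator \<open>A\<close> of \<open>T\<close> gives
  powers of \<open>A\<close> as denominators. The exponent \<open>j\<close> depends on
  \<open>n\<close> and comes under control only through heights. The extra set \<open>T0\<close>
  lets the same ring hold the coefficients of a factor of \<open>Q\<close>.\<close>

lemma coefficient_ring:
  assumes T0: "finite T0" "\<And>t. t \<in> T0 \<Longrightarrow> algebraic t"
  obtains d R A where "bounded_degree_ring (of_rat :: rat \<Rightarrow> complex) d R" "T0 \<subseteq> R" "A > 0"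
    "\<And>n. f n \<in> R" "\<And>n. \<exists>j. algebraic_int (of_nat (A ^ j) * f n)"
proof -
  obtain a :: "nat \<Rightarrow> nat" and s where s: "s \<in> keys Q"
    and rec: "\<And>n. monom_in m n \<Longrightarrow> f n = lookup P (n + s) / lookup Q s
       - (\<Sum>k\<in>{k\<in>keys Q. monom_le k (n + s)} - {s}. lookup Q k / lookup Q s * f (n + s - k))"
    and less: "\<And>n k. monom_in m n \<Longrightarrow> k \<in> {k\<in>keys Q. monom_le k (n + s)} - {s} \<Longrightarrow>
       wdeg a (n + s - k) < wdeg a n"
    by (rule recursion) (rule that; assumption)
  define T where "T = T0 \<union> (\<lambda>n. lookup P n / lookup Q s) ` keys P \<union> (\<lambda>n. lookup Q n / lookup Q s) ` keys Q"
  have algdiv: "algebraic (x / lookup Q s)" if "algebraic x" for x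
    unfolding divide_inverse using that mp_algebraic[OF Q] by (intro algebraic_mult) auto
  have T: "finite T" "\<And>t. t \<in> T \<Longrightarrow> algebraic t"
    using T0 algdiv mp_algebraic[OF P] mp_algebraic[OF Q] by (auto simp: T_def)
  obtain d R where R: "bounded_degree_ring (of_rat :: rat \<Rightarrow> complex) d R" "T \<subseteq> R"
    by (rule integral_ring[OF comm_ring_hom_of_rat T(1)]) (use T(2) in \<open>auto simp: algebraic_iff_monic\<close>)
  obtain A :: nat where A: "A > 0" "\<And>t. t \<in> T \<Longrightarrow> algebraic_int (of_nat A * t)"
    using common_denominator[OF T] by blast
  define D where "D x \<longleftrightarrow> (\<exists>j. algebraic_int (of_nat (A ^ j) * x))" for x :: complex
  have Dadd: "D (x + y)" if xy: "D x" "D y" for x y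
  proof -
    obtain i j where "algebraic_int (of_nat (A ^ i) * x)" "algebraic_int (of_nat (A ^ j) * y)"
      using xy by (auto simp: D_def)
    hence "algebraic_int (of_nat (A ^ j) * (of_nat (A ^ i) * x) + of_nat (A ^ i) * (of_nat (A ^ j) * y))"
      by (metis algebraic_int_add algebraic_int_of_nat_mult)
    thus ?thesis unfolding D_def by (intro exI[of _ "i + j"]) (simp add: power_add algebra_simps)
  qed
  have Dmult: "D (x * y)" if xy: "D x" "D y" for x y
  proof -
    obtain i j where "algebraic_int (of_nat (A ^ i) * x)" "algebraic_int (of_nat (A ^ j) * y)"
      using xy by (auto simp: D_def)
    hence "algebraic_int ((of_nat (A ^ i) * x) * (of_nat (A ^ j) * y))"
      by (rule algebraic_int_mult)
    thus ?thesis unfolding D_def by (intro exI[of _ "i + j"]) (simp add: power_add mult_ac)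
  qed
  have Duminus: "D (- x)" if "D x" for x using that by (auto simp: D_def)
  have D0: "D 0" by (auto simp: D_def)
  have Dsum: "D (sum g I)" if "\<And>i. i \<in> I \<Longrightarrow> D (g i)" for g and I :: "monom set"
    using that by (induction I rule: infinite_finite_induct) (auto intro: Dadd D0)
  have DT: "D t" if "t \<in> T" for t unfolding D_def using A(2)[OF that] by (intro exI[of _ 1]) simp
  have PT: "D (lookup P n / lookup Q s) \<and> lookup P n / lookup Q s \<in> R" for n
  proof (cases "n \<in> keys P")
    case True
    hence "lookup P n / lookup Q s \<in> T" by (auto simp: T_def)
    thus ?thesis using DT R by auto
  qed (simp add: in_keys_iff D0 bdr_0[OF R(1)])
  have QT: "D (lookup Q n / lookup Q s) \<and> lookup Q n / lookup Q s \<in> R" if "n \<in> keys Q" for n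
  proof -
    have "lookup Q n / lookup Q s \<in> T" using that by (auto simp: T_def)
    thus ?thesis using DT R by auto
  qed
  have "D (f n) \<and> f n \<in> R" for n
  proof (induction "wdeg a n" arbitrary: n rule: less_induct)
    case less': less
    show ?case
    proof (cases "monom_in m n")
      case False
      thus ?thesis by (simp add: f_supported D0 bdr_0[OF R(1)])
    next
      case True
      let ?K = "{k\<in>keys Q. monom_le k (n + s)} - {s}"
      let ?S = "\<Sum>k\<in>?K. lookup Q k / lookup Q s * f (n + s - k)"
      have IH: "D (f (n + s - k)) \<and> f (n + s - k) \<in> R" if "k \<in> ?K" for k
        using less'.hyps less[OF True that] by blast
      have "D ?S" by (rule Dsum, rule Dmult) (use IH QT in auto)
      moreover have "?S \<in> R" by (rule bdr_sum[OF R(1)], rule bdr_mult[OF R(1)]) (use IH QT in auto)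
      ultimately have "D (lookup P (n + s) / lookup Q s - ?S)" "lookup P (n + s) / lookup Q s - ?S \<in> R"
        using Dadd[of "lookup P (n + s) / lookup Q s" "- ?S"] Duminus[of ?S] PT bdr_diff[OF R(1)] by auto
      thus ?thesis unfolding rec[OF True, symmetric] by blast
    qed
  qed
  hence D: "\<exists>j. algebraic_int (of_nat (A ^ j) * f n)" "f n \<in> R" for n by (auto simp: D_def)
  show ?thesis
    by (rule that[OF R(1) _ A(1) D(2) D(1)]) (use R(2) in \<open>auto simp: T_def\<close>)
qed

end

section \<open>Products of polynomials with coefficient families\<close>

lemma lookup_mult_series:
  "lookup (Q * A) n = series_mult_coeff Q (lookup A) n"
proof -
  have "lookup (Q * A) n = (\<Sum>k\<in>keys Q. lookup (Poly_Mapping.single k (lookup Q k) * A) n)"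
    by (subst pm_sum_singles[of Q]) (simp add: sum_distrib_right lookup_sum)
  also have "\<dots> = (\<Sum>k\<in>keys Q. if monom_le k n then lookup Q k * lookup A (n - k) else 0)"
  proof (rule sum.cong[OF refl])
    fix k
    show "lookup (Poly_Mapping.single k (lookup Q k) * A) n = (if monom_le k n then lookup Q k * lookup A (n - k) else 0)"
    proof (cases "monom_le k n")
      case True
      then obtain l where "n = k + l" by (auto simp: monom_le_iff)
      thus ?thesis using True by (simp add: lookup_single_mult)
    next
      case False
      thus ?thesis by (simp add: monom_le_iff lookup_single_mult_0)
    qed
  qed
  also have "\<dots> = series_mult_coeff Q (lookup A) n"
    unfolding series_mult_coeff_def by (rule sum.mono_neutral_cong_right) auto
  finally show ?thesis .
qed

lemma series_mult_coeff_commute: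
  "series_mult_coeff A (series_mult_coeff B f) n = series_mult_coeff B (series_mult_coeff A f) n"
proof -
  have e: "series_mult_coeff A (series_mult_coeff B f) n
      = (\<Sum>k\<in>keys A. \<Sum>l\<in>keys B. if monom_le (k + l) n then lookup A k * lookup B l * f (n - (k + l)) else 0)" for A B
  proof -
    have "series_mult_coeff A (series_mult_coeff B f) n
      = (\<Sum>k\<in>keys A. if monom_le k n then lookup A k * series_mult_coeff B f (n - k) else 0)"
      unfolding series_mult_coeff_def[of A] by (rule sum.mono_neutral_cong_left) auto
    also have "\<dots> = (\<Sum>k\<in>keys A. \<Sum>l\<in>keys B. if monom_le (k + l) n then lookup A k * lookup B l * f (n - (k + l)) else 0)"
    proof (rule sum.cong[OF refl])
      fix k
      show "(if monom_le k n then lookup A k * series_mult_coeff B f (n - k) else 0)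
        = (\<Sum>l\<in>keys B. if monom_le (k + l) n then lookup A k * lookup B l * f (n - (k + l)) else 0)"
      proof (cases "monom_le k n")
        case True
        then obtain r where r: "n = k + r" by (auto simp: monom_le_iff)
        have le: "monom_le (k + l) n \<longleftrightarrow> monom_le l r" for l
          unfolding r by (auto simp: monom_le_def lookup_add)
        have "series_mult_coeff B f r = (\<Sum>l\<in>keys B. if monom_le l r then lookup B l * f (r - l) else 0)"
          unfolding series_mult_coeff_def by (rule sum.mono_neutral_cong_left) auto
        moreover have nl: "n - (k + l) = r - l" for l
          by (rule poly_mapping_eqI) (simp add: r lookup_minus lookup_add)
        ultimately have "lookup A k * series_mult_coeff B f r
            = (\<Sum>l\<in>keys B. if monom_le (k + l) n then lookup A k * lookup B l * f (n - (k + l)) else 0)"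
          unfolding le nl by (auto simp: sum_distrib_left intro!: sum.cong)
        thus ?thesis using True by (simp add: r)
      next
        case False
        have "\<not> monom_le (k + l) n" for l
        proof
          assume "monom_le (k + l) n"
          hence "monom_le k n" by (auto simp: monom_le_def lookup_add intro: order_trans[OF le_add1])
          thus False using False by simp
        qed
        thus ?thesis using False by simp
      qed
    qed
    finally show ?thesis .
  qed
  show ?thesis unfolding e by (subst sum.swap) (intro sum.cong refl, simp add: add.commute mult.commute mult.left_commute)
qed

section \<open>Multiples of the denominator with coefficients -1, 0, 1\<close>

definition mbox :: "nat \<Rightarrow> nat \<Rightarrow> monom set" where
  "mbox m k = {n. monom_in m n \<and> (\<forall>i. lookup n i < k \<or> \<not> i < m)}"

lemma mbox_iff: "n \<in> mbox m k \<longleftrightarrow> monom_in m n \<and> (\<forall>i<m. lookup n i < k)"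
  by (auto simp: mbox_def)

lemma mbox_card: "finite (mbox m k)" "card (mbox m k) = k ^ m"
proof -
  define g where "g n = restrict (lookup n) {..<m}" for n :: monom
  have inj: "inj_on g (mbox m k)"
  proof (rule inj_onI)
    fix n n' assume n: "n \<in> mbox m k" "n' \<in> mbox m k" "g n = g n'"
    have "lookup n i = lookup n' i" for i
    proof (cases "i < m")
      case True
      thus ?thesis using fun_cong[OF n(3), of i] by (simp add: g_def)
    next
      case False
      hence "i \<notin> keys n" "i \<notin> keys n'" using n by (auto simp: mbox_iff monom_in_def)
      thus ?thesis by (simp add: in_keys_iff)
    qed
    thus "n = n'" by (auto intro: poly_mapping_eqI)
  qed
  have img: "g ` mbox m k = ({..<m} \<rightarrow>\<^sub>E {..<k})"
  proof (intro equalityI subsetI)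
    fix x assume "x \<in> g ` mbox m k"
    thus "x \<in> ({..<m} \<rightarrow>\<^sub>E {..<k})" by (force simp: g_def mbox_iff PiE_def extensional_def)
  next
    fix x assume x: "x \<in> ({..<m} \<rightarrow>\<^sub>E {..<k})"
    define n where "n = (\<Sum>i<m. Poly_Mapping.single i (x i))"
    have l: "lookup n j = (if j < m then x j else 0)" for j
      by (simp add: n_def lookup_sum lookup_single when_def)
    hence "monom_in m n" by (auto simp: monom_in_def in_keys_iff split: if_splits)
    hence "n \<in> mbox m k" using x by (auto simp: mbox_iff l)
    moreover have "g n = x" using x by (auto simp: g_def l fun_eq_iff PiE_def extensional_def)
    ultimately show "x \<in> g ` mbox m k" by blast
  qed
  have fin: "finite ({..<m} \<rightarrow>\<^sub>E {..<k})" by (intro finite_PiE) auto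
  show "finite (mbox m k)" using inj fin img finite_imageD by metis
  have "card (mbox m k) = card ({..<m} \<rightarrow>\<^sub>E {..<k})" using card_image[OF inj] img by simp
  thus "card (mbox m k) = k ^ m" by (simp add: card_PiE)
qed

lemma mbox_mnorm: "n \<in> mbox m k \<Longrightarrow> mnorm n \<le> m * k"
proof -
  assume n: "n \<in> mbox m k"
  have "mnorm n = (\<Sum>i<m. lookup n i)"
    by (rule mnorm_superset) (use n in \<open>auto simp: mbox_iff monom_in_def\<close>)
  also have "\<dots> \<le> (\<Sum>i<m. k)" by (rule sum_mono) (use n in \<open>auto simp: mbox_iff\<close>)
  finally show ?thesis by simp
qed

text \<open>A difference of two powers with exponent \<open>m\<close>, factored. From
  \<open>D\<close> at most \<open>k\<close>, the larger side \<open>k + 2 * D\<close> is at most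
  \<open>3 * k\<close>, whence the power of 3.\<close>

lemma shell_card:
  assumes "k \<ge> D" "D \<ge> 1" "m \<ge> 1"
  shows "real (card (mbox m (k + 2 * D) - mbox m (k + D))) \<le> m * D * 3 ^ (m - 1) * real k ^ (m - 1)"
proof -
  have sub: "mbox m (k + D) \<subseteq> mbox m (k + 2 * D)" by (force simp: mbox_iff)
  define x y :: real where "x = real (k + 2 * D)" and "y = real (k + D)"
  have xy: "0 \<le> y" "y \<le> x" "x \<le> 3 * k" using assms by (auto simp: x_def y_def)
  have "real (card (mbox m (k + 2 * D) - mbox m (k + D))) = x ^ m - y ^ m"
    using card_Diff_subset[OF mbox_card(1) sub] card_mono[OF mbox_card(1) sub]
    by (simp add: mbox_card of_nat_diff x_def y_def)
  also have "\<dots> = (x - y) * (\<Sum>i<m. y ^ (m - Suc i) * x ^ i)" by (rule power_diff_sumr2)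
  also have "\<dots> \<le> (x - y) * (\<Sum>i<m. x ^ (m - 1))"
  proof (intro mult_left_mono sum_mono)
    fix i assume i: "i \<in> {..<m}"
    have "y ^ (m - Suc i) * x ^ i \<le> x ^ (m - Suc i) * x ^ i"
      using xy by (intro mult_right_mono power_mono) auto
    also have "\<dots> = x ^ (m - 1)" using i by (simp flip: power_add)
    finally show "y ^ (m - Suc i) * x ^ i \<le> x ^ (m - 1)" .
  qed (use xy in auto)
  also have "\<dots> = D * m * x ^ (m - 1)" by (simp add: x_def y_def)
  also have "\<dots> \<le> D * m * (3 * real k) ^ (m - 1)" using xy by (intro mult_left_mono power_mono) auto
  also have "\<dots> = m * D * 3 ^ (m - 1) * real k ^ (m - 1)" by (simp add: power_mult_distrib)
  finally show ?thesis by simp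
qed

text \<open>The left side will bound the logarithm of the number of value patterns on the shell; the
  right side is the logarithm of the number of subsets of the box. A factor o(k) times
  \<open>k ^ (m - 1)\<close> loses against \<open>k ^ m\<close>.\<close>

lemma counting_eventually:
  fixes H :: "nat \<Rightarrow> real"
  assumes H: "H \<in> o(\<lambda>n. real n)" and m: "m \<ge> 1"
  shows "\<forall>\<^sub>F k in sequentially. K * real k ^ (m - 1) * (c0 + c1 * H (m * (k + 2 * D)) + c2 * ln (real k)) < real k ^ m * ln 2"
proof -
  have mN: "k \<le> m * (k + 2 * D)" for k
    using mult_le_mono[OF m, of k "k + 2 * D"] by simp
  have "(\<lambda>n. H n / real n) \<longlonglongrightarrow> 0" using smalloD_tendsto[OF H] .
  moreover have "filterlim (\<lambda>k. m * (k + 2 * D)) at_top sequentially"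
    by (rule filterlim_at_top_mono[OF filterlim_ident]) (intro always_eventually allI, use mN in simp)
  ultimately have "(\<lambda>k. H (m * (k + 2 * D)) / real (m * (k + 2 * D))) \<longlonglongrightarrow> 0"
    by (rule filterlim_compose)
  moreover have "(\<lambda>k. real (m * (k + 2 * D)) / real k) \<longlonglongrightarrow> real m" by real_asymp
  ultimately have "(\<lambda>k. H (m * (k + 2 * D)) / real (m * (k + 2 * D)) * (real (m * (k + 2 * D)) / real k)) \<longlonglongrightarrow> 0 * real m"
    by (rule tendsto_mult)
  moreover have "(\<lambda>k. H (m * (k + 2 * D)) / real (m * (k + 2 * D)) * (real (m * (k + 2 * D)) / real k))
      = (\<lambda>k. H (m * (k + 2 * D)) / real k)"
  proof
    fix k
    show "H (m * (k + 2 * D)) / real (m * (k + 2 * D)) * (real (m * (k + 2 * D)) / real k) = H (m * (k + 2 * D)) / real k"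
    proof (cases "k = 0")
      case False
      hence "real (m * (k + 2 * D)) \<noteq> 0" using m by simp
      thus ?thesis by simp
    qed simp
  qed
  ultimately have Hk: "(\<lambda>k. H (m * (k + 2 * D)) / real k) \<longlonglongrightarrow> 0"
    by simp
  have "(\<lambda>k. ln (real k) / real k) \<longlonglongrightarrow> 0" "(\<lambda>k. c0 / real k) \<longlonglongrightarrow> 0" by real_asymp+
  hence "(\<lambda>k. K * (c0 / real k + c1 * (H (m * (k + 2 * D)) / real k) + c2 * (ln (real k) / real k))) \<longlonglongrightarrow> K * (0 + c1 * 0 + c2 * 0)"
    by (intro tendsto_intros Hk)
  hence "\<forall>\<^sub>F k in sequentially. K * (c0 / real k + c1 * (H (m * (k + 2 * D)) / real k) + c2 * (ln (real k) / real k)) < ln 2"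
    by (intro order_tendstoD(2)[where y = "K * (0 + c1 * 0 + c2 * 0)"]) simp_all
  thus ?thesis using eventually_gt_at_top[of 0]
  proof eventually_elim
    case (elim k)
    have k: "real k ^ m = real k ^ (m - 1) * real k" using m by (cases m) auto
    have "K * real k ^ (m - 1) * (c0 + c1 * H (m * (k + 2 * D)) + c2 * ln (real k))
      = real k ^ m * (K * (c0 / real k + c1 * (H (m * (k + 2 * D)) / real k) + c2 * (ln (real k) / real k)))"
      unfolding k using elim by (simp add: field_simps)
    also have "\<dots> < real k ^ m * ln 2" using elim by (intro mult_strict_left_mono) auto
    finally show ?case .
  qed
qed

text \<open>\<open>B\<close> bounds the conjugates of a sum of at most \<open>k ^ m\<close>
  coefficients of height at most \<open>h\<close> after multiplication by \<open>A ^ L\<close>. What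
  matters is that the logarithm of the count grows linearly in \<open>h\<close> and
  \<open>ln k\<close>.\<close>

lemma ln_bounded_ints_count:
  fixes B h :: real
  assumes d: "d \<ge> 1" and A: "A \<ge> 1" and k: "k \<ge> 1" and h: "h \<ge> 0"
    and B: "B = real A ^ L * real k ^ m * exp (d * h)" and L: "real L \<le> d * h / ln 2"
  shows "B \<ge> 1" "ln (d * (2 * (1 + B) ^ d + 1) ^ Suc d) \<le>
     (ln d + Suc d * (ln 3 + d * ln 2)) + (Suc d * d * (d * ln A / ln 2 + d)) * h + (Suc d * d * m) * ln k"
proof -
  have "real A ^ L \<ge> 1" "real k ^ m \<ge> 1" "exp (d * h) \<ge> 1" using A k h by (auto intro!: one_le_power)
  thus B1: "B \<ge> 1" unfolding B by (metis mult_1 mult_mono order_trans zero_le_one mult_ge1_I)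
  have lnB: "ln B = L * ln A + m * ln k + d * h"
    unfolding B using A k by (simp add: ln_mult ln_realpow)
  have "ln A \<ge> 0" using A by simp
  hence "L * ln A \<le> d * h / ln 2 * ln A" using L by (intro mult_right_mono) auto
  hence lnB': "ln B \<le> (d * ln A / ln 2 + d) * h + m * ln k" using lnB by (simp add: field_simps)
  have p1: "(1 + B) ^ d \<ge> 1" using B1 by simp
  have "ln (2 * (1 + B) ^ d + 1) \<le> ln (3 * (1 + B) ^ d)" using p1 by (subst ln_le_cancel_iff) auto
  also have "\<dots> = ln 3 + d * ln (1 + B)" using B1 by (simp add: ln_mult ln_realpow)
  also have "ln (1 + B) \<le> ln (2 * B)" using B1 by simp
  also have "ln (2 * B) = ln 2 + ln B" using B1 by (simp add: ln_mult)
  finally have 1: "ln (2 * (1 + B) ^ d + 1) \<le> ln 3 + d * (ln 2 + ln B)" by (simp add: mult_left_mono)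
  have "ln (d * (2 * (1 + B) ^ d + 1) ^ Suc d) = ln d + Suc d * ln (2 * (1 + B) ^ d + 1)"
    using d p1 by (subst ln_mult) (auto simp: ln_realpow simp del: power_Suc of_nat_Suc intro!: add_pos_nonneg)
  also have "\<dots> \<le> ln d + Suc d * (ln 3 + d * (ln 2 + ((d * ln A / ln 2 + d) * h + m * ln k)))"
    using 1 lnB' by (intro add_left_mono mult_left_mono order_trans[OF 1]) (auto intro!: mult_left_mono)
  also have "\<dots> = (ln d + Suc d * (ln 3 + d * ln 2)) + (Suc d * d * (d * ln A / ln 2 + d)) * h + (Suc d * d * m) * ln k"
    by (simp add: algebra_simps)
  finally show "ln (d * (2 * (1 + B) ^ d + 1) ^ Suc d) \<le>
     (ln d + Suc d * (ln 3 + d * ln 2)) + (Suc d * d * (d * ln A / ln 2 + d)) * h + (Suc d * d * m) * ln k" .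
qed

lemma norm_conj_le_exp_height:
  assumes x: "algebraic x" and d: "degree (min_int_poly x) \<le> d" and h: "weil_height x \<le> h" and s: "alg_hom s"
  shows "cmod (s x) \<le> exp (d * h)"
proof -
  have "ln (max 1 (cmod (s x))) \<le> degree (min_int_poly x) * weil_height x"
    by (rule ln_conj_le_height[OF x alg_hom_conj[OF s x]])
  also have "\<dots> \<le> d * h" using d h weil_height_nonneg[OF x] by (intro mult_mono) auto
  finally have "exp (ln (max 1 (cmod (s x)))) \<le> exp (d * h)" by (subst exp_le_cancel_iff)
  moreover have "exp (ln (max 1 (cmod (s x)))) = max 1 (cmod (s x))" by (rule exp_ln) simp
  ultimately show ?thesis by linarith
qed

lemma pigeonhole_subsets:
  fixes V :: "'v set" and F :: "'r set \<Rightarrow> 'n \<Rightarrow> 'v"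
  assumes "finite X" "finite T" "finite V" "card V ^ card T < 2 ^ card X"
    and "\<And>E n. E \<subseteq> X \<Longrightarrow> n \<in> T \<Longrightarrow> F E n \<in> V"
  shows "\<exists>E E'. E \<subseteq> X \<and> E' \<subseteq> X \<and> E \<noteq> E' \<and> (\<forall>n\<in>T. F E n = F E' n)"
proof -
  define g where "g E = restrict (F E) T" for E
  have sub: "g ` Pow X \<subseteq> (T \<rightarrow>\<^sub>E V)" using assms(5) by (auto simp: g_def)
  have fin: "finite (T \<rightarrow>\<^sub>E V)" using assms by (intro finite_PiE) auto
  have "card (T \<rightarrow>\<^sub>E V) = card V ^ card T" using assms(2) by (simp add: card_PiE)
  hence "card (T \<rightarrow>\<^sub>E V) < card (Pow X)" using assms by (simp add: card_Pow)
  hence "\<not> inj_on g (Pow X)" using card_inj_on_le[OF _ sub fin] by auto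
  then obtain E E' where E: "E \<subseteq> X" "E' \<subseteq> X" "E \<noteq> E'" "g E = g E'" by (auto simp: inj_on_def)
  have "F E n = F E' n" if "n \<in> T" for n using fun_cong[OF E(4), of n] that by (simp add: g_def)
  thus ?thesis using E by blast
qed

context rational_series
begin

text \<open>\<open>C\<close> is the product of \<open>S\<close> and \<open>f\<close> cut off at the
  shell. As that product vanishes on the shell, \<open>C\<close> agrees with it on the whole larger
  box, which settles \<open>Q * C\<close> there; outside that box \<open>Q * C\<close> and
  \<open>S * P\<close> are both 0, because \<open>D\<close> bounds the exponents of \<open>P\<close>
  and \<open>Q\<close>.\<close>

lemma truncate:
  assumes S: "S \<in> mp {..<m}" and bS: "\<And>n i. lookup S n \<noteq> 0 \<Longrightarrow> i < m \<Longrightarrow> lookup n i < k"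
    and D: "\<And>n i. n \<in> keys P \<union> keys Q \<Longrightarrow> lookup n i \<le> D"
    and vanish: "\<And>n. n \<in> mbox m (k + 2 * D) - mbox m (k + D) \<Longrightarrow> series_mult_coeff S f n = 0"
  shows "\<exists>C\<in>mp {..<m}. Q * C = S * P"
proof -
  define F where "F = series_mult_coeff S f"
  define C where "C = (\<Sum>n\<in>mbox m (k + D). Poly_Mapping.single n (F n))"
  have lC: "lookup C n = (if n \<in> mbox m (k + D) then F n else 0)" for n
    using mbox_card(1)[of m "k + D"] by (simp add: C_def lookup_sum lookup_single when_def)
  have Falg: "algebraic (F n)" for n unfolding F_def series_mult_coeff_def
    by (intro algebraic_sum algebraic_mult mp_algebraic[OF S] f_alg)
  have "C \<in> mp {..<m}"
    by (rule mpI) (auto simp: lC mbox_iff monom_in_def Falg split: if_splits)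
  moreover have "lookup (Q * C) n = lookup (S * P) n" for n
  proof -
    have QF: "series_mult_coeff Q F n = lookup (S * P) n"
      unfolding F_def series_mult_coeff_commute[of Q S] rat lookup_mult_series ..
    have supported: "F n = 0" if "\<not> monom_in m n" for n
      unfolding F_def series_mult_coeff_def
    proof (intro sum.neutral ballI)
      fix l assume l: "l \<in> {l \<in> keys S. monom_le l n}"
      then obtain r where r: "n = l + r" by (auto simp: monom_le_iff)
      have "monom_in m l" using S l by (auto simp: mp_def monom_in_def)
      hence "\<not> monom_in m r" using that by (auto simp: r monom_in_add)
      thus "lookup S l * f (n - l) = 0" by (simp add: r f_supported)
    qed
    show ?thesis
    proof (cases "\<forall>i<m. lookup n i < k + 2 * D")
      case True
      have "lookup C (n - l) = F (n - l)" for l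
      proof (cases "monom_in m (n - l)")
        case mi: True
        have "n - l \<in> mbox m (k + 2 * D)"
          using True mi by (auto simp: mbox_iff lookup_minus intro: le_less_trans[OF diff_le_self])
        thus ?thesis using vanish[of "n - l"] by (auto simp: lC F_def)
      next
        case False
        thus ?thesis by (simp add: lC supported mbox_iff)
      qed
      hence "lookup (Q * C) n = series_mult_coeff Q F n"
        unfolding lookup_mult_series by (simp add: series_mult_coeff_def)
      thus ?thesis using QF by simp
    next
      case False
      then obtain i where i: "i < m" "lookup n i \<ge> k + 2 * D" by auto
      have "lookup (Q * C) n = 0" unfolding lookup_mult_series series_mult_coeff_def
      proof (intro sum.neutral ballI)
        fix l assume "l \<in> {l \<in> keys Q. monom_le l n}"
        hence "lookup (n - l) i \<ge> k + D" using i D[of l i] by (auto simp: lookup_minus)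
        hence "n - l \<notin> mbox m (k + D)" using i by (force simp: mbox_iff)
        thus "lookup Q l * lookup C (n - l) = 0" by (simp add: lC)
      qed
      moreover have "lookup (S * P) n = 0" unfolding lookup_mult_series series_mult_coeff_def
      proof (intro sum.neutral ballI)
        fix l assume l: "l \<in> {l \<in> keys S. monom_le l n}"
        hence "lookup l i < k" using bS[of l i] i by (auto simp: in_keys_iff)
        hence "lookup (n - l) i > D" using i by (simp add: lookup_minus)
        hence "n - l \<notin> keys P" using D[of "n - l" i] by auto
        thus "lookup S l * lookup P (n - l) = 0" by (simp add: in_keys_iff)
      qed
      ultimately show ?thesis by simp
    qed
  qed
  ultimately show ?thesis by (intro bexI[of _ C] poly_mapping_eqI) auto
qed

text \<open>Pigeonhole over the polynomials S with coefficients 0 and 1 supported on a box of side k: the values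
  of S f on a shell around the box are few, because they are algebraic numbers of bounded degree with
  denominators and conjugates of size exp(o(k)), and there are only O(k^(m-1)) points per layer.\<close>
lemma small_multiple:
  assumes R: "bounded_degree_ring (of_rat :: rat \<Rightarrow> complex) d R" "\<And>n. f n \<in> R"
    and A: "A > 0" "\<And>n. \<exists>j. algebraic_int (of_nat (A ^ j) * f n)"
    and H: "\<And>n N. monom_in m n \<Longrightarrow> mnorm n \<le> N \<Longrightarrow> weil_height (f n) \<le> H N"
    and Ho: "H \<in> o(\<lambda>n. real n)" and m: "m \<ge> 1"
  shows "\<exists>S\<in>mp {..<m}. S \<noteq> 0 \<and> (\<forall>n. lookup S n \<in> {-1,0,1}) \<and> (\<exists>C\<in>mp {..<m}. Q * C = S * P)"
proof -
  have d: "d \<ge> 1" using R(1) unfolding bounded_degree_ring_def by auto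
  obtain D where D: "D \<ge> 1" "\<And>n i. n \<in> keys P \<union> keys Q \<Longrightarrow> lookup n i \<le> D"
  proof
    let ?D = "Suc (\<Sum>n\<in>keys P \<union> keys Q. mnorm n)"
    show "?D \<ge> 1" by simp
    fix n i assume n: "n \<in> keys P \<union> keys Q"
    have "lookup n i \<le> mnorm n" by (rule lookup_le_mnorm)
    also have "\<dots> \<le> (\<Sum>n\<in>keys P \<union> keys Q. mnorm n)" using n by (intro member_le_sum) auto
    finally show "lookup n i \<le> ?D" by simp
  qed
  have H0: "H N \<ge> 0" for N
    using H[of 0 N] weil_height_nonneg[OF f_alg[of 0]] by (simp add: monom_in_def)
  \<comment> \<open>These are the constants of \<open>ln_bounded_ints_count\<close>, and
    \<open>K\<close> is that of \<open>shell_card\<close>.\<close>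
  define c0 c1 c2 where "c0 = ln d + Suc d * (ln 3 + d * ln 2)"
    and "c1 = Suc d * d * (d * ln (real A) / ln 2 + d)" and "c2 = real (Suc d * d * m)"
  define K where "K = real m * real D * 3 ^ (m - 1)"
  have "\<forall>\<^sub>F k in sequentially. k \<ge> D \<and> k \<ge> 1 \<and> K * real k ^ (m - 1) * (c0 + c1 * H (m * (k + 2 * D)) + c2 * ln (real k)) < real k ^ m * ln 2"
    by (intro eventually_conj eventually_ge_at_top counting_eventually[OF Ho m])
  then obtain k where k: "k \<ge> D" "k \<ge> 1"
    and ineq: "K * real k ^ (m - 1) * (c0 + c1 * H (m * (k + 2 * D)) + c2 * ln (real k)) < real k ^ m * ln 2"
    by (auto simp: eventually_sequentially)
  define N h where "N = m * (k + 2 * D)" and "h = H N"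
  \<comment> \<open>Chosen by the height bound: leading coefficients of the minimal polynomials in
    question stay below \<open>2 ^ Suc L\<close>, as \<open>algebraic_int_scaled\<close>
    requires.\<close>
  define L where "L = nat \<lfloor>d * h / ln 2\<rfloor>"
  have "d * h / ln 2 \<ge> 0" using H0[of N] by (simp add: h_def)
  hence L: "real L \<le> d * h / ln 2" "d * h < Suc L * ln 2"
    unfolding L_def by (linarith, simp add: pos_divide_less_eq[symmetric], linarith)
  define B where "B = real A ^ L * real k ^ m * exp (d * h)"
  have A1: "A \<ge> 1" using A(1) by simp
  note cnt = ln_bounded_ints_count[OF d A1 k(2) H0[of N, folded h_def] B_def L(1)]
  define V where "V = bounded_ints d B"
  define T where "T = mbox m (k + 2 * D) - mbox m (k + D)"
  define X where "X = mbox m k"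
  \<comment> \<open>The coefficient at \<open>n\<close> of \<open>f\<close> times the sum of the
    monomials in \<open>E\<close>, multiplied by \<open>A ^ L\<close> so that on the shell it
    becomes an algebraic integer.\<close>
  define F where "F E n = of_nat (A ^ L) * (\<Sum>r\<in>{r\<in>E. monom_le r n}. f (n - r))" for E n
  have finX: "finite X" "card X = k ^ m" by (simp_all add: X_def mbox_card)
  have finT: "finite T" by (simp add: T_def mbox_card)
  have finV: "finite V" "real (card V) \<le> d * (2 * (1 + B) ^ d + 1) ^ Suc d"
    using bounded_ints_card[OF cnt(1), of d] by (auto simp: V_def)
  \<comment> \<open>Taking logarithms requires a positive \<open>card V\<close>; for empty
    \<open>V\<close> the power is 0 or, over an empty shell, 1.\<close>
  have count_less: "card V ^ card T < 2 ^ card X"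
  proof (cases "card V = 0")
    case True
    show ?thesis
    proof (cases "card T = 0")
      case T0: True
      have "card X > 0" using k finX by simp
      hence "(1::nat) < 2 ^ card X" by (intro one_less_power) simp_all
      thus ?thesis using T0 by simp
    next
      case False
      thus ?thesis using True by (simp only: neq0_conv zero_power) simp
    qed
  next
    case False
    hence "card V \<ge> 1" by linarith
    hence V1: "real (card V) \<ge> 1" using of_nat_mono[of 1 "card V", where 'a=real] by linarith
    have "ln (real (card V)) \<le> ln (d * (2 * (1 + B) ^ d + 1) ^ Suc d)"
      using finV(2) V1 by (intro ln_mono) auto
    also have "\<dots> \<le> c0 + c1 * h + c2 * ln k" using cnt(2) by (simp only: c0_def c1_def c2_def)
    finally have lV: "ln (real (card V)) \<le> c0 + c1 * h + c2 * ln k" .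
    have "ln (real (card V) ^ card T) = card T * ln (real (card V))" using V1 by (simp add: ln_realpow)
    also have "\<dots> \<le> (K * real k ^ (m - 1)) * (c0 + c1 * h + c2 * ln k)"
      using lV V1 shell_card[OF k(1) D(1) m] by (intro mult_mono) (auto simp: K_def T_def)
    also have "\<dots> < real k ^ m * ln 2" using ineq by (simp add: h_def N_def)
    also have "\<dots> = ln (2 ^ card X)" by (simp add: finX ln_realpow)
    finally have "real (card V) ^ card T < 2 ^ card X" using V1 by (subst (asm) ln_less_cancel_iff) auto
    hence "real (card V ^ card T) < real (2 ^ card X)" by simp
    thus ?thesis by (simp only: of_nat_less_iff)
  qed
  have fN: "algebraic_int (of_nat (A ^ L) * f n)" "\<And>s. alg_hom s \<Longrightarrow> cmod (s (f n)) \<le> exp (d * h)" if "mnorm n \<le> N" for n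
  proof -
    have "algebraic_int (of_nat (A ^ L) * f n) \<and> (\<forall>s. alg_hom s \<longrightarrow> cmod (s (f n)) \<le> exp (d * h))"
    proof (cases "monom_in m n")
      case False
      thus ?thesis by (simp add: f_supported alg_hom_0)
    next
      case True
    have wh: "weil_height (f n) \<le> h" using H[OF True that] by (simp add: h_def)
    have deg: "degree (min_int_poly (f n)) \<le> d" using bounded_degree(2)[OF R(1,2)] .
    obtain j where j: "algebraic_int (of_nat (A ^ j) * f n)" using A(2) by blast
    have "real d * weil_height (f n) < Suc L * ln 2"
      using mult_left_mono[OF wh, of "real d"] L(2) by linarith
    hence "algebraic_int (of_nat (A ^ L) * f n)"
      by (rule algebraic_int_scaled[OF f_alg deg A(1) j])
    thus ?thesis using norm_conj_le_exp_height[OF f_alg deg wh] by blast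
    qed
    thus "algebraic_int (of_nat (A ^ L) * f n)" "\<And>s. alg_hom s \<Longrightarrow> cmod (s (f n)) \<le> exp (d * h)" by blast+
  qed
  have FV: "F E n \<in> V" if E: "E \<subseteq> X" and n: "n \<in> T" for E n
  proof -
    have mn: "mnorm (n - r) \<le> N" if "monom_le r n" for r
    proof -
      obtain l where "n = r + l" using \<open>monom_le r n\<close> by (auto simp: monom_le_iff)
      hence "mnorm (n - r) \<le> mnorm n" by (simp add: mnorm_add)
      also have "\<dots> \<le> N" unfolding N_def using n by (intro mbox_mnorm) (simp add: T_def)
      finally show ?thesis .
    qed
    have alg_nat: "algebraic (of_nat j :: complex)" for j by (auto intro: rat_imp_algebraic)
    let ?E = "{r\<in>E. monom_le r n}"
    have finE: "finite ?E" "card ?E \<le> k ^ m"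
      using finite_subset[OF _ finX(1), of ?E] card_mono[OF finX(1), of ?E] E finX(2) by auto
    have eq: "F E n = (\<Sum>r\<in>?E. of_nat (A ^ L) * f (n - r))" by (simp add: F_def sum_distrib_left)
    have "algebraic_int (F E n)" unfolding eq by (intro algebraic_int_sum fN(1) mn) auto
    moreover have "F E n \<in> R" unfolding eq by (intro bdr_sum[OF R(1)] bdr_mult[OF R(1)] bdr_of_nat[OF R(1)] R(2))
    hence "degree (min_int_poly (F E n)) \<le> d" by (rule bounded_degree(2)[OF R(1)])
    moreover have "cmod (s (F E n)) \<le> B" if s: "alg_hom s" for s
    proof -
      have "s (F E n) = (\<Sum>r\<in>?E. of_nat (A ^ L) * s (f (n - r)))"
        unfolding eq by (subst alg_hom_sum[OF s])
          (auto intro!: algebraic_mult[OF _ f_alg] alg_nat sum.cong simp: alg_hom_mult[OF s alg_nat f_alg] alg_hom_of_nat[OF s] simp del: of_nat_power)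
      also have "cmod \<dots> \<le> (\<Sum>r\<in>?E. real A ^ L * exp (d * h))"
        by (intro sum_norm_le) (auto simp: norm_mult norm_power intro!: mult_left_mono fN(2) mn s)
      also have "\<dots> = card ?E * (real A ^ L * exp (d * h))" by simp
      also have "\<dots> \<le> real (k ^ m) * (real A ^ L * exp (d * h))"
        using finE(2) by (intro mult_right_mono) (auto simp del: of_nat_power)
      also have "\<dots> = B" by (simp add: B_def)
      finally show ?thesis .
    qed
    ultimately show ?thesis by (simp add: V_def bounded_ints_def)
  qed
  have "\<exists>E E'. E \<subseteq> X \<and> E' \<subseteq> X \<and> E \<noteq> E' \<and> (\<forall>n\<in>T. F E n = F E' n)"
    by (rule pigeonhole_subsets[OF finX(1) finT finV(1) count_less]) (rule FV)
  then obtain E E' where E: "E \<subseteq> X" "E' \<subseteq> X" "E \<noteq> E'" "\<And>n. n \<in> T \<Longrightarrow> F E n = F E' n"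
    by blast
  define mon where "mon E = (\<Sum>r\<in>E. Poly_Mapping.single r (1::complex))" for E :: "monom set"
  have lm: "lookup (mon E) n = (if n \<in> E then 1 else 0)" if "E \<subseteq> X" for E n
    using finite_subset[OF that finX(1)] by (simp add: mon_def lookup_sum lookup_single when_def)
  \<comment> \<open>Two different subsets with equal values on the shell: in the difference these
    values cancel, and the coefficients are -1, 0 or 1.\<close>
  define S where "S = mon E - mon E'"
  have lS: "lookup S n = (if n \<in> E then 1 else 0) - (if n \<in> E' then 1 else 0)" for n
    using E by (simp add: S_def lookup_minus lm)
  have Sn: "n \<in> X" if "lookup S n \<noteq> 0" for n using that E by (auto simp: lS split: if_splits)
  have S: "S \<in> mp {..<m}"
    by (rule mpI) (use Sn in \<open>auto simp: X_def mbox_iff monom_in_def lS rat_imp_algebraic\<close>)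
  obtain r where r: "(r \<in> E) \<noteq> (r \<in> E')" using E(3) by blast
  have "lookup S r \<noteq> 0" using r by (auto simp: lS)
  hence "S \<noteq> 0" by auto
  moreover have "lookup S n \<in> {-1,0,1}" for n by (simp add: lS)
  moreover have "\<exists>C\<in>mp {..<m}. Q * C = S * P"
  proof (rule truncate[OF S _ D(2)])
    show "lookup n i < k" if "lookup S n \<noteq> 0" "i < m" for n i
      using Sn[OF that(1)] that(2) by (simp add: X_def mbox_iff)
    fix n assume "n \<in> mbox m (k + 2 * D) - mbox m (k + D)"
    hence "F E n = F E' n" by (intro E(4)) (simp add: T_def)
    hence eq: "(\<Sum>r\<in>{r\<in>E. monom_le r n}. f (n - r)) = (\<Sum>r\<in>{r\<in>E'. monom_le r n}. f (n - r))"
      using A(1) by (simp add: F_def)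
    have sm: "(\<Sum>r\<in>{r\<in>X. monom_le r n}. (if r \<in> E then 1 else 0) * f (n - r)) = (\<Sum>r\<in>{r\<in>E. monom_le r n}. f (n - r))"
      if "E \<subseteq> X" for E
      using finX(1) that by (intro sum.mono_neutral_cong_right) auto
    have "series_mult_coeff S f n = (\<Sum>r\<in>{r\<in>X. monom_le r n}. lookup S r * f (n - r))"
      unfolding series_mult_coeff_def using finX(1) Sn
      by (intro sum.mono_neutral_left) (auto simp: in_keys_iff)
    also have "\<dots> = 0" unfolding lS left_diff_distrib sum_subtractf sm[OF E(1)] sm[OF E(2)] by (simp add: eq)
    finally show "series_mult_coeff S f n = 0" .
  qed
  ultimately have "S \<noteq> 0 \<and> (\<forall>n. lookup S n \<in> {-1,0,1}) \<and> (\<exists>C\<in>mp {..<m}. Q * C = S * P)" by blast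
  thus ?thesis by (rule bexI[OF _ S])
qed

end

section \<open>Zeros in the open polydisc\<close>

text \<open>Restriction to a curve with polynomial coordinates. The cases in use are lines, the
  curves \<open>t ^ a i\<close> of Kronecker's substitution, and rays through the origin.\<close>

interpretation ps: coeff_hom "\<lambda>c::complex. [:c:]" "wt Z" for Z :: "nat \<Rightarrow> complex poly"
  by unfold_locales (auto simp: wt_add one_pCons[symmetric] mult.commute)

abbreviation psub :: "(nat \<Rightarrow> complex poly) \<Rightarrow> mpoly \<Rightarrow> complex poly" where "psub Z \<equiv> ps.msub Z"

lemma psub_mult: "psub Z (p * q) = psub Z p * psub Z q" by (simp add: ps.msub_mult)

lemma poly_wt: "poly (wt Z n) t = wt (\<lambda>i. poly (Z i) t) n"
  by (simp add: wt_def poly_prod)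

lemma poly_psub: "poly (psub Z p) t = meval (\<lambda>i. poly (Z i) t) p"
  by (simp add: ps.msub_def ev.msub_def poly_sum poly_wt)

lemma wt_monom: "wt (\<lambda>i. Polynomial.monom 1 (a i)) n = Polynomial.monom (1::complex) (wdeg a n)"
proof -
  have "(\<Prod>i\<in>K. Polynomial.monom 1 (a i) ^ lookup n i) = Polynomial.monom (1::complex) (\<Sum>i\<in>K. a i * lookup n i)" for K
    by (induction K rule: infinite_finite_induct) (auto simp: monom_power mult_monom)
  thus ?thesis by (simp add: wt_def wdeg_def)
qed

abbreviation kron :: "(nat \<Rightarrow> nat) \<Rightarrow> mpoly \<Rightarrow> complex poly" where
  "kron a \<equiv> psub (\<lambda>i. Polynomial.monom 1 (a i))"

lemma coeff_kron: "coeff (kron a p) k = (\<Sum>n\<in>keys p. if wdeg a n = k then lookup p n else 0)"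
  unfolding ps.msub_def coeff_sum by (intro sum.cong refl) (simp add: wt_monom)

lemma coeff_kron_inj:
  assumes "inj_on (wdeg a) (keys p)" "n \<in> keys p" shows "coeff (kron a p) (wdeg a n) = lookup p n"
proof -
  have "coeff (kron a p) (wdeg a n) = (\<Sum>l\<in>keys p. if l = n then lookup p l else 0)"
    unfolding coeff_kron by (intro sum.cong refl) (use assms in \<open>auto dest: inj_onD\<close>)
  thus ?thesis using assms(2) by simp
qed

lemma coeff_kron_in:
  assumes "inj_on (wdeg a) (keys p)" "\<And>n. lookup p n \<in> C" "0 \<in> C" shows "coeff (kron a p) k \<in> C"
proof (cases "\<exists>n\<in>keys p. wdeg a n = k")
  case True
  thus ?thesis using coeff_kron_inj[OF assms(1)] assms(2) by auto
next
  case False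
  hence "coeff (kron a p) k = 0" unfolding coeff_kron by (intro sum.neutral) auto
  thus ?thesis using assms(3) by simp
qed

lemma kron_nonzero: "inj_on (wdeg a) (keys p) \<Longrightarrow> p \<noteq> 0 \<Longrightarrow> kron a p \<noteq> 0"
proof -
  assume "inj_on (wdeg a) (keys p)" "p \<noteq> 0"
  moreover then obtain n where "n \<in> keys p" by (metis all_not_in_conv keys_eq_empty)
  ultimately show ?thesis using coeff_kron_inj[of a p n] by (auto simp: in_keys_iff)
qed

lemma meval_cong: "(\<And>n i. lookup p n \<noteq> 0 \<Longrightarrow> i \<in> keys n \<Longrightarrow> x i = y i) \<Longrightarrow> meval x p = meval y p"
  unfolding ev.msub_def wt_def
  by (intro sum.cong refl arg_cong2[where f = "(*)"] prod.cong) (simp_all add: in_keys_iff)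

lemma meval_nonzero_point:
  assumes "c \<in> mp {..<m}" "c \<noteq> 0" shows "\<exists>x. meval x c \<noteq> 0"
proof -
  have "monom_in m n" if "n \<in> keys c" for n using assms(1) that by (auto simp: mp_def monom_in_def)
  then obtain a :: "nat \<Rightarrow> nat" where a: "inj_on (wdeg a) (keys c)"
    using exists_injective_weight[of "keys c" m] by auto
  have "kron a c \<noteq> 0" by (rule kron_nonzero[OF a assms(2)])
  then obtain t where "poly (kron a c) t \<noteq> 0" using poly_all_0_iff_0 by blast
  thus ?thesis unfolding poly_psub by blast
qed

text \<open>Quantitative continuity of roots. Each root \<open>z\<close> has distance at least
  \<delta> from \<open>y0\<close>, so its distance from \<open>y1\<close> exceeds that from
  \<open>y0\<close> at most by the factor \<open>1 + cmod (y1 - y0) / \<delta>\<close>; multiply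
  over the roots. Only an upper bound \<open>d\<close> on the degree enters, since the degree may
  drop within a family.\<close>

lemma poly_roots_away:
  fixes p :: "complex poly"
  assumes "\<And>y. cmod (y - y0) < \<delta> \<Longrightarrow> poly p y \<noteq> 0" "\<delta> > 0" "degree p \<le> d"
  shows "cmod (poly p y1) * (\<delta> / (\<delta> + cmod (y1 - y0))) ^ d \<le> cmod (poly p y0)"
  using assms
proof (induction "degree p" arbitrary: p d)
  case 0
  then obtain c where "p = [:c:]" by (metis degree_eq_zeroE)
  moreover have "(\<delta> / (\<delta> + cmod (y1 - y0))) ^ d \<le> 1" using 0 by (intro power_le_one) (auto simp: divide_le_eq_1_pos add_pos_nonneg)
  ultimately show ?case by (simp add: mult_left_le)
next
  case (Suc e)
  hence "\<not> constant (poly p)" by (simp add: constant_degree)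
  then obtain z where z: "poly p z = 0" using Fundamental_Theorem_Algebra.fundamental_theorem_of_algebra by blast
  then obtain q where q: "p = [:-z, 1:] * q" by (auto simp: poly_eq_0_iff_dvd elim: dvdE)
  have q0: "q \<noteq> 0" using q Suc by auto
  have dp: "degree p = Suc (degree q)" unfolding q using q0 by (subst degree_mult_eq) auto
  obtain d' where d': "d = Suc d'" using Suc dp by (cases d) auto
  define r a where "r = \<delta> / (\<delta> + cmod (y1 - y0))" and "a = cmod (y1 - y0)"
  have IH: "cmod (poly q y1) * r ^ d' \<le> cmod (poly q y0)" unfolding r_def
    by (rule Suc.hyps(1)) (use Suc.hyps(2) Suc.prems dp d' in \<open>auto simp: q\<close>)
  have dz: "cmod (y0 - z) \<ge> \<delta>" using Suc.prems(1)[of z] z by (force simp: norm_minus_commute)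
  have r0: "r \<ge> 0" using Suc.prems by (simp add: r_def)
  have den: "\<delta> + a > 0" using Suc.prems by (simp add: a_def add_pos_nonneg)
  have "cmod (y1 - z) \<le> cmod (y0 - z) + a"
    unfolding a_def using norm_triangle_ineq[of "y0 - z" "y1 - y0"] by simp
  hence "cmod (y1 - z) * \<delta> \<le> (cmod (y0 - z) + a) * \<delta>" using Suc.prems by (intro mult_right_mono) auto
  also have "\<dots> \<le> cmod (y0 - z) * (\<delta> + a)"
    using mult_right_mono[OF dz, of a] by (simp add: a_def algebra_simps)
  finally have "cmod (y1 - z) * r \<le> cmod (y0 - z)" using den by (simp add: r_def a_def[symmetric] field_simps)
  hence "(cmod (y1 - z) * r) * (cmod (poly q y1) * r ^ d') \<le> cmod (y0 - z) * cmod (poly q y0)"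
    using IH r0 by (intro mult_mono) auto
  moreover have pe: "poly p t = (t - z) * poly q t" for t by (simp add: q algebra_simps)
  ultimately show ?case unfolding pe norm_mult d' power_Suc r_def[symmetric] by (simp only: mult_ac)
qed

lemma degree_prod_le_sum: "degree (\<Prod>i\<in>K. f i :: complex poly) \<le> (\<Sum>i\<in>K. degree (f i))"
  by (induction K rule: infinite_finite_induct) (auto intro: order_trans[OF degree_mult_le])

lemma degree_psub_bound:
  assumes "\<And>j. degree (Z j) \<le> 1"
  shows "degree (psub Z p) \<le> (\<Sum>n\<in>keys p. mnorm n)"
  unfolding ps.msub_def
proof (rule degree_sum_le)
  fix n assume n: "n \<in> keys p"
  have "degree (wt Z n) \<le> (\<Sum>i\<in>keys n. degree (Z i ^ lookup n i))" unfolding wt_def by (rule degree_prod_le_sum)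
  also have "\<dots> \<le> (\<Sum>i\<in>keys n. lookup n i)"
    by (intro sum_mono order_trans[OF degree_power_le]) (use assms in \<open>auto intro: mult_le_mono1[of _ 1, simplified]\<close>)
  also have "\<dots> = mnorm n" by (simp add: mnorm_def)
  also have "\<dots> \<le> (\<Sum>n\<in>keys p. mnorm n)" using n by (intro member_le_sum) auto
  finally show "degree ([:lookup p n:] * wt Z n) \<le> (\<Sum>n\<in>keys p. mnorm n)"
    by (simp add: degree_smult_le order_trans[OF degree_smult_le])
qed simp

text \<open>Moving off the zero along a line on which c does not vanish, and letting the line parameter
  tend to 0, continuity of roots shows that the zero propagates in the direction of the i-th variable.\<close>
lemma zero_propagates:
  assumes van: "\<And>x. (\<And>j. j < m \<Longrightarrow> cmod (x j) < 1) \<Longrightarrow> meval x g = 0 \<Longrightarrow> meval x P = 0"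
    and c: "c \<in> mp ({..<m} - {i})" "c \<noteq> 0" "c = u * P + v * g"
    and z: "\<And>j. j < m \<Longrightarrow> cmod (z j) < 1" "meval z g = 0" and i: "i < m"
  shows "meval (z(i := y)) g = 0"
proof -
  have c': "c \<in> mp {..<m}" using c(1) mp_mono[of "{..<m} - {i}" "{..<m}"] by auto
  obtain x where x: "meval x c \<noteq> 0" using meval_nonzero_point[OF c' c(2)] by blast
  \<comment> \<open>The line from \<open>z\<close> at \<open>s = 0\<close> to \<open>x\<close> at
    \<open>s = 1\<close>. As \<open>c\<close> does not vanish at \<open>x\<close>, it vanishes at
    only finitely many parameters.\<close>
  define X where "X s j = z j + s * (x j - z j)" for s j
  define path where "path = psub (\<lambda>j. [:z j, x j - z j:]) c"
  have path: "poly path s = meval (X s) c" for s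
    unfolding path_def poly_psub X_def by (simp add: mult.commute)
  have "X 1 = x" by (rule ext) (simp add: X_def)
  hence "poly path 1 \<noteq> 0" using x by (simp add: path)
  hence "path \<noteq> 0" by auto
  hence fin: "finite {s. poly path s = 0}" by (rule poly_roots_finite)
  define s where "s k = (1 / of_nat (Suc k) :: complex)" for k
  have s0: "s \<longlonglongrightarrow> 0"
    unfolding s_def using LIMSEQ_inverse_real_of_nat tendsto_of_real_iff[of "\<lambda>n. inverse (real (Suc n))" 0 sequentially, where 'a = complex]
    by (simp add: inverse_eq_divide)
  have inj: "inj s" by (auto simp: inj_on_def s_def)
  have "finite (s -` {s. poly path s = 0})" by (rule finite_vimageI[OF fin inj])
  hence "\<forall>\<^sub>F k in sequentially. k \<notin> s -` {s. poly path s = 0}"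
    by (simp add: MOST_iff_cofinite flip: cofinite_eq_sequentially)
  hence ev1: "\<forall>\<^sub>F k in sequentially. poly path (s k) \<noteq> 0" by simp
  have cX: "(\<lambda>k. X (s k) j) \<longlonglongrightarrow> z j" for j
  proof -
    have "(\<lambda>k. z j + s k * (x j - z j)) \<longlonglongrightarrow> z j + 0 * (x j - z j)" by (intro tendsto_intros s0)
    thus ?thesis by (simp add: X_def)
  qed
  have "\<forall>\<^sub>F k in sequentially. \<forall>j\<in>{..<m}. cmod (X (s k) j) < 1"
    by (intro eventually_ball_finite ballI order_tendstoD(2)[OF tendsto_norm[OF cX]]) (use z in auto)
  hence ev2: "\<forall>\<^sub>F k in sequentially. \<forall>j<m. cmod (X (s k) j) < 1" by (simp add: Ball_def)
  define \<delta> where "\<delta> = 1 - cmod (z i)"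
  have d: "\<delta> > 0" using z(1)[OF i] by (simp add: \<delta>_def)
  define N where "N = (\<Sum>n\<in>keys g. mnorm n)"
  \<comment> \<open>Independent of \<open>k\<close>, because \<open>N\<close> bounds the degrees of
    all \<open>G k\<close>; so the estimate survives the limit.\<close>
  define \<kappa> where "\<kappa> = (\<delta> / (\<delta> + cmod (y - z i))) ^ N"
  have kp: "\<kappa> > 0" using d by (simp add: \<kappa>_def add_pos_nonneg)
  define G where "G k = psub (\<lambda>j. if j = i then [:0,1:] else [:X (s k) j:]) g" for k
  have G: "poly (G k) t = meval ((X (s k))(i := t)) g" for k t
    unfolding G_def poly_psub by (intro arg_cong[where f = "\<lambda>x. meval x g"]) auto
  have ineq: "\<forall>\<^sub>F k in sequentially. cmod (poly (G k) y) * \<kappa> \<le> cmod (poly (G k) (z i))"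
    using ev1 ev2
  proof eventually_elim
    case (elim k)
    \<comment> \<open>A common zero of \<open>g\<close> and \<open>P\<close> would be a zero of
      \<open>c\<close>, but \<open>c\<close> does not involve the coordinate \<open>i\<close> along
      which \<open>t\<close> moves, and it is nonzero on this part of the line.\<close>
    have nz: "poly (G k) t \<noteq> 0" if t: "cmod (t - z i) < \<delta>" for t
    proof
      assume 0: "poly (G k) t = 0"
      have "cmod t < 1" using t norm_triangle_ineq[of "t - z i" "z i"] by (simp add: \<delta>_def)
      hence "meval ((X (s k))(i := t)) P = 0" using van[of "(X (s k))(i := t)"] 0 elim(2) by (simp add: G)
      hence "meval ((X (s k))(i := t)) c = 0" using 0 unfolding c(3) G by (simp add: meval_simps)
      moreover have "meval ((X (s k))(i := t)) c = meval (X (s k)) c"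
        by (rule meval_cong) (use mp_keys[OF c(1)] in auto)
      ultimately show False using elim(1) by (simp add: path)
    qed
    show ?case unfolding \<kappa>_def
      by (rule poly_roots_away[OF nz d]) (auto simp: G_def N_def intro!: degree_psub_bound)
  qed
  have lim: "(\<lambda>k. poly (G k) t) \<longlonglongrightarrow> meval (z(i := t)) g" for t
    unfolding G ev.msub_def wt_def
    by (intro tendsto_intros) (auto intro!: cX tendsto_intros)
  have "cmod (meval (z(i := y)) g) * \<kappa> \<le> cmod (meval (z(i := z i)) g)"
    by (rule tendsto_le[OF sequentially_bot tendsto_norm[OF lim] tendsto_mult_right[OF tendsto_norm[OF lim]] ineq])
  hence "cmod (meval (z(i := y)) g) * \<kappa> \<le> 0" using z by simp
  thus ?thesis using kp by (simp add: mult_le_0_iff)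
qed

text \<open>Changing one coordinate after another carries a zero to every point of the polydisc:
  variables absent from \<open>g\<close> change nothing, the others move freely by elimination. Then
  the Kronecker substitution, which maps the unit disc into the polydisc, vanishes on a disc
  although it is a nonzero polynomial.\<close>

lemma zero_free:
  assumes van: "\<And>x. (\<And>j. j < m \<Longrightarrow> cmod (x j) < 1) \<Longrightarrow> meval x g = 0 \<Longrightarrow> meval x P = 0"
    and g: "g \<in> mp {..<m}" "g \<noteq> 0"
    and bez: "\<And>i n. lookup g n \<noteq> 0 \<Longrightarrow> lookup n i \<noteq> 0 \<Longrightarrow>
       \<exists>c u v. c \<in> mp ({..<m} - {i}) \<and> c \<noteq> 0 \<and> c = u * P + v * g"
    and z: "\<And>j. j < m \<Longrightarrow> cmod (z j) < 1"
  shows "meval z g \<noteq> 0"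
proof
  assume z0: "meval z g = 0"
  have step: "meval (x(i := y)) g = 0" if x: "\<And>j. j < m \<Longrightarrow> cmod (x j) < 1" "meval x g = 0" for x i y
  proof (cases "\<exists>n. lookup g n \<noteq> 0 \<and> lookup n i \<noteq> 0")
    case True
    then obtain n where n: "lookup g n \<noteq> 0" "lookup n i \<noteq> 0" by blast
    then obtain c u v where c: "c \<in> mp ({..<m} - {i})" "c \<noteq> 0" "c = u * P + v * g" using bez by blast
    have "i \<in> keys n" using n(2) by (simp add: in_keys_iff)
    hence "i < m" using mp_keys[OF g(1) n(1)] by auto
    thus ?thesis using zero_propagates[OF van c x] by simp
  next
    case False
    have "meval (x(i := y)) g = meval x g"
      by (rule meval_cong) (use False in \<open>auto simp: in_keys_iff\<close>)
    thus ?thesis using x(2) by simp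
  qed
  have all: "meval (\<lambda>j. if j < k then w j else z j) g = 0" if w: "\<And>j. cmod (w j) < 1" for w k
  proof (induction k)
    case 0
    show ?case using z0 by simp
  next
    case (Suc k)
    have "(\<lambda>j. if j < Suc k then w j else z j) = (\<lambda>j. if j < k then w j else z j)(k := w k)"
      by (auto simp: less_Suc_eq)
    thus ?case using step[OF _ Suc.IH, of k "w k"] w z by simp
  qed
  have all': "meval w g = 0" if w: "\<And>j. cmod (w j) < 1" for w
  proof -
    have "meval w g = meval (\<lambda>j. if j < m then w j else z j) g"
      by (rule meval_cong) (use mp_keys[OF g(1)] in force)
    thus ?thesis using all[OF w] by simp
  qed
  have "monom_in m n" if "n \<in> keys g" for n using g(1) that by (auto simp: mp_def monom_in_def)
  then obtain a :: "nat \<Rightarrow> nat" where a: "\<And>i. a i > 0" "inj_on (wdeg a) (keys g)"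
    using exists_injective_weight[of "keys g" m] by auto
  have "poly (kron a g) t = 0" if "cmod t < 1" for t
    unfolding poly_psub using that a(1)
    by (intro all') (auto simp: poly_monom norm_power power_less_one_iff)
  hence "ball 0 1 \<subseteq> {t. poly (kron a g) t = 0}" by auto
  moreover have "finite {t. poly (kron a g) t = 0}" by (intro poly_roots_finite kron_nonzero a g)
  ultimately have "finite (ball (0::complex) 1)" by (rule finite_subset)
  thus False using uncountable_ball[of 1 "0::complex"] by (auto dest: countable_finite)
qed

section \<open>Convergence along rays\<close>

definition mlevel :: "nat \<Rightarrow> nat \<Rightarrow> monom set" where "mlevel m k = {n. monom_in m n \<and> mnorm n = k}"

lemma mlevel_card: "finite (mlevel m k)" "card (mlevel m k) \<le> (k + 1) ^ m"
proof -
  have "mlevel m k \<subseteq> mbox m (k + 1)"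
    using lookup_le_mnorm by (fastforce simp: mlevel_def mbox_iff less_Suc_eq_le)
  thus "finite (mlevel m k)" "card (mlevel m k) \<le> (k + 1) ^ m"
    using finite_subset[OF _ mbox_card(1)] card_mono[OF mbox_card(1)] mbox_card(2) by metis+
qed

abbreviation radial :: "(nat \<Rightarrow> complex) \<Rightarrow> mpoly \<Rightarrow> complex poly" where
  "radial z \<equiv> psub (\<lambda>i. [:0, z i:])"

lemma wt_radial: "wt (\<lambda>i. [:0, z i:]) n = Polynomial.monom (wt z n) (mnorm n)" for z :: "nat \<Rightarrow> complex"
proof -
  have "(\<Prod>i\<in>K. [:0, z i:] ^ lookup n i) = Polynomial.monom (\<Prod>i\<in>K. z i ^ lookup n i) (\<Sum>i\<in>K. lookup n i)" for K
  proof -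
    have "[:0, z i:] = Polynomial.monom (z i) 1" for i by (simp add: monom_altdef)
    thus ?thesis by (induction K rule: infinite_finite_induct) (auto simp: monom_power mult_monom)
  qed
  thus ?thesis by (simp add: wt_def mnorm_def)
qed

lemma coeff_radial: "coeff (radial z p) k = (\<Sum>n\<in>{n\<in>keys p. mnorm n = k}. lookup p n * wt z n)"
proof -
  have "coeff (radial z p) k = (\<Sum>n\<in>keys p. if mnorm n = k then lookup p n * wt z n else 0)"
    unfolding ps.msub_def coeff_sum by (intro sum.cong refl) (simp add: wt_radial)
  also have "\<dots> = (\<Sum>n\<in>{n\<in>keys p. mnorm n = k}. lookup p n * wt z n)"
    by (rule sum.mono_neutral_cong_right) auto
  finally show ?thesis .
qed

lemma poly_radial_1: "poly (radial z p) 1 = meval z p" by (simp add: poly_psub)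

text \<open>Grading by total degree turns the coefficient identity into a product of formal power
  series in one variable along the ray through \<open>z\<close>; no convergence is involved.\<close>

lemma radial_product:
  assumes Q: "Q \<in> mp {..<m}" and P: "P \<in> mp {..<m}"
    and rat: "\<And>n. series_mult_coeff Q F n = lookup P n"
  shows "fps_of_poly (radial z Q) * Abs_fps (\<lambda>k. \<Sum>n\<in>mlevel m k. F n * wt z n) = fps_of_poly (radial z P)"
proof (rule fps_ext)
  fix N
  define \<Phi> where "\<Phi> k = (\<Sum>n\<in>mlevel m k. F n * wt z n)" for k
  have sQ: "monom_in m s" if "s \<in> keys Q" for s using Q that by (auto simp: mp_def monom_in_def)
  have "fps_nth (fps_of_poly (radial z Q) * Abs_fps \<Phi>) N = (\<Sum>j\<le>N. coeff (radial z Q) j * \<Phi> (N - j))"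
    by (simp add: fps_mult_nth atLeast0AtMost)
  also have "\<dots> = (\<Sum>j\<le>N. \<Sum>s\<in>{s\<in>keys Q. mnorm s = j}. lookup Q s * wt z s * \<Phi> (N - mnorm s))"
    by (simp add: coeff_radial sum_distrib_right)
  also have "\<dots> = (\<Sum>j\<le>N. \<Sum>s\<in>{s\<in>{s\<in>keys Q. mnorm s \<le> N}. mnorm s = j}. lookup Q s * wt z s * \<Phi> (N - mnorm s))"
    by (intro sum.cong refl) auto
  also have "\<dots> = (\<Sum>s\<in>{s\<in>keys Q. mnorm s \<le> N}. lookup Q s * wt z s * \<Phi> (N - mnorm s))"
    by (rule sum.group) auto
  also have "\<dots> = (\<Sum>s\<in>{s\<in>keys Q. mnorm s \<le> N}. \<Sum>n\<in>{n\<in>mlevel m N. monom_le s n}. lookup Q s * F (n - s) * wt z n)"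
  proof (intro sum.cong refl)
    fix s assume s: "s \<in> {s\<in>keys Q. mnorm s \<le> N}"
    have "lookup Q s * wt z s * \<Phi> (N - mnorm s) = (\<Sum>l\<in>mlevel m (N - mnorm s). lookup Q s * F l * wt z (s + l))"
      by (simp add: \<Phi>_def sum_distrib_left wt_add mult_ac)
    also have "\<dots> = (\<Sum>n\<in>{n\<in>mlevel m N. monom_le s n}. lookup Q s * F (n - s) * wt z n)"
      by (rule sum.reindex_bij_witness[of _ "\<lambda>n. n - s" "\<lambda>l. s + l"])
         (use s sQ in \<open>auto simp: mlevel_def monom_in_add mnorm_add monom_le_iff\<close>)
    finally show "lookup Q s * wt z s * \<Phi> (N - mnorm s) = \<dots>" .
  qed
  also have "\<dots> = (\<Sum>s\<in>keys Q. \<Sum>n\<in>{n\<in>mlevel m N. monom_le s n}. lookup Q s * F (n - s) * wt z n)"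
  proof (rule sum.mono_neutral_left)
    show "\<forall>s\<in>keys Q - {s\<in>keys Q. mnorm s \<le> N}. (\<Sum>n\<in>{n\<in>mlevel m N. monom_le s n}. lookup Q s * F (n - s) * wt z n) = 0"
    proof
      fix s assume "s \<in> keys Q - {s\<in>keys Q. mnorm s \<le> N}"
      hence "{n\<in>mlevel m N. monom_le s n} = {}" by (auto simp: mlevel_def monom_le_iff mnorm_add)
      thus "(\<Sum>n\<in>{n\<in>mlevel m N. monom_le s n}. lookup Q s * F (n - s) * wt z n) = 0" by (simp only: sum.empty)
    qed
  qed auto
  also have "\<dots> = (\<Sum>s\<in>keys Q. \<Sum>n\<in>mlevel m N. if monom_le s n then lookup Q s * F (n - s) * wt z n else 0)"
    by (intro sum.cong refl sum.mono_neutral_cong_left) (auto simp: mlevel_card)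
  also have "\<dots> = (\<Sum>n\<in>mlevel m N. \<Sum>s\<in>keys Q. if monom_le s n then lookup Q s * F (n - s) * wt z n else 0)"
    by (rule sum.swap)
  also have "\<dots> = (\<Sum>n\<in>mlevel m N. lookup P n * wt z n)"
  proof (intro sum.cong refl)
    fix n
    have "(\<Sum>s\<in>keys Q. if monom_le s n then lookup Q s * F (n - s) * wt z n else 0)
      = (\<Sum>s\<in>{s\<in>keys Q. monom_le s n}. lookup Q s * F (n - s) * wt z n)"
      by (rule sum.mono_neutral_cong_right) auto
    also have "\<dots> = lookup P n * wt z n"
      unfolding rat[symmetric] series_mult_coeff_def by (simp add: sum_distrib_right)
    finally show "(\<Sum>s\<in>keys Q. if monom_le s n then lookup Q s * F (n - s) * wt z n else 0) = lookup P n * wt z n" .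
  qed
  also have "\<dots> = coeff (radial z P) N" unfolding coeff_radial
    by (rule sum.mono_neutral_right[OF mlevel_card(1)])
       (use P in \<open>auto simp: mlevel_def mp_def monom_in_def in_keys_iff\<close>)
  finally show "fps_nth (fps_of_poly (radial z Q) * Abs_fps (\<lambda>k. \<Sum>n\<in>mlevel m k. F n * wt z n)) N = fps_nth (fps_of_poly (radial z P)) N"
    by (simp add: \<Phi>_def[abs_def])
qed

lemma norm_wt_le:
  assumes "monom_in m n" "\<And>j. j < m \<Longrightarrow> cmod (z j) \<le> \<rho>" "\<rho> \<ge> 0"
  shows "cmod (wt z n) \<le> \<rho> ^ mnorm n"
proof -
  have "cmod (wt z n) = (\<Prod>i\<in>keys n. cmod (z i) ^ lookup n i)" by (simp add: wt_def norm_power flip: prod_norm)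
  also have "\<dots> \<le> (\<Prod>i\<in>keys n. \<rho> ^ lookup n i)"
    by (intro prod_mono conjI power_mono) (use assms in \<open>auto simp: monom_in_def\<close>)
  also have "\<dots> = \<rho> ^ mnorm n" by (simp add: mnorm_def power_sum)
  finally show ?thesis .
qed

text \<open>Along the ray through \<open>z\<close> the series has radius of convergence above 1,
  because the coefficients grow subexponentially and all coordinates have modulus below 1.
  Evaluating the product identity at parameter 1 makes \<open>P\<close> vanish with
  \<open>Q\<close>.\<close>

lemma numerator_vanishes:
  assumes Q: "Q \<in> mp {..<m}" and P: "P \<in> mp {..<m}"
    and rat: "\<And>n. series_mult_coeff Q F n = lookup P n"
    and growth: "\<And>e::real. e > 0 \<Longrightarrow> \<exists>C. \<forall>n. monom_in m n \<longrightarrow> cmod (F n) \<le> C * exp (e * mnorm n)"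
    and z: "\<And>j. j < m \<Longrightarrow> cmod (z j) < 1" and zero: "meval z Q = 0"
  shows "meval z P = 0"
proof -
  \<comment> \<open>Inserting 1/2 keeps the maximum defined and \<rho> positive, so that its
    logarithm is meaningful.\<close>
  define \<rho> where "\<rho> = Max (insert (1/2) ((\<lambda>j. cmod (z j)) ` {..<m}))"
  have r: "\<rho> < 1" unfolding \<rho>_def using z by (subst Max_less_iff) auto
  have r2: "\<rho> \<ge> 1/2" unfolding \<rho>_def by (rule Max_ge) auto
  have rz: "cmod (z j) \<le> \<rho>" if "j < m" for j unfolding \<rho>_def by (rule Max_ge) (use that in auto)
  \<comment> \<open>The decay is spent in four equal shares: on the growth of \<open>F\<close>, on
    the number of monomials of a given degree, on moving out to radius \<open>exp e\<close>, and on
    the remaining geometric series.\<close>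
  define e where "e = - ln \<rho> / 4"
  have e: "e > 0" using r r2 by (simp add: e_def)
  have lr: "\<rho> = exp (- 4 * e)" using r2 by (simp add: e_def)
  obtain C0 where C0: "\<And>n. monom_in m n \<Longrightarrow> cmod (F n) \<le> C0 * exp (e * mnorm n)" using growth[OF e] by blast
  define C where "C = max C0 0"
  have C: "cmod (F n) \<le> C * exp (e * mnorm n)" if "monom_in m n" for n
    using C0[OF that] by (rule order_trans) (simp add: C_def)
  have "(\<lambda>k. (real k + 1) ^ m * exp (- e * real k)) \<longlonglongrightarrow> 0" using e by real_asymp
  hence "Bseq (\<lambda>k. (real k + 1) ^ m * exp (- e * real k))" by (intro convergent_imp_Bseq) (auto simp: convergent_def)
  then obtain K where K: "K > 0" "\<And>k. norm ((real k + 1) ^ m * exp (- e * real k)) \<le> K" by (auto elim: BseqE)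
  define \<Phi> where "\<Phi> k = (\<Sum>n\<in>mlevel m k. F n * wt z n)" for k
  have b: "cmod (\<Phi> k) \<le> (K * C) * exp (- 2 * e * real k)" for k
  proof -
    have "cmod (\<Phi> k) \<le> (\<Sum>n\<in>mlevel m k. C * exp (e * k) * \<rho> ^ k)" unfolding \<Phi>_def
    proof (rule sum_norm_le)
      fix n assume n: "n \<in> mlevel m k"
      have "cmod (F n * wt z n) \<le> (C * exp (e * mnorm n)) * \<rho> ^ mnorm n" unfolding norm_mult
        by (intro mult_mono C norm_wt_le[of m] rz) (use n r2 in \<open>auto simp: mlevel_def C_def\<close>)
      thus "cmod (F n * wt z n) \<le> C * exp (e * k) * \<rho> ^ k" using n by (simp add: mlevel_def)
    qed
    also have "\<dots> = card (mlevel m k) * (C * exp (e * k) * \<rho> ^ k)" by simp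
    also have "\<dots> \<le> (real k + 1) ^ m * (C * exp (e * k) * \<rho> ^ k)"
    proof (rule mult_right_mono)
      have "real (card (mlevel m k)) \<le> real ((k + 1) ^ m)" using mlevel_card(2) by (simp only: of_nat_le_iff)
      thus "real (card (mlevel m k)) \<le> (real k + 1) ^ m" by (simp add: add.commute)
    qed (use r2 in \<open>auto simp: C_def\<close>)
    also have "\<rho> ^ k = exp (- 4 * e * k)" by (simp add: lr exp_of_nat_mult[symmetric] mult_ac)
    also have "(real k + 1) ^ m * (C * exp (e * k) * exp (- 4 * e * k)) = ((real k + 1) ^ m * exp (- e * k)) * (C * exp (- 2 * e * k))"
    proof -
      have "exp (e * k) * exp (- 4 * e * k) = exp (- e * k) * exp (- 2 * e * k)" by (simp flip: exp_add)
      thus ?thesis by (simp add: mult.assoc mult.left_commute)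
    qed
    also have "\<dots> \<le> K * (C * exp (- 2 * e * k))"
      using K(2)[of k] by (intro mult_right_mono) (auto simp: C_def)
    finally show ?thesis by (simp add: mult_ac)
  qed
  have summ: "summable (\<lambda>k. \<Phi> k * (of_real (exp e)) ^ k)"
  proof (rule summable_comparison_test')
    show "summable (\<lambda>k. (K * C) * exp (- e) ^ k)" using e by (intro summable_mult summable_geometric) simp
    fix k :: nat
    have "norm (\<Phi> k * of_real (exp e) ^ k) = cmod (\<Phi> k) * exp (e * k)"
      by (simp add: norm_mult norm_power exp_of_nat_mult[symmetric] mult.commute)
    also have "\<dots> \<le> (K * C) * exp (- 2 * e * k) * exp (e * k)" by (intro mult_right_mono b) simp
    also have "\<dots> = (K * C) * exp (- e) ^ k" by (simp add: exp_of_nat_mult[symmetric] mult_ac flip: exp_add)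
    finally show "norm (\<Phi> k * of_real (exp e) ^ k) \<le> (K * C) * exp (- e) ^ k" .
  qed
  have "conv_radius \<Phi> \<ge> ereal (norm (complex_of_real (exp e)))" by (rule conv_radius_geI[OF summ])
  moreover have "ereal (norm (complex_of_real (exp e))) > ereal 1" using e by simp
  ultimately have cr: "fps_conv_radius (Abs_fps \<Phi>) > ereal 1" unfolding fps_conv_radius_def fps_nth_Abs_fps by (meson less_le_trans)
  have "eval_fps (fps_of_poly (radial z Q) * Abs_fps \<Phi>) 1 = eval_fps (fps_of_poly (radial z Q)) 1 * eval_fps (Abs_fps \<Phi>) 1"
    by (rule eval_fps_mult) (use cr in \<open>auto simp: one_ereal_def\<close>)
  moreover have "fps_of_poly (radial z Q) * Abs_fps \<Phi> = fps_of_poly (radial z P)"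
    unfolding \<Phi>_def by (rule radial_product[OF Q P rat])
  ultimately show ?thesis using zero by (simp add: poly_radial_1)
qed

section \<open>Integrality of divisors of polynomials with coefficients -1, 0, 1\<close>

lemma algebraic_int_root_signs:
  fixes p :: "complex poly"
  assumes "\<And>i. coeff p i \<in> {-1,0,1}" "p \<noteq> 0" "poly p x = 0"
  shows "algebraic_int x"
proof -
  \<comment> \<open>The leading coefficient is 1 or -1, hence its own inverse, so \<open>q\<close>
    is monic.\<close>
  define q where "q = Polynomial.smult (lead_coeff p) p"
  have "lead_coeff p \<in> {-1,1}" using assms(1)[of "degree p"] assms(2) by auto
  hence "lead_coeff q = 1" by (auto simp: q_def)
  moreover have "coeff q i \<in> \<int>" for i using assms(1)[of i] assms(1)[of "degree p"] by (auto simp: q_def)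
  moreover have "poly q x = 0" using assms(3) by (simp add: q_def)
  ultimately show ?thesis unfolding algebraic_int.simps by blast
qed

lemma monic_algebraic_int_coeffs:
  fixes p :: "complex poly"
  assumes "lead_coeff p = 1" "\<And>x. poly p x = 0 \<Longrightarrow> algebraic_int x"
  shows "algebraic_int (coeff p i)"
  using assms
proof (induction "degree p" arbitrary: p i)
  case 0
  then obtain c where c: "p = [:c:]" by (metis degree_eq_zeroE)
  hence "c = 1" using 0 by simp
  thus ?case by (cases i) (auto simp: c intro: int_imp_algebraic_int)
next
  case (Suc e)
  hence "\<not> constant (poly p)" by (simp add: constant_degree)
  then obtain z where z: "poly p z = 0" using Fundamental_Theorem_Algebra.fundamental_theorem_of_algebra by blast
  then obtain q where q: "p = [:-z, 1:] * q" by (auto simp: poly_eq_0_iff_dvd elim: dvdE)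
  have q0: "q \<noteq> 0" using q Suc by auto
  have dp: "degree p = Suc (degree q)" unfolding q using q0 by (subst degree_mult_eq) auto
  have "lead_coeff q = 1" using Suc.prems(1) lead_coeff_mult[of "[:-z,1:]" q] unfolding q by simp
  hence cq: "algebraic_int (coeff q j)" for j using Suc.hyps(1)[of q j] Suc.hyps(2) Suc.prems(2) dp q by auto
  have "coeff p i = (case i of 0 \<Rightarrow> 0 | Suc j \<Rightarrow> coeff q j) - z * coeff q i"
    by (simp add: q coeff_pCons split: nat.splits)
  thus ?case using cq z Suc.prems(2)
    by (auto intro!: algebraic_int_diff algebraic_int_mult split: nat.splits)
qed

text \<open>An injective weight turns \<open>S\<close> into a one-variable polynomial with
  coefficients -1, 0, 1 without collisions. Reversing the order of coefficients makes the image of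
  \<open>g\<close> monic, because \<open>lookup g 0 = 1\<close>, and it still divides a polynomial
  of that kind; so its roots, then its coefficients, then those of \<open>g\<close> are algebraic
  integers. The second conclusion later makes a root that is split off from \<open>g\<close>
  algebraic.\<close>

lemma divisor_of_signs:
  assumes S: "S \<in> mp {..<m}" "S \<noteq> 0" "\<And>n. lookup S n \<in> {-1,0,1}" and g: "S = g * c" "g \<in> mp {..<m}" "lookup g 0 = 1"
  shows "algebraic_int (lookup g n)" "\<exists>a. (\<forall>i. a i > 0) \<and> (\<forall>t. poly (kron a g) t = 0 \<longrightarrow> algebraic t)"
proof -
  have "monom_in m n" if "n \<in> keys S \<union> keys g \<union> {0}" for n
    using S(1) g(2) that by (auto simp: mp_def monom_in_def)
  then obtain a :: "nat \<Rightarrow> nat" where a: "\<And>i. a i > 0" "inj_on (wdeg a) (keys S \<union> keys g \<union> {0})"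
    using exists_injective_weight[of "keys S \<union> keys g \<union> {0}" m] by auto
  have aS: "inj_on (wdeg a) (keys S)" and ag: "inj_on (wdeg a) (keys g)" using a(2) by (auto intro: inj_on_subset)
  have kS: "kron a S = kron a g * kron a c" by (simp add: g(1) psub_mult)
  have S0: "kron a S \<noteq> 0" by (rule kron_nonzero[OF aS S(2)])
  have cS: "coeff (kron a S) i \<in> {-1,0,1}" for i by (rule coeff_kron_in[OF aS S(3)]) simp
  have "poly (kron a g) t = 0 \<Longrightarrow> algebraic t" for t
    using algebraic_int_root_signs[OF cS S0, of t] by (auto simp: kS)
  thus "\<exists>a. (\<forall>i. a i > 0) \<and> (\<forall>t. poly (kron a g) t = 0 \<longrightarrow> algebraic t)" using a(1) by blast
  define r where "r = reflect_poly (kron a g)"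
  have "keys g \<noteq> {}" "0 \<in> keys g" using g(3) by (auto simp: in_keys_iff)
  hence c0: "coeff (kron a g) 0 = 1" using coeff_kron_inj[OF ag, of 0] g(3) by simp
  have "lead_coeff r = coeff (kron a g) 0" unfolding r_def
    using c0 coeff_0_reflect_poly[of "reflect_poly (kron a g)"] by simp
  hence lr: "lead_coeff r = 1" using c0 by simp
  have rS: "reflect_poly (kron a S) = r * reflect_poly (kron a c)" by (simp add: r_def kS reflect_poly_mult)
  have rS0: "reflect_poly (kron a S) \<noteq> 0" using S0 by simp
  have crS: "coeff (reflect_poly (kron a S)) i \<in> {-1,0,1}" for i
    using cS by (simp add: coeff_reflect_poly)
  have "algebraic_int x" if "poly r x = 0" for x
    by (rule algebraic_int_root_signs[OF crS rS0]) (simp add: rS that)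
  hence cr: "algebraic_int (coeff r i)" for i by (rule monic_algebraic_int_coeffs[OF lr])
  have cg: "algebraic_int (coeff (kron a g) i)" for i
  proof (cases "i \<le> degree (kron a g)")
    case True
    hence "coeff (kron a g) i = coeff r (degree (kron a g) - i)" by (simp add: r_def coeff_reflect_poly)
    thus ?thesis using cr by simp
  qed (simp add: coeff_eq_0)
  show "algebraic_int (lookup g n)"
  proof (cases "n \<in> keys g")
    case True
    thus ?thesis using coeff_kron_inj[OF ag True] cg[of "wdeg a n"] by simp
  qed (simp add: in_keys_iff)
qed

section \<open>Logarithmic derivatives\<close>

lemma poly_coeff_bound_circle:
  fixes q :: "complex poly"
  assumes "\<And>x. cmod x = 1 \<Longrightarrow> cmod (poly q x) \<le> D"
  shows "cmod (coeff q k) \<le> D"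
proof -
  have "norm ((deriv ^^ k) (poly q) 0) \<le> fact k * D / 1 ^ k"
    by (rule Cauchy_inequality) (use assms in \<open>auto intro!: holomorphic_intros continuous_intros\<close>)
  moreover have "eval_fps (fps_of_poly q) = poly q" by (rule ext) simp
  hence "coeff q k = (deriv ^^ k) (poly q) 0 / fact k"
    using fps_nth_conv_deriv[of "fps_of_poly q" k] by simp
  hence "cmod (coeff q k) = norm ((deriv ^^ k) (poly q) 0) / fact k" by (simp add: norm_divide)
  ultimately show ?thesis by (simp add: divide_le_eq mult.commute)
qed

text \<open>The Kronecker curve maps the unit circle into the torus and keeps the coefficients
  apart, so the one-variable Cauchy estimate applies.\<close>

lemma mpoly_coeff_bound_torus:
  assumes p: "p \<in> mp {..<m}" and b: "\<And>x. (\<And>i. cmod (x i) = 1) \<Longrightarrow> cmod (meval x p) \<le> D"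
  shows "cmod (lookup p n) \<le> D"
proof -
  have "cmod (meval (\<lambda>_. 1) p) \<le> D" by (rule b) simp
  hence D: "D \<ge> 0" using norm_ge_zero order_trans by blast
  have "monom_in m n" if "n \<in> keys p" for n using p that by (auto simp: mp_def monom_in_def)
  then obtain a :: "nat \<Rightarrow> nat" where a: "inj_on (wdeg a) (keys p)"
    using exists_injective_weight[of "keys p" m] by auto
  show ?thesis
  proof (cases "n \<in> keys p")
    case True
    have "cmod (coeff (kron a p) (wdeg a n)) \<le> D"
      by (rule poly_coeff_bound_circle) (auto simp: poly_psub poly_monom norm_power intro!: b)
    thus ?thesis using coeff_kron_inj[OF a True] by simp
  qed (use D in \<open>simp add: in_keys_iff\<close>)
qed

text \<open>b is the generating function of the power sums of the reciprocal roots of p.\<close>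
lemma power_sum_bound:
  fixes p :: "complex poly"
  assumes "coeff p 0 = 1" "\<And>t. cmod t < 1 \<Longrightarrow> poly p t \<noteq> 0"
    and "fps_of_poly p * b = - (fps_X * fps_deriv (fps_of_poly p))"
  shows "cmod (fps_nth b k) \<le> degree p"
  using assms
proof (induction "degree p" arbitrary: p b)
  case 0
  then obtain c where "p = [:c:]" by (metis degree_eq_zeroE)
  hence "b = 0" using 0 by simp
  thus ?case by simp
next
  case (Suc e)
  hence "\<not> constant (poly p)" by (simp add: constant_degree)
  from Fundamental_Theorem_Algebra.fundamental_theorem_of_algebra[OF this] obtain z where z: "poly p z = 0" by blast
  then obtain q' where q': "p = [:-z, 1:] * q'" by (auto simp: poly_eq_0_iff_dvd elim: dvdE)
  have zn: "cmod z \<ge> 1" using Suc.prems(2) z by force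
  hence z0: "z \<noteq> 0" by auto
  \<comment> \<open>\<alpha> is the reciprocal of a root, so that both factors of \<open>p\<close>
    have constant term 1.\<close>
  define \<alpha> q where "\<alpha> = 1 / z" and "q = Polynomial.smult (- z) q'"
  have "[:1, - \<alpha>:] * q = Polynomial.smult (- z) [:1, - \<alpha>:] * q'"
    unfolding q_def by (simp only: mult_smult_left mult_smult_right)
  also have "Polynomial.smult (- z) [:1, - \<alpha>:] = [:-z, 1:]" using z0 by (simp add: \<alpha>_def)
  finally have q: "p = [:1, - \<alpha>:] * q" unfolding q' ..
  have q0: "q \<noteq> 0" using q Suc by auto
  have a0: "\<alpha> \<noteq> 0" "cmod \<alpha> \<le> 1" using z0 zn by (auto simp: \<alpha>_def norm_divide divide_le_eq_1_pos)
  have dp: "degree p = Suc (degree q)" unfolding q using q0 a0 by (subst degree_mult_eq) auto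
  have cq: "coeff q 0 = 1" using Suc.prems(1) by (simp add: q)
  define b1 where "b1 = - (fps_X * fps_deriv (fps_of_poly q)) * inverse (fps_of_poly q)"
  have b1: "fps_of_poly q * b1 = - (fps_X * fps_deriv (fps_of_poly q))"
  proof -
    have "inverse (fps_of_poly q) * fps_of_poly q = 1" by (rule inverse_mult_eq_1) (simp add: cq)
    thus ?thesis unfolding b1_def by (simp add: mult_ac)
  qed
  have IH: "cmod (fps_nth b1 k) \<le> degree q"
    by (rule Suc.hyps(1)) (use Suc.hyps(2) Suc.prems dp cq b1 q in auto)
  \<comment> \<open>The contribution of the factor \<open>1 - \<alpha> X\<close>: the powers of
    \<alpha> from exponent 1 on. Logarithmic derivatives add over factors.\<close>
  define s where "s = Abs_fps (\<lambda>k. if k = 0 then 0 else \<alpha> ^ k)"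
  have lin: "fps_of_poly [:1, - \<alpha>:] = 1 - fps_const \<alpha> * fps_X"
    by (rule fps_ext) (auto simp: coeff_pCons split: nat.splits)
  have s: "fps_of_poly [:1, - \<alpha>:] * s = fps_const \<alpha> * fps_X"
  proof (rule fps_ext)
    fix j
    show "fps_nth (fps_of_poly [:1, - \<alpha>:] * s) j = fps_nth (fps_const \<alpha> * fps_X) j"
      unfolding lin left_diff_distrib mult.assoc
      by (cases j rule: nat.exhaust, simp add: s_def, rename_tac i, case_tac i) (auto simp: s_def)
  qed
  let ?l = "fps_of_poly [:1, - \<alpha>:]" and ?q = "fps_of_poly q"
  have pf: "fps_of_poly p = ?l * ?q" unfolding q fps_of_poly_mult ..
  have dl: "fps_deriv ?l = - fps_const \<alpha>" by (simp add: lin)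
  have "fps_of_poly p * (b1 + s) = ?l * (?q * b1) + (?l * s) * ?q" unfolding pf by (simp add: algebra_simps)
  also have "\<dots> = ?l * (- (fps_X * fps_deriv ?q)) + fps_const \<alpha> * fps_X * ?q" unfolding b1 s ..
  also have "\<dots> = - (fps_X * fps_deriv (fps_of_poly p))" unfolding pf fps_deriv_mult dl by (simp add: algebra_simps)
  also have "\<dots> = fps_of_poly p * b" using Suc.prems(3) by simp
  finally have eq: "fps_of_poly p * (b1 + s) = fps_of_poly p * b" .
  have "fps_of_poly p \<noteq> 0" using Suc.prems(1) by (auto dest!: arg_cong[where f = "\<lambda>F. fps_nth F 0"])
  hence "b = b1 + s" using eq by (simp only: mult_cancel_left) simp
  hence "cmod (fps_nth b k) \<le> cmod (fps_nth b1 k) + cmod (fps_nth s k)" by (simp add: norm_triangle_ineq)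
  also have "cmod (fps_nth s k) \<le> 1" using a0 by (auto simp: s_def norm_power intro: power_le_one)
  finally show ?case using IH dp by simp
qed

lemma lookup_of_nat_mult: "lookup (of_nat k * p :: mpoly) n = of_nat k * lookup p n"
  using lookup_const_mult[of "of_nat k" p n] by (simp add: single_of_nat)

lemma lookup_mult_superset:
  assumes "finite K" "keys Q \<subseteq> K"
  shows "lookup (Q * A :: mpoly) n = (\<Sum>k\<in>{k\<in>K. monom_le k n}. lookup Q k * lookup A (n - k))"
  unfolding lookup_mult_series series_mult_coeff_def
  by (rule sum.mono_neutral_left) (use assms in \<open>auto simp: in_keys_iff\<close>)

text \<open>Conjugation is not an instance of \<open>coeff_hom\<close>: an \<open>alg_hom\<close>
  respects sums and products of algebraic numbers only, so the laws below require membership in some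
  \<open>mp V\<close>.\<close>

definition smap :: "(complex \<Rightarrow> complex) \<Rightarrow> mpoly \<Rightarrow> mpoly" where
  "smap s p = (\<Sum>n\<in>keys p. Poly_Mapping.single n (s (lookup p n)))"

context
  fixes s assumes s: "alg_hom s"
begin

lemma lookup_smap: "lookup (smap s p) n = s (lookup p n)"
proof -
  have "lookup (smap s p) n = (\<Sum>k\<in>keys p. if k = n then s (lookup p k) else 0)"
    unfolding smap_def lookup_sum by (intro sum.cong refl) (simp add: lookup_single when_def)
  also have "\<dots> = s (lookup p n)" by (auto simp: in_keys_iff alg_hom_0[OF s])
  finally show ?thesis .
qed

lemma smap_in: "p \<in> mp V \<Longrightarrow> smap s p \<in> mp V"
proof (rule mpI)
  fix n assume p: "p \<in> mp V" and n: "lookup (smap s p) n \<noteq> 0"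
  have "lookup p n \<noteq> 0" using n alg_hom_0[OF s] by (auto simp: lookup_smap)
  thus "keys n \<subseteq> V \<and> algebraic (lookup (smap s p) n)"
    using mp_keys[OF p] mp_algebraic[OF p] alg_hom_algebraic[OF s] by (simp add: lookup_smap)
qed

lemma keys_smap: "p \<in> mp V \<Longrightarrow> keys (smap s p) = keys p"
  using alg_hom_eq_0[OF s mp_algebraic] by (auto simp: in_keys_iff lookup_smap)

lemma smap_add: "p \<in> mp V \<Longrightarrow> q \<in> mp V \<Longrightarrow> smap s (p + q) = smap s p + smap s q"
  by (rule poly_mapping_eqI) (simp add: lookup_smap lookup_add alg_hom_add[OF s] mp_algebraic)

lemma smap_uminus: "p \<in> mp V \<Longrightarrow> smap s (- p) = - smap s p"
  by (rule poly_mapping_eqI) (simp add: lookup_smap alg_hom_uminus[OF s] mp_algebraic)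

lemma smap_sum: "(\<And>i. i \<in> I \<Longrightarrow> f i \<in> mp V) \<Longrightarrow> smap s (sum f I) = (\<Sum>i\<in>I. smap s (f i))"
  by (rule poly_mapping_eqI) (simp add: lookup_smap lookup_sum, rule alg_hom_sum[OF s], blast intro: mp_algebraic)

lemma smap_series:
  assumes "p \<in> mp V" "\<And>n. algebraic (f n)"
  shows "series_mult_coeff (smap s p) (\<lambda>n. s (f n)) n = s (series_mult_coeff p f n)"
  unfolding series_mult_coeff_def keys_smap[OF assms(1)] lookup_smap
  by (subst alg_hom_sum[OF s]) (auto simp: alg_hom_mult[OF s] assms(2) mp_algebraic[OF assms(1)] intro!: algebraic_mult)

lemma smap_mult: "p \<in> mp V \<Longrightarrow> q \<in> mp V \<Longrightarrow> smap s (p * q) = smap s p * smap s q"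
proof (rule poly_mapping_eqI)
  fix n assume p: "p \<in> mp V" and q: "q \<in> mp V"
  have "(\<lambda>n. s (lookup q n)) = lookup (smap s q)" by (rule ext) (simp add: lookup_smap)
  thus "lookup (smap s (p * q)) n = lookup (smap s p * smap s q) n"
    using smap_series[OF p, of "lookup q" n] mp_algebraic[OF q] by (simp add: lookup_smap lookup_mult_series)
qed

lemma smap_of_nat_mult: "p \<in> mp V \<Longrightarrow> smap s (of_nat k * p) = of_nat k * smap s p"
  by (rule poly_mapping_eqI)
     (simp add: lookup_smap lookup_of_nat_mult alg_hom_mult[OF s] mp_algebraic rat_imp_algebraic alg_hom_of_nat[OF s])

end

section \<open>Euler operators on series graded by total degree\<close>

definition theta :: "nat \<Rightarrow> mpoly \<Rightarrow> mpoly" where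
  "theta i p = Poly_Mapping.mapp (\<lambda>n c. of_nat (lookup n i) * c) p"

lemma lookup_theta: "lookup (theta i p) n = of_nat (lookup n i) * lookup p n"
  by (simp add: theta_def lookup_mapp when_def in_keys_iff)

lemma theta_add: "theta i (p + q) = theta i p + theta i q"
  by (rule poly_mapping_eqI) (simp add: lookup_theta lookup_add algebra_simps)

lemma theta_0: "theta i 0 = 0"
  by (rule poly_mapping_eqI) (simp add: lookup_theta)

lemma theta_sum: "theta i (sum f I) = (\<Sum>j\<in>I. theta i (f j))"
  by (induction I rule: infinite_finite_induct) (auto simp: theta_add theta_0)

lemma theta_mult: "theta i (p * q) = theta i p * q + p * theta i q"
proof (rule poly_mapping_eqI)
  fix n
  let ?K = "{k\<in>keys p. monom_le k n}"
  have sub: "keys (theta i p) \<subseteq> keys p" by (auto simp: in_keys_iff lookup_theta)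
  have "lookup (theta i (p * q)) n = (\<Sum>k\<in>?K. of_nat (lookup n i) * (lookup p k * lookup q (n - k)))"
    unfolding lookup_theta lookup_mult_superset[OF finite_keys order_refl] by (rule sum_distrib_left)
  also have "\<dots> = (\<Sum>k\<in>?K. (of_nat (lookup k i) * lookup p k) * lookup q (n - k) + lookup p k * (of_nat (lookup (n - k) i) * lookup q (n - k)))"
  proof (intro sum.cong refl)
    fix k assume "k \<in> ?K"
    then obtain l where "n = k + l" by (auto simp: monom_le_iff)
    thus "of_nat (lookup n i) * (lookup p k * lookup q (n - k)) = (of_nat (lookup k i) * lookup p k) * lookup q (n - k) + lookup p k * (of_nat (lookup (n - k) i) * lookup q (n - k))"
      by (simp add: lookup_add algebra_simps)
  qed
  also have "\<dots> = lookup (theta i p * q + p * theta i q) n"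
    unfolding lookup_add lookup_mult_superset[OF finite_keys sub] lookup_mult_superset[OF finite_keys order_refl, of p]
    by (simp add: lookup_theta sum.distrib)
  finally show "lookup (theta i (p * q)) n = lookup (theta i p * q + p * theta i q) n" .
qed

text \<open>A power series in several variables is kept as a one-variable series whose coefficient
  of index \<open>k\<close> is its part of degree \<open>k\<close>. On such a series
  \<open>fps_theta i\<close> is the Euler operator of variable \<open>i\<close>, and
  \<open>fps_tderiv\<close> is, by Euler's identity, the sum of these operators.\<close>

definition fps_theta :: "nat \<Rightarrow> mpoly fps \<Rightarrow> mpoly fps" where "fps_theta i F = Abs_fps (\<lambda>k. theta i (fps_nth F k))"
definition fps_tderiv :: "mpoly fps \<Rightarrow> mpoly fps" where "fps_tderiv F = fps_X * fps_deriv F"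

lemma fps_tderiv_nth: "fps_nth (fps_tderiv F) k = of_nat k * fps_nth F k"
  by (cases k) (simp_all add: fps_tderiv_def)

lemma fps_theta_nth: "fps_nth (fps_theta i F) k = theta i (fps_nth F k)" by (simp add: fps_theta_def)

lemma fps_theta_mult: "fps_theta i (F * G) = fps_theta i F * G + F * fps_theta i G"
  by (rule fps_ext) (simp add: fps_theta_nth fps_mult_nth theta_sum theta_mult sum.distrib)

lemma fps_tderiv_mult: "fps_tderiv (F * G) = fps_tderiv F * G + F * fps_tderiv G"
  by (simp add: fps_tderiv_def algebra_simps)

lemma fps_tderiv_fps_theta: "fps_tderiv (fps_theta i F) = fps_theta i (fps_tderiv F)"
proof (rule fps_ext, rule poly_mapping_eqI)
  fix k n
  show "lookup (fps_nth (fps_tderiv (fps_theta i F)) k) n = lookup (fps_nth (fps_theta i (fps_tderiv F)) k) n"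
    by (simp add: fps_tderiv_nth fps_theta_nth lookup_theta lookup_of_nat_mult)
qed

lemma fps_tderiv_uminus: "fps_tderiv (- F) = - fps_tderiv F" and fps_theta_uminus: "fps_theta i (- F) = - fps_theta i F"
proof -
  show "fps_tderiv (- F) = - fps_tderiv F" by (rule fps_ext) (simp add: fps_tderiv_nth)
  show "fps_theta i (- F) = - fps_theta i F"
    by (rule fps_ext, rule poly_mapping_eqI) (simp add: fps_theta_nth lookup_theta)
qed

abbreviation hfps :: "mpoly \<Rightarrow> mpoly fps" where "hfps g \<equiv> fps_of_poly (hompoly g)"

text \<open>Coefficients cannot be divided in \<open>mpoly\<close>, so the inverse series is built
  from the inverse 1 of the constant term 1. With the signs chosen, \<open>logd g\<close> and
  \<open>logdi i g\<close> are logarithmic derivatives of the reciprocal of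
  \<open>g\<close>.\<close>

definition ginv :: "mpoly \<Rightarrow> mpoly fps" where "ginv g = fps_right_inverse (hfps g) 1"
definition logd :: "mpoly \<Rightarrow> mpoly fps" where "logd g = - fps_tderiv (hfps g) * ginv g"
definition logdi :: "nat \<Rightarrow> mpoly \<Rightarrow> mpoly fps" where "logdi i g = - fps_theta i (hfps g) * ginv g"

lemma hfps_0: assumes "lookup g 0 = 1" shows "fps_nth (hfps g) 0 = 1"
proof (rule poly_mapping_eqI)
  fix n
  show "lookup (fps_nth (hfps g) 0) n = lookup 1 n"
    using assms by (simp add: lookup_hompoly mnorm_eq_0 lookup_one when_def)
qed

context
  fixes g :: mpoly assumes g0: "lookup g 0 = 1"
begin

lemma hfps_nz: "hfps g \<noteq> 0"
  using hfps_0[OF g0] by (auto dest!: arg_cong[where f = "\<lambda>F. fps_nth F 0"])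

lemma hfps_ginv: "hfps g * ginv g = 1"
  unfolding ginv_def by (rule fps_right_inverse) (simp only: hfps_0[OF g0] mult_1)

lemma hfps_logd: "hfps g * logd g = - fps_tderiv (hfps g)"
  unfolding logd_def by (simp add: mult.left_commute hfps_ginv)

lemma hfps_logdi: "hfps g * logdi i g = - fps_theta i (hfps g)"
  unfolding logdi_def by (simp add: mult.left_commute hfps_ginv)

text \<open>The two Euler operators commute, so both sides are the same mixed derivative of the
  logarithm of the reciprocal of \<open>g\<close>. Comparing coefficients then makes the ratio of an
  exponent to the degree a quotient of two coefficients.\<close>

lemma logdi_logd: "fps_tderiv (logdi i g) = fps_theta i (logd g)"
proof -
  have 1: "fps_theta i (hfps g) * logd g + hfps g * fps_theta i (logd g) = - fps_theta i (fps_tderiv (hfps g))"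
    using arg_cong[OF hfps_logd, of "fps_theta i"] by (simp add: fps_theta_mult fps_theta_uminus)
  have 2: "fps_tderiv (hfps g) * logdi i g + hfps g * fps_tderiv (logdi i g) = - fps_theta i (fps_tderiv (hfps g))"
    using arg_cong[OF hfps_logdi, of fps_tderiv i] by (simp add: fps_tderiv_mult fps_tderiv_uminus fps_tderiv_fps_theta)
  have 3: "fps_theta i (hfps g) = - (hfps g * logdi i g)" "fps_tderiv (hfps g) = - (hfps g * logd g)"
    by (simp_all add: hfps_logd hfps_logdi)
  have "- (hfps g * logdi i g) * logd g + hfps g * fps_theta i (logd g) = - (hfps g * logd g) * logdi i g + hfps g * fps_tderiv (logdi i g)"
    using 1 2 unfolding 3(1)[symmetric] 3(2)[symmetric] by simp
  hence "hfps g * fps_theta i (logd g) = hfps g * fps_tderiv (logdi i g)" by (simp add: mult_ac)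
  thus ?thesis using hfps_nz by simp
qed

lemma lookup_logdi:
  "of_nat k * lookup (fps_nth (logdi i g) k) n = of_nat (lookup n i) * lookup (fps_nth (logd g) k) n"
  using arg_cong[OF logdi_logd, of "\<lambda>F. lookup (fps_nth F k) n" i]
  by (simp add: fps_tderiv_nth fps_theta_nth lookup_theta lookup_of_nat_mult)

end

section \<open>Rings containing the coefficients of logarithmic derivatives, and their
  conjugates\<close>

lemma fps_mult_in:
  assumes "is_subring M" "\<And>k. fps_nth F k \<in> M" "\<And>k. fps_nth G k \<in> M"
  shows "fps_nth (F * G) k \<in> M"
proof -
  have "sum f I \<in> M" if "\<And>i. i \<in> I \<Longrightarrow> f i \<in> M" for f and I :: "nat set"
    using that assms(1) by (induction I rule: infinite_finite_induct) (auto simp: is_subring_def)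
  thus ?thesis unfolding fps_mult_nth using assms by (auto simp: is_subring_def)
qed

lemma subring_uminus: "is_subring M \<Longrightarrow> a \<in> M \<Longrightarrow> - a \<in> M"
  unfolding is_subring_def by (metis diff_0)

lemma ginv_in:
  assumes M: "is_subring M" "\<And>k. fps_nth (hfps g) k \<in> M" and g0: "lookup g 0 = 1"
  shows "fps_nth (ginv g) k \<in> M"
proof (induction k rule: less_induct)
  case (less k)
  have sm: "sum f I \<in> M" if "\<And>i. i \<in> I \<Longrightarrow> f i \<in> M" for f and I :: "nat set"
    using that M(1) by (induction I rule: infinite_finite_induct) (auto simp: is_subring_def)
  show ?case
  proof (cases k)
    case 0
    thus ?thesis using M(1) by (simp add: ginv_def is_subring_def)
  next
    case (Suc j)
    have eq: "fps_nth (ginv g) k = - (\<Sum>i=1..k. fps_nth (hfps g) i * fps_nth (ginv g) (k - i))"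
      by (simp add: ginv_def Suc)
    show ?thesis unfolding eq
    proof (intro subring_uminus[OF M(1)] sm)
      fix i assume "i \<in> {1..k}"
      hence "fps_nth (ginv g) (k - i) \<in> M" by (intro less) auto
      thus "fps_nth (hfps g) i * fps_nth (ginv g) (k - i) \<in> M" using M unfolding is_subring_def by blast
    qed
  qed
qed

lemma coeffwise_subring:
  assumes C: "is_subring C" shows "is_subring {p :: mpoly. \<forall>n. lookup p n \<in> C}"
proof -
  have sm: "sum f I \<in> C" if "\<And>i. i \<in> I \<Longrightarrow> f i \<in> C" for f and I :: "monom set"
    using that C by (induction I rule: infinite_finite_induct) (auto simp: is_subring_def)
  have "lookup (p * q) n \<in> C" if "\<forall>n. lookup p n \<in> C" "\<forall>n. lookup q n \<in> C" for p q :: mpoly and n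
    unfolding lookup_mult_series series_mult_coeff_def
    by (rule sm) (use C that in \<open>auto simp: is_subring_def\<close>)
  thus ?thesis using C by (auto simp: is_subring_def lookup_add lookup_minus lookup_one when_def)
qed

lemma of_nat_in_subring: "is_subring C \<Longrightarrow> of_nat k \<in> C"
  by (induction k) (auto simp: is_subring_def)

text \<open>A series with constant term 1 is inverted without division, so the coefficients never
  leave a subring that contains those of \<open>g\<close>.\<close>

lemma logd_in:
  assumes C: "is_subring C" "\<And>n. lookup g n \<in> C" and g0: "lookup g 0 = 1"
  shows "lookup (fps_nth (logd g) k) n \<in> C" "lookup (fps_nth (logdi i g) k) n \<in> C"
proof -
  let ?M = "{p :: mpoly. \<forall>n. lookup p n \<in> C}"
  have M: "is_subring ?M" by (rule coeffwise_subring[OF C(1)])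
  have C0: "0 \<in> C" using C(1) by (simp add: is_subring_def)
  have G: "fps_nth (hfps g) k \<in> ?M" for k using C(2) C0 by (simp add: lookup_hompoly)
  have I: "fps_nth (ginv g) k \<in> ?M" for k by (rule ginv_in[OF M G g0])
  have cm: "of_nat j * c \<in> C" if "c \<in> C" for j c
    using of_nat_in_subring[OF C(1), of j] that C(1) by (auto simp: is_subring_def)
  have T: "fps_nth (- fps_tderiv (hfps g)) k \<in> ?M" for k
    using subring_uminus[OF C(1)] cm G by (auto simp: fps_tderiv_nth lookup_of_nat_mult)
  have Ti: "fps_nth (- fps_theta i (hfps g)) k \<in> ?M" for k
    using subring_uminus[OF C(1)] cm G by (auto simp: fps_theta_nth lookup_theta)
  show "lookup (fps_nth (logd g) k) n \<in> C"
    using fps_mult_in[OF M T I] unfolding logd_def by blast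
  show "lookup (fps_nth (logdi i g) k) n \<in> C"
    using fps_mult_in[OF M Ti I] unfolding logdi_def by blast
qed

lemma logd_in_mp:
  assumes g: "g \<in> mp V" and g0: "lookup g 0 = 1"
  shows "fps_nth (logd g) k \<in> mp V"
proof -
  have G: "fps_nth (hfps g) k \<in> mp V" for k
    by (rule mpI) (use mp_keys[OF g] mp_algebraic[OF g] in \<open>auto simp: lookup_hompoly split: if_splits\<close>)
  have I: "fps_nth (ginv g) k \<in> mp V" for k by (rule ginv_in[OF mp_subring G g0])
  have "of_nat j \<in> mp V" for j by (rule of_nat_in_subring[OF mp_subring])
  hence T: "fps_nth (- fps_tderiv (hfps g)) k \<in> mp V" for k
    using G by (auto simp: fps_tderiv_nth intro!: mp_uminus mp_mult)
  show ?thesis unfolding logd_def by (rule fps_mult_in[OF mp_subring T I])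
qed

text \<open>Both sides solve the same linear equation with the factor
  \<open>hfps (smap s g)\<close>, which can be cancelled.\<close>

lemma smap_logd:
  assumes s: "alg_hom s" and g: "g \<in> mp V" and g0: "lookup g 0 = 1"
  shows "fps_nth (logd (smap s g)) k = smap s (fps_nth (logd g) k)"
proof -
  define F where "F = Abs_fps (\<lambda>k. smap s (fps_nth (logd g) k))"
  have sg0: "lookup (smap s g) 0 = 1" using g0 by (simp add: lookup_smap[OF s] alg_hom_1[OF s])
  have G: "fps_nth (hfps g) k \<in> mp V" for k
    by (rule mpI) (use mp_keys[OF g] mp_algebraic[OF g] in \<open>auto simp: lookup_hompoly split: if_splits\<close>)
  note L = logd_in_mp[OF g g0]
  have Gs: "fps_nth (hfps (smap s g)) k = smap s (fps_nth (hfps g) k)" for k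
    by (rule poly_mapping_eqI) (simp add: lookup_smap[OF s] lookup_hompoly alg_hom_0[OF s])
  have "hfps (smap s g) * F = - fps_tderiv (hfps (smap s g))"
  proof (rule fps_ext)
    fix k
    have "fps_nth (hfps (smap s g) * F) k = (\<Sum>j=0..k. smap s (fps_nth (hfps g) j * fps_nth (logd g) (k - j)))"
      unfolding fps_mult_nth Gs F_def fps_nth_Abs_fps smap_mult[OF s G L] ..
    also have "\<dots> = smap s (fps_nth (hfps g * logd g) k)"
      unfolding fps_mult_nth by (rule smap_sum[OF s, symmetric]) (rule mp_mult[OF G L])
    also have "\<dots> = fps_nth (- fps_tderiv (hfps (smap s g))) k"
      unfolding hfps_logd[OF g0]
      by (simp add: fps_tderiv_nth smap_of_nat_mult[OF s G] Gs smap_uminus[OF s mp_mult[OF of_nat_in_subring[OF mp_subring] G]] del: fps_of_poly_nth)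
    finally show "fps_nth (hfps (smap s g) * F) k = fps_nth (- fps_tderiv (hfps (smap s g))) k" .
  qed
  hence "hfps (smap s g) * F = hfps (smap s g) * logd (smap s g)" by (simp add: hfps_logd[OF sg0])
  hence "F = logd (smap s g)" using hfps_nz[OF sg0] by simp
  thus ?thesis by (simp add: F_def fps_eq_iff)
qed

text \<open>For a point \<open>x\<close> of the torus, \<open>g\<close> restricted to the ray
  through \<open>x\<close> has no zero in the open unit disc, so its reciprocal roots have modulus
  at most 1 and their power sums are bounded by the degree. The Cauchy estimate passes from values
  on the torus to coefficients.\<close>

lemma logd_bound:
  assumes g: "g \<in> mp {..<m}" and g0: "lookup g 0 = 1"
    and zf: "\<And>z. (\<And>j. j < m \<Longrightarrow> cmod (z j) < 1) \<Longrightarrow> meval z g \<noteq> 0"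
  shows "cmod (lookup (fps_nth (logd g) k) n) \<le> tdeg g"
proof (rule mpoly_coeff_bound_torus[OF logd_in_mp[OF g g0]])
  fix x :: "nat \<Rightarrow> complex" assume x: "\<And>i. cmod (x i) = 1"
  define E where "E F = Abs_fps (\<lambda>k. meval x (fps_nth F k))" for F
  have Emult: "E (F * G) = E F * E G" for F G
    by (rule fps_ext) (simp add: E_def fps_mult_nth ev.msub_sum meval_simps)
  have EG: "E (hfps g) = fps_of_poly (radial x g)"
  proof (rule fps_ext)
    fix k
    let ?K = "{n\<in>keys g. mnorm n = k}"
    have "meval x (coeff (hompoly g) k) = (\<Sum>n\<in>?K. lookup (coeff (hompoly g) k) n * wt x n)"
      by (rule ev.msub_superset) (auto simp: in_keys_iff lookup_hompoly split: if_splits)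
    thus "fps_nth (E (hfps g)) k = fps_nth (fps_of_poly (radial x g)) k"
      by (simp add: E_def coeff_radial lookup_hompoly)
  qed
  have em: "meval x (- p) = - meval x p" for p
    using ev.msub_add[of x p "-p"] by (simp add: ev.msub_0 eq_neg_iff_add_eq_0 add.commute)
  have en: "meval x (of_nat k * p) = of_nat k * meval x p" for k p
    using ev.msub_single[of x 0 "of_nat k"] by (simp add: meval_simps single_of_nat)
  have ET: "E (- fps_tderiv F) = - (fps_X * fps_deriv (E F))" for F
  proof (rule fps_ext)
    fix k
    show "fps_nth (E (- fps_tderiv F)) k = fps_nth (- (fps_X * fps_deriv (E F))) k"
    proof -
      have "fps_nth (E (- fps_tderiv F)) k = - (of_nat k * fps_nth (E F) k)"
        by (simp add: E_def fps_tderiv_nth em en)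
      also have "\<dots> = fps_nth (- (fps_X * fps_deriv (E F))) k" by (cases k) simp_all
      finally show ?thesis .
    qed
  qed
  have "fps_of_poly (radial x g) * E (logd g) = - (fps_X * fps_deriv (fps_of_poly (radial x g)))"
    unfolding EG[symmetric] Emult[symmetric] hfps_logd[OF g0] ET ..
  moreover have "coeff (radial x g) 0 = 1"
  proof -
    have "{n\<in>keys g. mnorm n = 0} = {0}" using g0 by (auto simp: mnorm_eq_0 in_keys_iff)
    thus ?thesis using g0 by (simp add: coeff_radial)
  qed
  moreover have "poly (radial x g) t \<noteq> 0" if "cmod t < 1" for t
    unfolding poly_psub by (rule zf) (simp add: norm_mult x that)
  ultimately have "cmod (fps_nth (E (logd g)) k) \<le> degree (radial x g)"
    by (intro power_sum_bound)
  also have "degree (radial x g) \<le> tdeg g"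
  proof (rule degree_le, intro allI impI)
    fix i assume "tdeg g < i"
    hence "{n\<in>keys g. mnorm n = i} = {}" using mnorm_le_tdeg[of g] by (force simp: in_keys_iff)
    thus "coeff (radial x g) i = 0" by (simp only: coeff_radial sum.empty)
  qed
  finally show "cmod (meval x (fps_nth (logd g) k)) \<le> tdeg g" by (simp add: E_def)
qed

section \<open>Supports of graded series\<close>

lemma lookup_mult_nz:
  assumes "lookup (p * q :: mpoly) n \<noteq> 0"
  obtains a b where "n = a + b" "lookup p a \<noteq> 0" "lookup q b \<noteq> 0"
proof -
  have "n \<in> keys (p * q)" using assms by (simp add: in_keys_iff)
  then obtain a b where "n = a + b" "a \<in> keys p" "b \<in> keys q" using keys_mult[of p q] by blast
  thus ?thesis using that by (simp add: in_keys_iff)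
qed

definition supported :: "(nat \<Rightarrow> monom \<Rightarrow> bool) \<Rightarrow> mpoly fps \<Rightarrow> bool" where
  "supported Z F \<longleftrightarrow> (\<forall>k n. lookup (fps_nth F k) n \<noteq> 0 \<longrightarrow> Z k n)"

lemma fps_mult_nz:
  fixes F G :: "mpoly fps"
  assumes "lookup (fps_nth (F * G) k) n \<noteq> 0"
  obtains j a b where "j \<le> k" "n = a + b" "lookup (fps_nth F j) a \<noteq> 0" "lookup (fps_nth G (k - j)) b \<noteq> 0"
proof -
  have "(\<Sum>j=0..k. lookup (fps_nth F j * fps_nth G (k - j)) n) \<noteq> 0"
    using assms by (simp add: fps_mult_nth lookup_sum)
  then obtain j where j: "j \<in> {0..k}" "lookup (fps_nth F j * fps_nth G (k - j)) n \<noteq> 0"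
    by (meson sum.neutral)
  from j(2) obtain a b where "n = a + b" "lookup (fps_nth F j) a \<noteq> 0" "lookup (fps_nth G (k - j)) b \<noteq> 0"
    by (rule lookup_mult_nz)
  thus ?thesis using that j(1) by simp
qed

lemma supported_mult:
  assumes "\<And>i j a b. Z i a \<Longrightarrow> Z j b \<Longrightarrow> Z (i + j) (a + b)" "supported Z F" "supported Z G"
  shows "supported Z (F * G)"
  unfolding supported_def
proof (intro allI impI)
  fix k n assume "lookup (fps_nth (F * G) k) n \<noteq> 0"
  then obtain j a b where "j \<le> k" "n = a + b" "lookup (fps_nth F j) a \<noteq> 0" "lookup (fps_nth G (k - j)) b \<noteq> 0"
    by (rule fps_mult_nz)
  thus "Z k n" using assms(1)[of j a "k - j" b] assms(2,3) by (auto simp: supported_def)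
qed

lemma supported_uminus: "supported Z F \<Longrightarrow> supported Z (- F)" by (auto simp: supported_def)

text \<open>The equation determines \<open>k\<close> times the part of degree \<open>k\<close> of
  \<open>F\<close> from parts of lower degree, as \<open>B\<close> has no part of degree 0. A
  condition that is additive in degree and exponent thus passes from \<open>B\<close> and the part
  of degree 0 to all of \<open>F\<close>.\<close>

lemma supported_ode:
  assumes add: "\<And>i j a b. Z i a \<Longrightarrow> Z j b \<Longrightarrow> Z (i + j) (a + b)"
    and ode: "fps_tderiv F = - (F * B)" and B0: "fps_nth B 0 = 0" and B: "supported Z B"
    and F0: "\<And>n. lookup (fps_nth F 0) n \<noteq> 0 \<Longrightarrow> Z 0 n"
  shows "supported Z F"
proof -
  have "lookup (fps_nth F k) n \<noteq> 0 \<Longrightarrow> Z k n" for k n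
  proof (induction k arbitrary: n rule: less_induct)
    case (less k)
    show ?case
    proof (cases "k = 0")
      case True
      thus ?thesis using F0 less.prems by simp
    next
      case False
      have "of_nat k * lookup (fps_nth F k) n = - lookup (fps_nth (F * B) k) n"
        using arg_cong[OF ode, of "\<lambda>F. lookup (fps_nth F k) n"] by (simp add: fps_tderiv_nth lookup_of_nat_mult)
      hence "lookup (fps_nth (F * B) k) n \<noteq> 0" using False less.prems by auto
      then obtain j a b where j: "j \<le> k" "n = a + b" "lookup (fps_nth F j) a \<noteq> 0" "lookup (fps_nth B (k - j)) b \<noteq> 0"
        by (rule fps_mult_nz)
      have "j \<noteq> k" using j(4) B0 by auto
      hence "Z j a" using less.IH j by auto
      moreover have "Z (k - j) b" using B j(4) by (auto simp: supported_def)
      ultimately show ?thesis using add[of j a "k - j" b] j by simp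
    qed
  qed
  thus ?thesis by (auto simp: supported_def)
qed

lemma supported_hfps: "supported (\<lambda>k n. mnorm n = k) (hfps g)"
  by (auto simp: supported_def lookup_hompoly)

lemma supported_fps_tderiv: "supported Z F \<Longrightarrow> supported Z (fps_tderiv F)"
  by (auto simp: supported_def fps_tderiv_nth lookup_of_nat_mult)

lemma supported_ginv:
  assumes add: "\<And>i j a b. Z i a \<Longrightarrow> Z j b \<Longrightarrow> Z (i + j) (a + b)" and Z0: "Z 0 0" and G: "supported Z (hfps g)"
  shows "supported Z (ginv g)"
proof -
  have "lookup (fps_nth (ginv g) k) n \<noteq> 0 \<Longrightarrow> Z k n" for k n
  proof (induction k arbitrary: n rule: less_induct)
    case (less k)
    show ?case
    proof (cases k)
      case 0
      thus ?thesis using less.prems Z0 by (auto simp: ginv_def lookup_one when_def split: if_splits)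
    next
      case (Suc j)
      have "fps_nth (ginv g) k = - (\<Sum>i=1..k. fps_nth (hfps g) i * fps_nth (ginv g) (k - i))"
        by (simp add: ginv_def Suc)
      hence "(\<Sum>i=1..k. lookup (fps_nth (hfps g) i * fps_nth (ginv g) (k - i)) n) \<noteq> 0"
        using less.prems by (simp add: lookup_sum)
      then obtain i where i: "i \<in> {1..k}" "lookup (fps_nth (hfps g) i * fps_nth (ginv g) (k - i)) n \<noteq> 0"
        by (meson sum.neutral)
      from i(2) obtain a b where ab: "n = a + b" "lookup (fps_nth (hfps g) i) a \<noteq> 0" "lookup (fps_nth (ginv g) (k - i)) b \<noteq> 0"
        by (rule lookup_mult_nz)
      have "Z i a" using G ab(2) by (auto simp: supported_def)
      moreover have "Z (k - i) b" using less.IH[of "k - i"] i ab(3) by auto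
      ultimately show ?thesis using add[of i a "k - i" b] i ab(1) by simp
    qed
  qed
  thus ?thesis by (auto simp: supported_def)
qed

lemma logd_homogeneous: "lookup (fps_nth (logd g) k) n \<noteq> 0 \<Longrightarrow> mnorm n = k"
proof -
  have a: "\<And>i j a b. mnorm a = i \<Longrightarrow> mnorm b = j \<Longrightarrow> mnorm (a + b) = i + j" by (simp add: mnorm_add)
  have "supported (\<lambda>k n. mnorm n = k) (logd g)" unfolding logd_def
    by (rule supported_mult[OF a supported_uminus[OF supported_fps_tderiv[OF supported_hfps]] supported_ginv[OF a mnorm_0 supported_hfps]])
  thus "lookup (fps_nth (logd g) k) n \<noteq> 0 \<Longrightarrow> mnorm n = k" by (simp add: supported_def)
qed

lemma logd_nth_0: "fps_nth (logd g) 0 = 0"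
  by (simp add: logd_def fps_tderiv_nth)

lemma tdeg_mono: "keys p \<subseteq> keys q \<Longrightarrow> tdeg p \<le> tdeg q"
  unfolding tdeg_def[of p]
proof (rule degree_le, intro allI impI poly_mapping_eqI)
  fix i n assume k: "keys p \<subseteq> keys q" and "tdeg q < i"
  hence "mnorm n = i \<Longrightarrow> lookup q n = 0" using mnorm_le_tdeg[of q n] by force
  hence "mnorm n = i \<Longrightarrow> lookup p n = 0" using k by (metis in_keys_iff subsetD)
  thus "lookup (coeff (hompoly p) i) n = lookup 0 n" by (simp add: lookup_hompoly)
qed

section \<open>Directions and faces of the logarithmic derivative\<close>

text \<open>At exponent 0 this is the zero vector by division by 0; that exponent never occurs in
  the support of \<open>logd g\<close>.\<close>

definition direction :: "monom \<Rightarrow> nat \<Rightarrow> real" where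
  "direction n i = real (lookup n i) / real (mnorm n)"

definition log_directions :: "mpoly \<Rightarrow> (nat \<Rightarrow> real) set" where
  "log_directions g = {direction n |k n. lookup (fps_nth (logd g) k) n \<noteq> 0}"

text \<open>The coefficients of \<open>logd g\<close>, and those of \<open>logdi i g\<close> at
  exponents whose norm is the positive degree, are algebraic integers of bounded degree with all
  conjugates bounded, hence lie in a finite set \<open>V\<close>. By \<open>lookup_logdi\<close>,
  every coordinate of a direction is a quotient of two elements of \<open>V\<close>.\<close>

lemma finite_log_directions:
  assumes R: "bounded_degree_ring (of_rat :: rat \<Rightarrow> complex) d R"
    and g: "g \<in> mp {..<m}" and g0: "lookup g 0 = 1"
    and gR: "\<And>n. lookup g n \<in> R" and gI: "\<And>n. algebraic_int (lookup g n)"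
    and zf: "\<And>s z. alg_hom s \<Longrightarrow> (\<And>j. j < m \<Longrightarrow> cmod (z j) < 1) \<Longrightarrow> meval z (smap s g) \<noteq> 0"
  shows "finite (log_directions g)"
proof -
  define C where "C = R \<inter> {x. algebraic_int x}"
  have C: "is_subring C" unfolding C_def is_subring_def
    by (auto intro: bdr_0[OF R] bdr_1[OF R] bdr_add[OF R] bdr_mult[OF R] bdr_diff[OF R]
        algebraic_int_add algebraic_int_mult algebraic_int_diff int_imp_algebraic_int)
  have gC: "lookup g n \<in> C" for n using gR gI by (simp add: C_def)
  note inC = logd_in[OF C gC g0]
  define D where "D = max 1 (real (tdeg g))"
  define V where "V = bounded_ints d D"
  have finV: "finite V" unfolding V_def by (rule bounded_ints_card) (simp add: D_def)
  have sb: "cmod (s (lookup (fps_nth (logd g) k) n)) \<le> D" if s: "alg_hom s" for s k n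
  proof -
    have "lookup (smap s g) 0 = 1" using g0 by (simp add: lookup_smap[OF s] alg_hom_1[OF s])
    hence "cmod (lookup (fps_nth (logd (smap s g)) k) n) \<le> tdeg (smap s g)"
      by (rule logd_bound[OF smap_in[OF s g] _ zf[OF s]])
    also have "tdeg (smap s g) \<le> tdeg g" by (rule tdeg_mono) (simp add: keys_smap[OF s g])
    finally show ?thesis unfolding smap_logd[OF s g g0] lookup_smap[OF s] by (simp add: D_def)
  qed
  have bV: "lookup (fps_nth (logd g) k) n \<in> V" for k n
    using inC(1)[of k n] bounded_degree(2)[OF R] sb by (auto simp: V_def bounded_ints_def C_def)
  have biV: "lookup (fps_nth (logdi i g) k) n \<in> V" if k: "k > 0" "mnorm n = k" for i k n
  proof -
    let ?y = "lookup (fps_nth (logdi i g) k) n" and ?b = "lookup (fps_nth (logd g) k) n"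
    have alg: "algebraic ?y" "algebraic ?b"
      using inC(2)[of i k n] inC(1)[of k n] by (auto simp: C_def)
    have na: "algebraic (of_nat j :: complex)" for j by (simp add: rat_imp_algebraic)
    \<comment> \<open>Conjugate the identity of \<open>lookup_logdi\<close>; the exponent of
      variable \<open>i\<close> is at most the degree \<open>k\<close>.\<close>
    have "cmod (s ?y) \<le> D" if s: "alg_hom s" for s
    proof -
      have "of_nat k * s ?y = of_nat (lookup n i) * s ?b"
        using arg_cong[OF lookup_logdi[OF g0, of k i n], of s]
        by (simp add: alg_hom_mult[OF s na] alg alg_hom_of_nat[OF s])
      hence "real k * cmod (s ?y) = real (lookup n i) * cmod (s ?b)" by (metis norm_mult norm_of_nat)
      also have "\<dots> \<le> real k * D" using lookup_le_mnorm[of n i] k sb[OF s] by (intro mult_mono) auto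
      finally show ?thesis using k by simp
    qed
    thus ?thesis using inC(2)[of i k n] bounded_degree(2)[OF R] by (auto simp: V_def bounded_ints_def C_def)
  qed
  define W where "W = (\<lambda>(x,y). Re (x / y)) ` (V \<times> V)"
  have finW: "finite W" using finV by (simp add: W_def)
  have "log_directions g \<subseteq> {v. \<forall>i. (i \<in> {..<m} \<longrightarrow> v i \<in> W) \<and> (i \<notin> {..<m} \<longrightarrow> v i = 0)}"
  proof
    fix v assume "v \<in> log_directions g"
    then obtain k n where n: "v = direction n" "lookup (fps_nth (logd g) k) n \<noteq> 0" by (auto simp: log_directions_def)
    have k: "mnorm n = k" using n(2) by (rule logd_homogeneous)
    have "k \<noteq> 0" using n(2) logd_nth_0[of g] by (metis lookup_zero)
    hence k0: "k > 0" by simp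
    have "direction n i \<in> W" for i
    proof -
      let ?y = "lookup (fps_nth (logdi i g) k) n" and ?b = "lookup (fps_nth (logd g) k) n"
      have "?y / ?b = of_real (direction n i)"
        using lookup_logdi[OF g0, of k i n] n(2) k0 by (simp add: direction_def k field_simps)
      hence "direction n i = Re (?y / ?b)" by simp
      thus ?thesis unfolding W_def using bV[of k n] biV[OF k0 k, of i] by force
    qed
    moreover have "direction n i = 0" if "i \<notin> {..<m}" for i
    proof -
      have "keys n \<subseteq> {..<m}" using mp_keys[OF logd_in_mp[OF g g0] n(2)] .
      hence "lookup n i = 0" using that by (auto simp: in_keys_iff)
      thus ?thesis by (simp add: direction_def)
    qed
    ultimately show "v \<in> {v. \<forall>i. (i \<in> {..<m} \<longrightarrow> v i \<in> W) \<and> (i \<notin> {..<m} \<longrightarrow> v i = 0)}"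
      by (simp add: n(1))
  qed
  moreover have "finite {v. \<forall>i. (i \<in> {..<m} \<longrightarrow> v i \<in> W) \<and> (i \<notin> {..<m} \<longrightarrow> v i = (0::real))}"
    by (rule finite_set_of_finite_funs) (use finW in auto)
  ultimately show ?thesis by (rule finite_subset)
qed

text \<open>The exposed v is an element of maximal Euclidean norm.\<close>
lemma exposed_direction:
  fixes V :: "(nat \<Rightarrow> real) set"
  assumes V: "finite V" "V \<noteq> {}" "\<And>v i. v \<in> V \<Longrightarrow> i \<ge> m \<Longrightarrow> v i = 0"
  obtains v c \<delta> where "v \<in> V" "\<delta> > 0" "(\<Sum>i<m. v i * v i) = c"
    "\<And>u. u \<in> V \<Longrightarrow> u \<noteq> v \<Longrightarrow> c - (\<Sum>i<m. v i * u i) \<ge> \<delta>"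
proof -
  define q where "q u = (\<Sum>i<m. u i * u i)" for u :: "nat \<Rightarrow> real"
  have "Max (q ` V) \<in> q ` V" using V by simp
  then obtain v where v: "v \<in> V" "Max (q ` V) = q v" by blast
  have le: "q u \<le> q v" if "u \<in> V" for u unfolding v(2)[symmetric] using that V by simp
  define t where "t u = q v - (\<Sum>i<m. v i * u i)" for u
  have pos: "t u > 0" if u: "u \<in> V" "u \<noteq> v" for u
  proof -
    obtain i where i: "u i \<noteq> v i" using u(2) by blast
    hence im: "i < m" using V(3) u v by (metis linorder_not_less)
    \<comment> \<open>The squared distance from \<open>u\<close> to \<open>v\<close> is positive and
      \<open>q u\<close> is at most \<open>q v\<close>, which pushes the inner product of
      \<open>u\<close> and \<open>v\<close> strictly below \<open>q v\<close>.\<close>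
    have "0 < (\<Sum>j<m. (u j - v j)\<^sup>2)" by (rule sum_pos2[of _ i]) (use i im in auto)
    also have "\<dots> = q u - 2 * (\<Sum>i<m. v i * u i) + q v"
      by (simp add: q_def power2_eq_square algebra_simps sum.distrib sum_subtractf sum_distrib_left)
    finally show ?thesis using le[OF u(1)] by (simp add: t_def)
  qed
  \<comment> \<open>The inserted 1 covers the case that \<open>v\<close> is the only
    element.\<close>
  define \<delta> where "\<delta> = Min (insert 1 (t ` (V - {v})))"
  have "\<delta> > 0" unfolding \<delta>_def using V pos by (subst Min_gr_iff) auto
  moreover have "\<delta> \<le> t u" if "u \<in> V" "u \<noteq> v" for u unfolding \<delta>_def using V that by (intro Min_le) auto
  ultimately show ?thesis using that[OF v(1), of \<delta> "q v"] by (simp add: q_def t_def)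
qed

definition face_part :: "(nat \<Rightarrow> real) \<Rightarrow> mpoly \<Rightarrow> mpoly" where
  "face_part w p = Poly_Mapping.mapp (\<lambda>n c. if wdeg w n = 0 then c else 0) p"

lemma lookup_face_part: "lookup (face_part w p) n = (if wdeg w n = 0 then lookup p n else 0)"
  by (auto simp: face_part_def lookup_mapp when_def in_keys_iff)

lemma face_part_in: "p \<in> mp V \<Longrightarrow> face_part w p \<in> mp V"
  by (rule mpI) (auto simp: lookup_face_part mp_algebraic dest: mp_keys split: if_splits)

lemma face_part_sum: "face_part w (sum f I) = (\<Sum>i\<in>I. face_part w (f i))"
  by (rule poly_mapping_eqI) (simp add: lookup_face_part lookup_sum)

text \<open>A sum of two nonnegative weights vanishes only if both do, so products with a factor off
  the face never reach it.\<close>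

lemma face_part_mult:
  assumes p: "\<And>n. lookup p n \<noteq> 0 \<Longrightarrow> wdeg w n \<ge> 0" and q: "\<And>n. lookup q n \<noteq> 0 \<Longrightarrow> wdeg w n \<ge> 0"
  shows "face_part w (p * q) = face_part w p * face_part w q"
proof (rule poly_mapping_eqI)
  fix n
  let ?K = "{k\<in>keys p. monom_le k n}"
  have sub: "keys (face_part w p) \<subseteq> keys p" by (auto simp: in_keys_iff lookup_face_part split: if_splits)
  have "lookup (face_part w p * face_part w q) n = (\<Sum>k\<in>?K. lookup (face_part w p) k * lookup (face_part w q) (n - k))"
    by (rule lookup_mult_superset[OF finite_keys sub])
  also have "\<dots> = (\<Sum>k\<in>?K. if wdeg w n = 0 then lookup p k * lookup q (n - k) else 0)"
  proof (intro sum.cong refl)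
    fix k assume "k \<in> ?K"
    then obtain l where n: "n = k + l" and k: "lookup p k \<noteq> 0" by (auto simp: monom_le_iff in_keys_iff)
    show "lookup (face_part w p) k * lookup (face_part w q) (n - k) = (if wdeg w n = 0 then lookup p k * lookup q (n - k) else 0)"
    proof (cases "lookup q l = 0")
      case False
      hence "wdeg w k \<ge> 0" "wdeg w l \<ge> 0" using p q k by auto
      thus ?thesis by (auto simp: n lookup_face_part wdeg_add)
    qed (simp add: n lookup_face_part)
  qed
  also have "\<dots> = lookup (face_part w (p * q)) n"
    unfolding lookup_face_part lookup_mult_superset[OF finite_keys order_refl] by simp
  finally show "lookup (face_part w (p * q)) n = lookup (face_part w p * face_part w q) n" by simp
qed

lemma hompoly_face_part: "fps_nth (hfps (face_part w g)) k = face_part w (fps_nth (hfps g) k)"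
  by (rule poly_mapping_eqI) (simp add: lookup_face_part lookup_hompoly)

text \<open>If the logarithmic derivative is supported on the face where w vanishes and strictly inside
  the cone otherwise, then the face part of g divides g: the cofactor is a power series whose
  homogeneous parts vanish eventually.\<close>
lemma face_factor:
  assumes g: "g \<in> mp V" and g0: "lookup g 0 = 1" and \<delta>: "\<delta> > 0"
    and cone: "\<And>k n. lookup (fps_nth (logd g) k) n \<noteq> 0 \<Longrightarrow> wdeg w n = 0 \<or> wdeg w n \<ge> \<delta> * real k"
  shows "lookup (face_part w g) 0 = 1"
    "logd (face_part w g) = Abs_fps (\<lambda>k. face_part w (fps_nth (logd g) k))"
    "\<exists>h\<in>mp V. g = face_part w g * h"
proof -
  define p where "p = face_part w g"
  \<comment> \<open>The logarithmic derivative splits into its part on the face, which turns out to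
    be \<open>logd p\<close>, and the rest \<open>B'\<close>, which governs the cofactor.\<close>
  define B1 where "B1 = Abs_fps (\<lambda>k. face_part w (fps_nth (logd g) k))"
  define B' where "B' = logd g - B1"
  show p0: "lookup (face_part w g) 0 = 1" by (simp add: lookup_face_part g0)
  note p0' = p0[folded p_def]
  have B1: "lookup (fps_nth B1 k) n = (if wdeg w n = 0 then lookup (fps_nth (logd g) k) n else 0)" for k n
    by (simp add: B1_def lookup_face_part)
  have B': "lookup (fps_nth B' k) n = (if wdeg w n = 0 then 0 else lookup (fps_nth (logd g) k) n)" for k n
    by (simp add: B'_def lookup_minus B1)
  have Bnn: "wdeg w n \<ge> 0" if "lookup (fps_nth (logd g) k) n \<noteq> 0" for k n
    using cone[OF that] \<delta> by (auto intro: order_trans[of _ "\<delta> * real k"])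
  have G0: "lookup (fps_nth (hfps g) 0) n \<noteq> 0 \<Longrightarrow> n = 0" for g n
    by (auto simp: lookup_hompoly mnorm_eq_0 split: if_splits)
  have ode: "fps_tderiv (hfps g) = - (hfps g * logd g)" by (simp add: hfps_logd[OF g0])
  have "supported (\<lambda>k n. wdeg w n \<ge> 0) (hfps g)"
  proof (rule supported_ode[OF _ ode logd_nth_0])
    show "wdeg w n \<ge> 0" if "lookup (fps_nth (hfps g) 0) n \<noteq> 0" for n using G0[OF that] by simp
  qed (use Bnn in \<open>auto simp: wdeg_add supported_def\<close>)
  hence Gnn: "wdeg w n \<ge> 0" if "lookup (fps_nth (hfps g) k) n \<noteq> 0" for k n using that by (auto simp: supported_def)
  have "hfps p * B1 = - fps_tderiv (hfps p)"
  proof (rule fps_ext)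
    fix k
    have "fps_nth (hfps p * B1) k = (\<Sum>j=0..k. face_part w (fps_nth (hfps g) j * fps_nth (logd g) (k - j)))"
      unfolding fps_mult_nth p_def B1_def hompoly_face_part fps_nth_Abs_fps
      by (intro sum.cong refl face_part_mult[symmetric]) (use Gnn Bnn in blast)+
    also have "\<dots> = face_part w (fps_nth (hfps g * logd g) k)" by (simp add: fps_mult_nth face_part_sum)
    also have "\<dots> = fps_nth (- fps_tderiv (hfps p)) k" unfolding hfps_logd[OF g0]
      by (rule poly_mapping_eqI) (simp add: lookup_face_part fps_tderiv_nth lookup_of_nat_mult p_def hompoly_face_part del: fps_of_poly_nth)
    finally show "fps_nth (hfps p * B1) k = fps_nth (- fps_tderiv (hfps p)) k" .
  qed
  hence "hfps p * B1 = hfps p * logd p" by (simp add: hfps_logd[OF p0'])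
  hence lp: "logd p = B1" using hfps_nz[OF p0'] by simp
  thus "logd (face_part w g) = Abs_fps (\<lambda>k. face_part w (fps_nth (logd g) k))" by (simp add: p_def B1_def)
  \<comment> \<open>The cofactor as a formal series; what remains is that it is a
    polynomial.\<close>
  define H where "H = hfps g * ginv p"
  have GH: "hfps p * H = hfps g" by (simp add: H_def mult.left_commute[of "hfps p"] hfps_ginv[OF p0'])
  have "fps_tderiv (hfps p) * H + hfps p * fps_tderiv H = fps_tderiv (hfps g)" using arg_cong[OF GH, of fps_tderiv] by (simp add: fps_tderiv_mult)
  moreover have "fps_tderiv (hfps p) = - (hfps p * B1)" using hfps_logd[OF p0'] lp by simp
  moreover have "fps_tderiv (hfps g) = - (hfps p * H * logd g)" using ode GH by simp
  ultimately have "hfps p * fps_tderiv H = hfps p * (H * B1 - H * logd g)" by (simp add: algebra_simps)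
  hence "fps_tderiv H = H * B1 - H * logd g" using hfps_nz[OF p0'] by (simp only: mult_cancel_left) simp
  \<comment> \<open>The cofactor inherits from \<open>B'\<close> that its weights are at least
    \<delta> times the degree.\<close>
  hence Hode: "fps_tderiv H = - (H * B')" by (simp add: B'_def algebra_simps)
  have "supported (\<lambda>k n. mnorm n = k) H" unfolding H_def
    by (rule supported_mult[OF _ supported_hfps supported_ginv[OF _ mnorm_0 supported_hfps]]) (simp_all add: mnorm_add)
  hence Hh: "mnorm n = k" if "lookup (fps_nth H k) n \<noteq> 0" for k n using that by (auto simp: supported_def)
  have "supported (\<lambda>k n. wdeg w n \<ge> \<delta> * real k) H"
  proof (rule supported_ode[OF _ Hode])
    show "fps_nth B' 0 = 0" by (rule poly_mapping_eqI) (simp add: B' logd_nth_0)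
    show "supported (\<lambda>k n. wdeg w n \<ge> \<delta> * real k) B'" using cone by (force simp: supported_def B')
    show "wdeg w n \<ge> \<delta> * real 0" if "lookup (fps_nth H 0) n \<noteq> 0" for n using Hh[OF that] by (simp add: mnorm_eq_0)
  qed (simp add: wdeg_add algebra_simps)
  hence Hlow: "wdeg w n \<ge> \<delta> * real k" if "lookup (fps_nth H k) n \<noteq> 0" for k n using that by (auto simp: supported_def)
  define \<Lambda> where "\<Lambda> = Max (insert 0 (wdeg w ` keys g))"
  have \<Lambda>: "wdeg w n \<le> \<Lambda>" if "lookup g n \<noteq> 0" for n
    unfolding \<Lambda>_def by (rule Max_ge) (use that in \<open>auto simp: in_keys_iff\<close>)
  \<comment> \<open>Terms of \<open>p\<close> have weight 0, so a term of \<open>H\<close> of weight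
    above \<Lambda> in the lowest possible degree meets nothing that could cancel it in the product,
    and would appear in \<open>g\<close>.\<close>
  have Hup: "lookup (fps_nth H k) n \<noteq> 0 \<Longrightarrow> wdeg w n \<le> \<Lambda>" for k n
  proof (induction k arbitrary: n rule: less_induct)
    case (less k)
    show ?case
    proof (rule ccontr)
      assume big: "\<not> wdeg w n \<le> \<Lambda>"
      have "lookup (fps_nth (hfps p) j * fps_nth H (k - j)) n = 0" if j: "j \<in> {1..k}" for j
      proof (rule ccontr)
        assume "lookup (fps_nth (hfps p) j * fps_nth H (k - j)) n \<noteq> 0"
        then obtain a b where ab: "n = a + b" "lookup (fps_nth (hfps p) j) a \<noteq> 0" "lookup (fps_nth H (k - j)) b \<noteq> 0"
          by (rule lookup_mult_nz)
        have "wdeg w a = 0" using ab(2) unfolding p_def hompoly_face_part lookup_face_part by (auto split: if_splits)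
        moreover have "wdeg w b \<le> \<Lambda>" using less.IH[of "k - j" b] ab(3) j by auto
        ultimately show False using big ab(1) by (simp add: wdeg_add)
      qed
      hence "(\<Sum>j=1..k. lookup (fps_nth (hfps p) j * fps_nth H (k - j)) n) = 0" by (rule sum.neutral[OF ballI])
      moreover have "fps_nth (hfps g) k = fps_nth (hfps p) 0 * fps_nth H (k - 0) + (\<Sum>j=1..k. fps_nth (hfps p) j * fps_nth H (k - j))"
        unfolding GH[symmetric] fps_mult_nth by (simp add: sum.atLeast_Suc_atMost del: fps_of_poly_nth)
      ultimately have "lookup (fps_nth (hfps g) k) n = lookup (fps_nth H k) n"
        by (simp add: hfps_0[OF p0'] lookup_add lookup_sum del: fps_of_poly_nth)
      hence "lookup g n \<noteq> 0" using less.prems by (auto simp: lookup_hompoly split: if_splits)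
      thus False using \<Lambda> big by blast
    qed
  qed
  \<comment> \<open>Weights at least \<delta> times the degree and at most \<Lambda> leave no room
    for degrees beyond \<open>N\<close>.\<close>
  define N where "N = nat \<lceil>\<Lambda> / \<delta>\<rceil>"
  have H0: "fps_nth H k = 0" if "k > N" for k
  proof (rule poly_mapping_eqI, rule ccontr)
    fix n assume "lookup (fps_nth H k) n \<noteq> lookup 0 n"
    hence "\<delta> * real k \<le> \<Lambda>" using Hlow[of k n] Hup[of k n] by simp
    hence "real k \<le> \<Lambda> / \<delta>" using \<delta> by (simp add: field_simps)
    hence "k \<le> N" unfolding N_def by linarith
    thus False using that by simp
  qed
  define h where "h = (\<Sum>k\<le>N. fps_nth H k)"
  have lh: "lookup h n = lookup (fps_nth H (mnorm n)) n" for n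
  proof -
    have "lookup h n = (\<Sum>k\<le>N. lookup (fps_nth H k) n)" by (simp add: h_def lookup_sum)
    also have "\<dots> = (\<Sum>k\<le>N. if k = mnorm n then lookup (fps_nth H (mnorm n)) n else 0)"
      by (intro sum.cong refl) (use Hh in auto)
    also have "\<dots> = lookup (fps_nth H (mnorm n)) n" using H0[of "mnorm n"] by auto
    finally show ?thesis .
  qed
  have "hfps h = H"
    by (rule fps_ext, rule poly_mapping_eqI) (use Hh in \<open>auto simp: lookup_hompoly lh\<close>)
  hence "fps_of_poly (hompoly p * hompoly h) = hfps g" using GH by (simp add: fps_of_poly_mult)
  hence "hompoly (p * h) = hompoly g" by (simp add: hompoly_mult)
  hence "g = p * h" by (rule hompoly_inj[symmetric])
  moreover have "h \<in> mp V"
  proof -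
    have Gin: "fps_nth (hfps q) k \<in> mp V" if "q \<in> mp V" for q k
      by (rule mpI) (use mp_keys[OF that] mp_algebraic[OF that] in \<open>auto simp: lookup_hompoly split: if_splits\<close>)
    have pV: "p \<in> mp V" unfolding p_def by (rule face_part_in[OF g])
    have "fps_nth H k \<in> mp V" for k unfolding H_def
      by (rule fps_mult_in[OF mp_subring Gin[OF g] ginv_in[OF mp_subring Gin[OF pV] p0']])
    thus ?thesis unfolding h_def by (rule mp_sum)
  qed
  ultimately show "\<exists>h\<in>mp V. g = face_part w g * h" by (auto simp: p_def)
qed

lemma logd_eq_0_iff:
  assumes g0: "lookup g 0 = 1" shows "logd g = 0 \<longleftrightarrow> tdeg g = 0"
proof
  assume l0: "logd g = 0"
  have "0 = - fps_tderiv (hfps g)" using hfps_logd[OF g0] unfolding l0 mult_zero_right .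
  hence "- fps_tderiv (hfps g) = 0" by (rule sym)
  hence T: "fps_tderiv (hfps g) = 0" by (simp only: neg_equal_0_iff_equal)
  show "tdeg g = 0"
  proof (rule ccontr)
    assume d: "tdeg g \<noteq> 0"
    have "of_nat (tdeg g) * coeff (hompoly g) (tdeg g) = 0"
      using arg_cong[OF T, of "\<lambda>F. fps_nth F (tdeg g)"] by (simp add: fps_tderiv_nth)
    hence "coeff (hompoly g) (tdeg g) = 0" using d by simp
    hence "hompoly g = 0" by (simp add: tdeg_def)
    thus False using d by (simp add: tdeg_def)
  qed
next
  assume d: "tdeg g = 0"
  have "fps_tderiv (hfps g) = 0"
  proof (rule fps_ext)
    fix k
    show "fps_nth (fps_tderiv (hfps g)) k = fps_nth 0 k"
      using d by (cases k) (simp_all add: fps_tderiv_nth tdeg_def coeff_eq_0)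
  qed
  hence "hfps g * logd g = 0" using hfps_logd[OF g0] by simp
  thus "logd g = 0" using hfps_nz[OF g0] by simp
qed

text \<open>Expose one direction \<open>v\<close> of the logarithmic derivative. The face part of
  \<open>g\<close> belonging to it is a factor with nonzero logarithmic derivative, hence not a
  unit, so irreducibility makes it all of \<open>g\<close>. No other direction remains, and
  \<open>supported_ode\<close> carries this from \<open>logd g\<close> to \<open>g\<close>.\<close>

lemma ray_support:
  assumes g: "irreducible_in (mp {..<m}) g" and g0: "lookup g 0 = 1" and fin: "finite (log_directions g)"
  shows "\<exists>v. \<forall>n i. lookup g n \<noteq> 0 \<longrightarrow> real (lookup n i) = real (mnorm n) * v i"
proof -
  have gV: "g \<in> mp {..<m}" "g \<noteq> 0" using g by (auto simp: irreducible_in_def)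
  have "tdeg g \<noteq> 0" using g mp_unit_iff[OF gV(1)] gV(2) by (auto simp: irreducible_in_def)
  hence "logd g \<noteq> 0" using logd_eq_0_iff[OF g0] by simp
  then obtain k where "fps_nth (logd g) k \<noteq> 0" by (auto simp: fps_eq_iff)
  then obtain n where "lookup (fps_nth (logd g) k) n \<noteq> 0" by (metis lookup_zero poly_mapping_eqI)
  hence ne: "log_directions g \<noteq> {}" by (auto simp: log_directions_def)
  have L: "keys n \<subseteq> {..<m}" "mnorm n = k" "k > 0" if "lookup (fps_nth (logd g) k) n \<noteq> 0" for k n
  proof -
    show "keys n \<subseteq> {..<m}" using mp_keys[OF logd_in_mp[OF gV(1) g0] that] .
    show "mnorm n = k" by (rule logd_homogeneous[OF that])
    show "k > 0" using that by (cases "k = 0") (auto simp: logd_nth_0)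
  qed
  have out: "u i = 0" if u: "u \<in> log_directions g" "i \<ge> m" for u i
  proof -
    obtain k n where n: "u = direction n" "lookup (fps_nth (logd g) k) n \<noteq> 0" using u by (auto simp: log_directions_def)
    hence "lookup n i = 0" using L(1)[OF n(2)] u(2) by (auto simp: in_keys_iff)
    thus ?thesis by (simp add: n(1) direction_def)
  qed
  obtain v c \<delta> where v: "v \<in> log_directions g" "\<delta> > 0" "(\<Sum>i<m. v i * v i) = c"
    "\<And>u. u \<in> log_directions g \<Longrightarrow> u \<noteq> v \<Longrightarrow> c - (\<Sum>i<m. v i * u i) \<ge> \<delta>"
    by (rule exposed_direction[where m = m, OF fin ne])
      (use out in \<open>auto simp del: One_nat_def\<close>)
  \<comment> \<open>With this linear form, the weight of an exponent of the logarithmic derivative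
    is its degree times the gap from \<open>exposed_direction\<close>: zero in direction
    \<open>v\<close>, at least \<delta> per degree in all others.\<close>
  define w where "w i = c - v i" for i
  have wd: "wdeg w n = real k * (c - (\<Sum>i<m. v i * direction n i))" if n: "lookup (fps_nth (logd g) k) n \<noteq> 0" for k n
  proof -
    have li: "real (lookup n i) = real k * direction n i" for i using L(2,3)[OF n] by (simp add: direction_def)
    have "wdeg w n = (\<Sum>i<m. w i * real (lookup n i))" by (rule wdeg_superset) (use L(1)[OF n] in auto)
    also have "\<dots> = c * (\<Sum>i<m. real (lookup n i)) - (\<Sum>i<m. v i * real (lookup n i))"
      by (simp add: w_def left_diff_distrib sum_subtractf sum_distrib_left)
    also have "(\<Sum>i<m. real (lookup n i)) = real k"
      using mnorm_superset[of "{..<m}" n] L(1,2)[OF n] by simp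
    finally show ?thesis unfolding li by (simp add: right_diff_distrib sum_distrib_left mult_ac)
  qed
  have dir: "direction n \<in> log_directions g" if "lookup (fps_nth (logd g) k) n \<noteq> 0" for k n
    using that by (auto simp: log_directions_def)
  have cone: "wdeg w n = 0 \<or> wdeg w n \<ge> \<delta> * real k" if n: "lookup (fps_nth (logd g) k) n \<noteq> 0" for k n
    using v(3) v(4)[OF dir[OF n]] L(3)[OF n] by (cases "direction n = v") (auto simp: wd[OF n])
  have dv: "direction n = v" if n: "lookup (fps_nth (logd g) k) n \<noteq> 0" "wdeg w n = 0" for k n
  proof (rule ccontr)
    assume "direction n \<noteq> v"
    hence "c - (\<Sum>i<m. v i * direction n i) \<ge> \<delta>" by (rule v(4)[OF dir[OF n(1)]])
    thus False using n(2) L(3)[OF n(1)] v(2) by (simp add: wd[OF n(1)])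
  qed
  define p where "p = face_part w g"
  note ff = face_factor[OF gV(1) g0 v(2) cone, folded p_def]
  obtain h where h: "h \<in> mp {..<m}" "g = p * h" using ff(3) by blast
  have pV: "p \<in> mp {..<m}" unfolding p_def by (rule face_part_in[OF gV(1)])
  obtain k n where kn: "v = direction n" "lookup (fps_nth (logd g) k) n \<noteq> 0" using v(1) by (auto simp: log_directions_def)
  hence "wdeg w n = 0" using v(3) by (simp add: wd)
  hence "lookup (fps_nth (logd p) k) n \<noteq> 0" using kn(2) by (simp add: ff(2) lookup_face_part)
  hence "logd p \<noteq> 0" by auto
  hence "tdeg p \<noteq> 0" using logd_eq_0_iff[OF ff(1)] by simp
  hence "\<not> dvd_in (mp {..<m}) p 1" using mp_unit_iff[OF pV] by simp
  hence "dvd_in (mp {..<m}) h 1" using g pV h unfolding irreducible_in_def by blast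
  hence "tdeg h = 0" using mp_unit_iff[OF h(1)] by simp
  hence hc: "h = Poly_Mapping.single 0 (lookup h 0)" by (rule tdeg_0_const)
  have gp: "lookup g n = lookup h 0 * lookup p n" for n
    unfolding h(2) using lookup_const_mult[of "lookup h 0" p n] hc by (simp add: mult.commute)
  hence "lookup h 0 = 1" using g0 ff(1) by (metis mult.right_neutral)
  hence eq: "g = p" using gp by (intro poly_mapping_eqI) simp
  have all: "wdeg w n = 0" if "lookup (fps_nth (logd g) k) n \<noteq> 0" for k n
  proof (rule ccontr)
    assume "wdeg w n \<noteq> 0"
    hence "lookup (face_part w (fps_nth (logd g) k)) n = 0" by (simp add: lookup_face_part)
    moreover have "fps_nth (logd g) k = face_part w (fps_nth (logd g) k)"
      using arg_cong[OF ff(2), of "\<lambda>F. fps_nth F k"] eq by simp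
    ultimately show False using that by simp
  qed
  have "supported (\<lambda>k n. \<forall>i. real (lookup n i) = real k * v i) (hfps g)"
  proof (rule supported_ode[OF _ _ logd_nth_0])
    show "fps_tderiv (hfps g) = - (hfps g * logd g)" by (simp add: hfps_logd[OF g0])
    show "supported (\<lambda>k n. \<forall>i. real (lookup n i) = real k * v i) (logd g)"
      unfolding supported_def
    proof (intro allI impI)
      fix k n i assume n: "lookup (fps_nth (logd g) k) n \<noteq> 0"
      show "real (lookup n i) = real k * v i"
        using dv[OF n all[OF n]] L(2,3)[OF n] by (auto simp: direction_def)
    qed
    show "\<forall>i. real (lookup n i) = real 0 * v i" if "lookup (fps_nth (hfps g) 0) n \<noteq> 0" for n
      using that by (auto simp: lookup_hompoly mnorm_eq_0 split: if_splits)
  qed (simp add: lookup_add algebra_simps)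
  hence "lookup g n \<noteq> 0 \<longrightarrow> real (lookup n i) = real (mnorm n) * v i" for n i
    unfolding supported_def by (auto simp: lookup_hompoly)
  thus ?thesis by blast
qed

section \<open>Lattice points on a ray and the binomial form\<close>

definition nmul :: "nat \<Rightarrow> monom \<Rightarrow> monom" where "nmul j n = Poly_Mapping.map ((*) j) n"

lemma lookup_nmul: "lookup (nmul j n) i = j * lookup n i"
  by (simp add: nmul_def Poly_Mapping.map.rep_eq when_def)

lemma nmul_0 [simp]: "nmul 0 n = 0" by (rule poly_mapping_eqI) (simp add: lookup_nmul)
lemma nmul_Suc: "nmul (Suc j) n = n + nmul j n" by (rule poly_mapping_eqI) (simp add: lookup_nmul lookup_add)

lemma mnorm_nmul: "mnorm (nmul j n) = j * mnorm n"
  by (induction j) (simp_all add: nmul_Suc mnorm_add)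

lemma single_nmul: "Poly_Mapping.single (nmul j n) (1::complex) = Poly_Mapping.single n 1 ^ j"
proof (induction j)
  case (Suc j)
  have "Poly_Mapping.single (nmul (Suc j) n) (1::complex) = Poly_Mapping.single n 1 * Poly_Mapping.single (nmul j n) 1"
    by (simp add: nmul_Suc mult_single)
  thus ?case using Suc by simp
qed simp

text \<open>A nonzero lattice vector of least norm on the ray generates the others: division with
  remainder of the norms leaves a vector that is again on the ray and shorter, hence 0.\<close>

lemma ray_generator:
  assumes n0: "n0 \<noteq> 0" "\<And>i. real (lookup n0 i) = real (mnorm n0) * v i"
  obtains n1 where "n1 \<noteq> 0" "\<And>i. real (lookup n1 i) = real (mnorm n1) * v i"
    "\<And>n. (\<And>i. real (lookup n i) = real (mnorm n) * v i) \<Longrightarrow> \<exists>j. n = nmul j n1"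
proof -
  define Z where "Z = {n :: monom. \<forall>i. real (lookup n i) = real (mnorm n) * v i}"
  define P where "P d \<longleftrightarrow> (\<exists>n\<in>Z. n \<noteq> 0 \<and> mnorm n = d)" for d
  have "P (mnorm n0)" using n0 by (auto simp: P_def Z_def)
  from LeastI[of P, OF this] obtain n1 where n1: "n1 \<in> Z" "n1 \<noteq> 0" "mnorm n1 = (LEAST d. P d)" by (auto simp: P_def)
  have min: "mnorm n1 \<le> mnorm n" if "n \<in> Z" "n \<noteq> 0" for n
    unfolding n1(3) by (rule Least_le) (use that in \<open>auto simp: P_def\<close>)
  have m1: "mnorm n1 > 0" using n1(2) by (simp add: mnorm_eq_0[symmetric])
  have v0: "v i \<ge> 0" for i
  proof -
    have "real (mnorm n1) * v i \<ge> 0" using n1(1) by (simp add: Z_def flip: n1(3)) (metis of_nat_0_le_iff)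
    thus ?thesis using m1 by (simp add: zero_le_mult_iff)
  qed
  show ?thesis
  proof (rule that[OF n1(2)])
    show "real (lookup n1 i) = real (mnorm n1) * v i" for i using n1(1) by (simp add: Z_def)
    fix n assume n: "\<And>i. real (lookup n i) = real (mnorm n) * v i"
    define j r where "j = mnorm n div mnorm n1" and "r = n - nmul j n1"
    have jm: "mnorm n = j * mnorm n1 + mnorm n mod mnorm n1" by (simp add: j_def)
    have le: "j * lookup n1 i \<le> lookup n i" for i
    proof -
      have "real (j * lookup n1 i) = real (j * mnorm n1) * v i" using n1(1) by (simp add: Z_def)
      also have "\<dots> \<le> real (mnorm n) * v i" using v0[of i] jm by (intro mult_right_mono) linarith+
      finally show ?thesis unfolding n[symmetric] by (simp only: of_nat_le_iff)
    qed
    have nr: "n = nmul j n1 + r"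
      by (rule poly_mapping_eqI) (simp add: r_def lookup_add lookup_minus lookup_nmul le)
    hence mr: "mnorm r = mnorm n mod mnorm n1" using jm mnorm_add[of "nmul j n1" r] by (simp add: mnorm_nmul)
    have "r \<in> Z"
    proof -
      have "real (lookup r i) = real (mnorm r) * v i" for i
      proof -
        have "real (lookup n i) = real j * real (lookup n1 i) + real (lookup r i)"
          unfolding nr by (simp add: lookup_add lookup_nmul)
        moreover have "real (mnorm n) = real j * real (mnorm n1) + real (mnorm r)"
          using jm mr by (metis of_nat_add of_nat_mult)
        ultimately show ?thesis using n[of i] n1(1) by (simp add: Z_def algebra_simps)
      qed
      thus ?thesis by (simp add: Z_def)
    qed
    hence "r = 0" using min[of r] mr m1 mod_less_divisor[OF m1, of "mnorm n"] by fastforce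
    thus "\<exists>j. n = nmul j n1" using nr by auto
  qed
qed

lemma synthetic_div_in:
  assumes S: "is_subring S" and p: "p \<in> poly_over S" and c: "c \<in> S"
  shows "synthetic_div p c \<in> poly_over S \<and> poly p c \<in> S"
  using p
proof (induction p)
  case 0
  thus ?case using S by (simp add: poly_over_def is_subring_def)
next
  case (pCons a p)
  have cf: "coeff (pCons a p) i \<in> S" for i using pCons.prems by (simp add: poly_over_def)
  have "a \<in> S" "coeff p i \<in> S" for i using cf[of 0] cf[of "Suc i"] by simp_all
  hence "p \<in> poly_over S" "a \<in> S" by (auto simp: poly_over_def)
  with pCons.IH show ?case using S c
    by (auto simp: poly_over_def coeff_pCons is_subring_def split: nat.splits)
qed

lemma wt_const: "wt (\<lambda>_. w) n = w ^ mnorm n"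
  by (simp add: wt_def mnorm_def power_sum)

lemma meval_power: "meval x (p ^ j) = meval x p ^ j"
  by (induction j) (simp_all add: meval_simps)

text \<open>Along a ray, \<open>g\<close> is a one-variable polynomial \<open>q\<close> in a single
  monomial \<open>y\<close>. A complex root \<open>z\<close> of \<open>q\<close> splits off the
  factor \<open>y - z\<close>, and irreducibility leaves only this. The factor has algebraic
  coefficients because \<open>z\<close> is a power of a zero of \<open>kron a g\<close>.\<close>

lemma ray_irreducible_is_binomial:
  assumes g: "irreducible_in (mp {..<m}) g" and g0: "lookup g 0 = 1"
    and ray: "\<And>n i. lookup g n \<noteq> 0 \<Longrightarrow> real (lookup n i) = real (mnorm n) * v i"
    and a: "\<And>i. a i > 0" "\<And>t. poly (kron a g) t = 0 \<Longrightarrow> algebraic t"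
  obtains \<zeta> n where "\<zeta> \<noteq> 0" "monom_in m n" "n \<noteq> 0" "g = 1 - Poly_Mapping.single n \<zeta>"
proof -
  have gV: "g \<in> mp {..<m}" "g \<noteq> 0" using g by (auto simp: irreducible_in_def)
  have td: "tdeg g \<noteq> 0" using g mp_unit_iff[OF gV(1)] gV(2) by (auto simp: irreducible_in_def)
  have "\<exists>n. lookup g n \<noteq> 0 \<and> n \<noteq> 0"
  proof (rule ccontr)
    assume "\<not> ?thesis"
    hence "g = Poly_Mapping.single 0 1" using g0
      by (intro poly_mapping_eqI) (auto simp: lookup_single when_def simp del: single_one)
    thus False using td tdeg_single_0[of 1] by (simp del: single_one)
  qed
  then obtain n0 where n0: "lookup g n0 \<noteq> 0" "n0 \<noteq> 0" by blast
  obtain n1 where n1: "n1 \<noteq> 0" "\<And>i. real (lookup n1 i) = real (mnorm n1) * v i"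
    "\<And>n. (\<And>i. real (lookup n i) = real (mnorm n) * v i) \<Longrightarrow> \<exists>j. n = nmul j n1"
    by (rule ray_generator[OF n0(2) ray[OF n0(1)]]) blast
  have m1: "mnorm n1 > 0" using n1(1) by (simp add: mnorm_eq_0[symmetric])
  have nm: "\<exists>j. n = nmul j n1" if "lookup g n \<noteq> 0" for n using n1(3) ray[OF that] by blast
  obtain j0 where j0: "n0 = nmul j0 n1" using nm[OF n0(1)] by blast
  have "j0 \<noteq> 0"
  proof
    assume "j0 = 0"
    thus False using n0(2) j0 by simp
  qed
  hence keq: "keys n1 = keys n0" by (auto simp: j0 in_keys_iff lookup_nmul)
  hence n1m: "keys n1 \<subseteq> {..<m}" using mp_keys[OF gV(1) n0(1)] by simp
  define y where "y = Poly_Mapping.single n1 (1::complex)"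
  define N where "N = tdeg g"
  define q where "q = (\<Sum>j\<le>N. Polynomial.monom (lookup g (nmul j n1)) j)"
  have cq: "coeff q j = (if j \<le> N then lookup g (nmul j n1) else 0)" for j by (simp add: q_def coeff_sum)
  have cqN: "coeff q j = lookup g (nmul j n1)" for j
  proof (cases "j \<le> N")
    case False
    have "lookup g (nmul j n1) = 0"
    proof (rule ccontr)
      assume "lookup g (nmul j n1) \<noteq> 0"
      hence "j * mnorm n1 \<le> N" using mnorm_le_tdeg mnorm_nmul N_def by metis
      moreover have "j \<le> j * mnorm n1" using m1 by simp
      ultimately show False using False by simp
    qed
    thus ?thesis using False by (simp add: cq)
  qed (simp add: cq)
  \<comment> \<open>The coefficients of \<open>q\<close> as constant polynomials, so that splitting
    off \<open>y - z\<close> becomes one-variable division over \<open>mpoly\<close>.\<close>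
  define Qm where "Qm = map_poly (Poly_Mapping.single (0::monom)) q"
  have cQm: "coeff Qm j = Poly_Mapping.single 0 (coeff q j)" for j by (simp add: Qm_def coeff_map_poly)
  have s0: "Poly_Mapping.single (0::monom) c = 0 \<longleftrightarrow> c = 0" for c :: complex
    using lookup_single_eq[of "0::monom" c] by (metis lookup_zero single_zero)
  have dQm: "degree Qm = degree q" unfolding Qm_def by (rule degree_map_poly) (simp add: s0)
  have inj: "nmul i n1 = nmul j n1 \<longleftrightarrow> i = j" for i j
  proof
    assume "nmul i n1 = nmul j n1"
    hence "mnorm (nmul i n1) = mnorm (nmul j n1)" by (rule arg_cong)
    thus "i = j" unfolding mnorm_nmul using m1 by simp
  qed simp
  have gQ: "g = poly Qm y"
  proof (rule poly_mapping_eqI)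
    fix n
    have "poly Qm y = (\<Sum>j\<le>degree q. Poly_Mapping.single (nmul j n1) (coeff q j))"
      unfolding poly_altdef dQm cQm y_def single_nmul[symmetric] by (simp add: mult_single)
    hence "lookup (poly Qm y) n = (\<Sum>j\<le>degree q. if nmul j n1 = n then coeff q j else 0)"
      by (simp add: lookup_sum lookup_single when_def)
    also have "\<dots> = lookup g n"
    proof (cases "\<exists>j. n = nmul j n1")
      case True
      then obtain l where l: "n = nmul l n1" by blast
      have "(\<Sum>j\<le>degree q. if nmul j n1 = n then coeff q j else 0) = coeff q l"
        by (simp add: l inj coeff_eq_0)
      thus ?thesis by (simp add: l cqN)
    next
      case False
      hence "lookup g n = 0" using nm by blast
      thus ?thesis using False by (auto intro!: sum.neutral)
    qed
    finally show "lookup g n = lookup (poly Qm y) n" by simp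
  qed
  have evg: "meval x g = poly q (wt x n1)" for x
  proof -
    have "meval x y = wt x n1" by (simp add: y_def ev.msub_single)
    thus ?thesis unfolding gQ poly_altdef dQm cQm
      by (simp add: ev.msub_sum meval_simps meval_power)
  qed
  have "coeff q j0 \<noteq> 0" using n0(1) by (simp add: cqN j0)
  hence "degree q > 0" using \<open>j0 \<noteq> 0\<close> le_degree[of q j0] by auto
  hence "\<not> constant (poly q)" by (simp add: constant_degree)
  from Fundamental_Theorem_Algebra.fundamental_theorem_of_algebra[OF this] obtain z where z: "poly q z = 0" by blast
  have "keys n1 \<noteq> {}" using n1(1) by simp
  then obtain i where i: "i \<in> keys n1" by blast
  have W: "wdeg a n1 > 0" unfolding wdeg_def
    by (rule sum_pos2[of _ i]) (use i a(1)[of i] in \<open>auto simp: in_keys_iff\<close>)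
  \<comment> \<open>At the point with coordinates \<open>t ^ a i\<close> the monomial of exponent
    \<open>n1\<close> takes the value \<open>z\<close>, so \<open>t\<close> is a zero of
    \<open>kron a g\<close>.\<close>
  obtain t where t: "z = t ^ wdeg a n1" using exists_complex_root[of "wdeg a n1" z] W by blast
  have "poly (kron a g) t = poly q (wt (\<lambda>i. t ^ a i) n1)" by (simp add: poly_psub poly_monom evg)
  also have "wt (\<lambda>i. t ^ a i) n1 = z" by (simp add: t wt_def wdeg_def power_sum power_mult)
  finally have "algebraic t" using z by (intro a(2)) simp
  hence zalg: "algebraic z" unfolding t by (rule algebraic_power)
  define Zc where "Zc = Poly_Mapping.single (0::monom) z"
  have "poly Qm Zc = Poly_Mapping.single 0 (poly q z)"
  proof -
    have "Zc ^ j = Poly_Mapping.single 0 (z ^ j)" for j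
      by (induction j) (simp_all add: Zc_def mult_single flip: single_one)
    hence "poly Qm Zc = (\<Sum>j\<le>degree q. Poly_Mapping.single 0 (coeff q j * z ^ j))"
      unfolding poly_altdef dQm cQm by (simp add: mult_single)
    also have "\<dots> = Poly_Mapping.single 0 (poly q z)"
      unfolding poly_altdef by (rule poly_mapping_eqI) (simp add: lookup_sum lookup_single when_def)
    finally show ?thesis .
  qed
  hence "[:- Zc, 1:] * synthetic_div Qm Zc = Qm" using synthetic_div_correct'[of Zc Qm] z by simp
  from arg_cong[OF this, of "\<lambda>p. poly p y"]
  have gk: "g = (y - Zc) * poly (synthetic_div Qm Zc) y" unfolding gQ by (simp add: left_diff_distrib)
  define k where "k = poly (synthetic_div Qm Zc) y"
  have yV: "y \<in> mp {..<m}" unfolding y_def by (rule mp_single[OF n1m]) (simp add: rat_imp_algebraic)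
  have ZV: "Zc \<in> mp {..<m}" unfolding Zc_def by (rule mp_single) (simp_all add: zalg)
  have QmV: "Qm \<in> poly_over (mp {..<m})"
    by (auto simp: poly_over_def cQm cqN intro!: mp_single mp_algebraic[OF gV(1)])
  have powV: "y ^ j \<in> mp {..<m}" for j by (induction j) (auto intro: mp_1 mp_mult yV)
  have kV: "k \<in> mp {..<m}" unfolding k_def poly_altdef
    using synthetic_div_in[OF mp_subring QmV ZV] by (intro mp_sum mp_mult powV) (auto simp: poly_over_def)
  have fV: "y - Zc \<in> mp {..<m}" by (rule mp_diff[OF yV ZV])
  have "lookup (y - Zc) n1 = 1" using n1(1) by (simp add: y_def Zc_def lookup_minus lookup_single)
  hence "mnorm n1 \<le> tdeg (y - Zc)" by (intro mnorm_le_tdeg) simp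
  hence "\<not> dvd_in (mp {..<m}) (y - Zc) 1" using mp_unit_iff[OF fV] m1 by simp
  hence "dvd_in (mp {..<m}) k 1" using g fV kV gk unfolding k_def[symmetric] irreducible_in_def by blast
  hence "tdeg k = 0" using mp_unit_iff[OF kV] by simp
  then have kc: "k = Poly_Mapping.single 0 (lookup k 0)" by (rule tdeg_0_const)
  define c where "c = lookup k 0"
  have g1: "g = Poly_Mapping.single n1 c - Poly_Mapping.single 0 (z * c)"
    unfolding gk k_def[symmetric] by (subst kc) (simp add: c_def y_def Zc_def left_diff_distrib mult_single)
  have "- (z * c) = 1" using g0 n1(1) unfolding g1 by (simp add: lookup_minus lookup_single)
  hence "c \<noteq> 0" "Poly_Mapping.single (0::monom) (z * c) = - 1"
    by (auto simp: minus_equation_iff[of "z * c"] simp flip: single_uminus single_one)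
  hence "g = 1 - Poly_Mapping.single n1 (- c)" unfolding g1 by (simp add: single_uminus)
  thus ?thesis using that[of "- c" n1] \<open>c \<noteq> 0\<close> n1(1) n1m by (simp add: monom_in_def)
qed

section \<open>Irreducible factors of the denominator\<close>

lemma meval_at_0: "meval (\<lambda>_. 0) g = lookup g 0"
proof -
  have "meval (\<lambda>_. 0) g = (\<Sum>n\<in>keys g. if n = 0 then lookup g n else 0)"
    unfolding ev.msub_def wt_const by (intro sum.cong refl) (auto simp: mnorm_eq_0 power_0_left)
  thus ?thesis by (simp add: in_keys_iff)
qed

lemma irreducible_in_unit_mult:
  assumes g: "irreducible_in (mp V) g" and c: "algebraic c" "c \<noteq> 0"
  shows "irreducible_in (mp V) (Poly_Mapping.single 0 c * g)"
proof -
  let ?u = "Poly_Mapping.single (0::monom) c" and ?v = "Poly_Mapping.single (0::monom) (inverse c)"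
  have uv: "?u * ?v = 1" using c by (simp add: mult_single)
  have u: "?u \<in> mp V" "?v \<in> mp V" using c by (auto intro!: mp_single)
  have gV: "g \<in> mp V" "g \<noteq> 0" using g by (auto simp: irreducible_in_def)
  have u0: "?u \<noteq> 0" "?v \<noteq> 0" using uv by auto
  have tu: "tdeg (?u * x) = tdeg x" "tdeg (?v * x) = tdeg x" if "x \<noteq> 0" for x
    using tdeg_mult[OF u0(1) that] tdeg_mult[OF u0(2) that] tdeg_single_0 by auto
  show ?thesis unfolding irreducible_in_def
  proof (intro conjI ballI impI)
    show "?u * g \<in> mp V" "?u * g \<noteq> 0" using mp_mult u gV u0 by auto
    show "\<not> dvd_in (mp V) (?u * g) 1"
      using g mp_unit_iff[OF mp_mult[OF u(1) gV(1)]] mp_unit_iff[OF gV(1)] gV(2) tu by (auto simp: irreducible_in_def)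
    fix a b assume ab: "a \<in> mp V" "b \<in> mp V" "?u * g = a * b"
    have a0: "a \<noteq> 0" using ab(3) gV(2) u0(1) by auto
    have "g = ?v * (?u * g)" using uv by (simp add: mult.assoc[symmetric] mult.commute[of ?v])
    hence "g = (?v * a) * b" using ab(3) by (simp add: mult.assoc)
    hence "dvd_in (mp V) (?v * a) 1 \<or> dvd_in (mp V) b 1"
      using g ab mp_mult[OF u(2) ab(1)] unfolding irreducible_in_def by blast
    thus "dvd_in (mp V) a 1 \<or> dvd_in (mp V) b 1"
      using mp_unit_iff[OF mp_mult[OF u(2) ab(1)]] mp_unit_iff[OF ab(1)] a0 tu by auto
  qed
qed

context rational_series
begin

text \<open>The height controls every conjugate. \<open>H N\<close> is at most
  \<open>(e / d) * N\<close> for large \<open>N\<close>, and the constant \<open>C\<close> absorbs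
  the finitely many smaller \<open>N\<close>.\<close>

lemma conjugate_growth:
  fixes H :: "nat \<Rightarrow> real"
  assumes R: "bounded_degree_ring (of_rat :: rat \<Rightarrow> complex) d R" "\<And>n. f n \<in> R"
    and H: "\<forall>n N. monom_in m n \<longrightarrow> mnorm n \<le> N \<longrightarrow> weil_height (f n) \<le> H N"
    and Ho: "H \<in> o(\<lambda>n. real n)" and s: "alg_hom s" and e: "e > (0::real)"
  shows "\<exists>C. \<forall>n. monom_in m n \<longrightarrow> cmod (s (f n)) \<le> C * exp (e * mnorm n)"
proof -
  have d: "d > 0" using R(1) by (simp add: bounded_degree_ring_def)
  have H0: "H N \<ge> 0" for N
    using H[rule_format, of 0 N] weil_height_nonneg[OF f_alg[of 0]] by (simp add: monom_in_def)
  have "\<forall>\<^sub>F N in sequentially. norm (H N) \<le> e / d * norm (real N)"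
    using landau_o.smallD[OF Ho, of "e / d"] e d by simp
  then obtain N0 where N0: "\<And>N. N \<ge> N0 \<Longrightarrow> H N \<le> e / d * real N"
    using H0 by (auto simp: eventually_sequentially)
  define C where "C = exp (\<Sum>N<N0. d * H N)"
  have C1: "C \<ge> 1" unfolding C_def using H0 by (simp add: sum_nonneg)
  show ?thesis
  proof (intro exI[of _ C] allI impI)
    fix n assume n: "monom_in m n"
    have "cmod (s (f n)) \<le> exp (d * H (mnorm n))"
      by (rule norm_conj_le_exp_height[OF f_alg bounded_degree(2)[OF R(1,2)] H[rule_format, OF n order_refl] s])
    also have "\<dots> \<le> C * exp (e * mnorm n)"
    proof (cases "mnorm n < N0")
      case True
      have "d * H (mnorm n) \<le> (\<Sum>N<N0. d * H N)"
        by (rule member_le_sum) (use True H0 in auto)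
      hence "exp (d * H (mnorm n)) \<le> C" by (simp add: C_def)
      also have "\<dots> \<le> C * exp (e * mnorm n)" using C1 e by (intro mult_left_le[THEN order_trans] mult_le_cancel_left1[THEN iffD2]) auto
      finally show ?thesis .
    next
      case False
      hence "d * H (mnorm n) \<le> e * mnorm n" using N0[of "mnorm n"] d by (simp add: field_simps)
      hence "exp (d * H (mnorm n)) \<le> 1 * exp (e * mnorm n)" by simp
      also have "\<dots> \<le> C * exp (e * mnorm n)" using C1 by (intro mult_right_mono) auto
      finally show ?thesis .
    qed
    finally show "cmod (s (f n)) \<le> C * exp (e * mnorm n)" .
  qed
qed

text \<open>Conjugation transports the whole situation: the series identity, the factorisation of
  \<open>Q\<close>, and the elimination relation, whose \<open>c\<close> stays nonzero because an
  \<open>alg_hom\<close> sends only 0 to 0 among algebraic numbers.\<close>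

lemma conjugate_zero_free:
  assumes R: "bounded_degree_ring (of_rat :: rat \<Rightarrow> complex) d R" "\<And>n. f n \<in> R"
    and H: "\<forall>n N. monom_in m n \<longrightarrow> mnorm n \<le> N \<longrightarrow> weil_height (f n) \<le> H N"
    and Ho: "H \<in> o(\<lambda>n. real n)" and s: "alg_hom s"
    and g: "irreducible_in (mp {..<m}) g" "dvd_in (mp {..<m}) g Q" "\<not> dvd_in (mp {..<m}) g P"
    and z: "\<And>j. j < m \<Longrightarrow> cmod (z j) < 1"
  shows "meval z (smap s g) \<noteq> 0"
proof (rule zero_free[where P = "smap s P", OF _ _ _ _ z])
  have gV: "g \<in> mp {..<m}" "g \<noteq> 0" using g(1) by (auto simp: irreducible_in_def)
  show "smap s g \<in> mp {..<m}" by (rule smap_in[OF s gV(1)])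
  show "smap s g \<noteq> 0" using keys_smap[OF s gV(1)] gV(2) by (metis keys_eq_empty)
  obtain h where h: "h \<in> mp {..<m}" "Q = g * h" using g(2) by (auto simp: dvd_in_def)
  show "meval x (smap s P) = 0" if x: "\<And>j. j < m \<Longrightarrow> cmod (x j) < 1" "meval x (smap s g) = 0" for x
  proof (rule numerator_vanishes[OF smap_in[OF s Q] smap_in[OF s P] _ conjugate_growth[OF R H Ho s] x(1)])
    show "series_mult_coeff (smap s Q) (\<lambda>n. s (f n)) n = lookup (smap s P) n" for n
      by (simp add: smap_series[OF s Q] f_alg rat lookup_smap[OF s])
    show "meval x (smap s Q) = 0" by (simp add: h(2) smap_mult[OF s gV(1) h(1)] meval_simps x(2))
  qed
  show "\<exists>c u v. c \<in> mp ({..<m} - {i}) \<and> c \<noteq> 0 \<and> c = u * smap s P + v * smap s g"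
    if n: "lookup (smap s g) n \<noteq> 0" "lookup n i \<noteq> 0" for i n
  proof -
    have gn: "lookup g n \<noteq> 0" using n(1) alg_hom_0[OF s] by (auto simp: lookup_smap[OF s])
    have "i \<in> keys n" using n(2) by (simp add: in_keys_iff)
    hence i: "i \<in> {..<m}" using mp_keys[OF gV(1) gn] by auto
    obtain c u v where c: "c \<in> mp ({..<m} - {i})" "c \<noteq> 0" "u \<in> mp {..<m}" "v \<in> mp {..<m}" "c = u * P + v * g"
      using mp_bezout[OF g(1) finite_lessThan i gn n(2) P g(3)] by (elim exE conjE)
    have "smap s c = smap s u * smap s P + smap s v * smap s g"
      unfolding c(5) by (simp add: smap_add[OF s mp_mult[OF c(3) P] mp_mult[OF c(4) gV(1)]]
          smap_mult[OF s c(3) P] smap_mult[OF s c(4) gV(1)])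
    moreover have "smap s c \<noteq> 0" using keys_smap[OF s c(1)] c(2) by (metis keys_eq_empty)
    ultimately show ?thesis using smap_in[OF s c(1)] by blast
  qed
qed

lemma irreducible_factor_binomial:
  assumes H: "\<forall>n N. monom_in m n \<longrightarrow> mnorm n \<le> N \<longrightarrow> weil_height (f n) \<le> H N"
    and Ho: "H \<in> o(\<lambda>n. real n)" and m: "m \<ge> 1"
    and g: "irreducible_in (mp {..<m}) g" "dvd_in (mp {..<m}) g Q" "\<not> dvd_in (mp {..<m}) g P"
  obtains c \<zeta> n where "c \<noteq> 0" "algebraic c" "root_of_unity \<zeta>" "monom_in m n" "n \<noteq> 0"
    "g = Poly_Mapping.single 0 c * (1 - Poly_Mapping.single n \<zeta>)"
proof -
  have gV: "g \<in> mp {..<m}" "g \<noteq> 0" using g(1) by (auto simp: irreducible_in_def)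
  define c where "c = lookup g 0"
  have calg: "algebraic c" "algebraic (inverse c)" using mp_algebraic[OF gV(1)] by (auto simp: c_def)
  \<comment> \<open>At this point \<open>c\<close> is not yet known to be nonzero; were it 0, its
    inverse would be 0 by convention and still algebraic.\<close>
  define T0 where "T0 = (\<lambda>n. inverse c * lookup g n) ` keys g"
  have T0: "finite T0" "\<And>t. t \<in> T0 \<Longrightarrow> algebraic t"
    using calg mp_algebraic[OF gV(1)] by (auto simp: T0_def intro!: algebraic_mult)
  obtain d R A where R: "bounded_degree_ring (of_rat :: rat \<Rightarrow> complex) d R" "T0 \<subseteq> R" "A > 0"
    "\<And>n. f n \<in> R" "\<And>n. \<exists>j. algebraic_int (of_nat (A ^ j) * f n)"
    by (rule coefficient_ring[OF T0]) (assumption | rule that; assumption)+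
  have zf: "meval z (smap s g) \<noteq> 0" if "alg_hom s" "\<And>j. j < m \<Longrightarrow> cmod (z j) < 1" for s z
    by (rule conjugate_zero_free[OF R(1,4) H Ho that(1) g that(2)])
  have "smap id g = g" by (rule poly_mapping_eqI) (simp add: lookup_smap[OF alg_hom_id])
  \<comment> \<open>The identity conjugation and the origin: zero-freeness there says that
    \<open>g\<close> has a constant term.\<close>
  hence c0: "c \<noteq> 0" using zf[OF alg_hom_id, of "\<lambda>_. 0"] by (simp add: meval_at_0 c_def)
  define g1 where "g1 = Poly_Mapping.single 0 (inverse c) * g"
  have g1: "irreducible_in (mp {..<m}) g1"
    unfolding g1_def by (rule irreducible_in_unit_mult[OF g(1) calg(2)]) (use c0 in simp)
  have gg1: "g = Poly_Mapping.single 0 c * g1"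
    unfolding g1_def using c0 by (simp add: mult.assoc[symmetric] mult_single)
  have g1V: "g1 \<in> mp {..<m}" using g1 by (simp add: irreducible_in_def)
  have lg1: "lookup g1 n = inverse c * lookup g n" for n unfolding g1_def by (rule lookup_const_mult)
  have g10: "lookup g1 0 = 1" using c0 by (simp add: lg1 c_def)
  have g1R: "lookup g1 n \<in> R" for n
  proof (cases "n \<in> keys g")
    case True
    thus ?thesis using R(2) by (auto simp: lg1 T0_def)
  qed (simp add: lg1 in_keys_iff bdr_0[OF R(1)])
  have zf1: "meval z (smap s g1) \<noteq> 0" if s: "alg_hom s" and z: "\<And>j. j < m \<Longrightarrow> cmod (z j) < 1" for s z
  proof -
    have "smap s g1 = Poly_Mapping.single 0 (s (inverse c)) * smap s g"
      by (rule poly_mapping_eqI)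
         (simp add: lookup_smap[OF s] lg1 lookup_const_mult alg_hom_mult[OF s calg(2) mp_algebraic[OF gV(1)]])
    moreover have "s (inverse c) \<noteq> 0" using alg_hom_eq_0[OF s calg(2)] c0 by simp
    ultimately show ?thesis using zf[OF s z] by (simp add: meval_simps)
  qed
  obtain S C where S: "S \<in> mp {..<m}" "S \<noteq> 0" "\<And>n. lookup S n \<in> {-1,0,1}" "C \<in> mp {..<m}" "Q * C = S * P"
    using small_multiple[OF R(1,4,3,5) H[rule_format] Ho m] by blast
  \<comment> \<open>As a prime, \<open>g\<close> divides \<open>S\<close>: it divides
    \<open>Q * C = S * P\<close> but not \<open>P\<close>.\<close>
  have "prime_in (mp {..<m}) g" using mp_irreducibles_prime[of "{..<m}"] g(1) by (simp add: irreducibles_prime_def)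
  moreover have "dvd_in (mp {..<m}) g (S * P)"
  proof -
    obtain h where "h \<in> mp {..<m}" "Q = g * h" using g(2) by (auto simp: dvd_in_def)
    hence "S * P = g * (h * C)" "h * C \<in> mp {..<m}" using S(4,5) mp_mult by (auto simp: mult.assoc)
    thus ?thesis unfolding dvd_in_def by blast
  qed
  ultimately have "dvd_in (mp {..<m}) g S" using g(3) S(1) P unfolding prime_in_def by blast
  then obtain k where "S = g * k" by (auto simp: dvd_in_def)
  hence Sg: "S = g1 * (Poly_Mapping.single 0 c * k)" unfolding gg1 by (simp add: mult_ac)
  note ds = divisor_of_signs[OF S(1-3) Sg g1V g10]
  obtain a where a: "\<And>i. a i > 0" "\<And>t. poly (kron a g1) t = 0 \<Longrightarrow> algebraic t" using ds(2) by blast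
  have "finite (log_directions g1)"
    by (rule finite_log_directions[OF R(1) g1V g10 g1R ds(1) zf1])
  from ray_support[OF g1 g10 this] obtain v where v: "\<And>n i. lookup g1 n \<noteq> 0 \<Longrightarrow> real (lookup n i) = real (mnorm n) * v i" by blast
  obtain \<zeta> n where n: "\<zeta> \<noteq> 0" "monom_in m n" "n \<noteq> 0" "g1 = 1 - Poly_Mapping.single n \<zeta>"
    by (rule ray_irreducible_is_binomial[OF g1 g10 v a])
  have z: "\<zeta> = - lookup g1 n" using n(3) by (simp add: n(4) lookup_minus lookup_one lookup_single)
  have zR: "\<zeta> \<in> R" unfolding z by (rule bdr_uminus[OF R(1) g1R])
  have zI: "algebraic_int \<zeta>" unfolding z using ds(1)[of n] by (rule algebraic_int_minus)
  \<comment> \<open>Otherwise the conjugate binomial would vanish at a point of the open polydisc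
    with all coordinates equal to \<open>w\<close>.\<close>
  have "cmod (s \<zeta>) \<le> 1" if s: "alg_hom s" for s
  proof (rule ccontr)
    assume big: "\<not> cmod (s \<zeta>) \<le> 1"
    have mn: "mnorm n > 0" using n(3) by (simp add: mnorm_eq_0[symmetric])
    have s0: "s \<zeta> \<noteq> 0" using big by auto
    obtain w where w: "1 / s \<zeta> = w ^ mnorm n" using exists_complex_root[of "mnorm n" "1 / s \<zeta>"] mn by blast
    have "cmod w ^ mnorm n = 1 / cmod (s \<zeta>)" using w by (metis norm_divide norm_one norm_power)
    also have "\<dots> < 1" using big by (simp add: divide_less_eq)
    finally have w1: "cmod w < 1" using mn by (simp add: power_less_one_iff)
    have "smap s g1 = 1 + Poly_Mapping.single n (- s \<zeta>)"
      using n(3) by (intro poly_mapping_eqI)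
        (auto simp: n(4) lookup_smap[OF s] lookup_minus lookup_add lookup_one lookup_single when_def
          alg_hom_0[OF s] alg_hom_1[OF s] alg_hom_uminus[OF s algebraic_int_imp_algebraic[OF zI]])
    hence "meval (\<lambda>_. w) (smap s g1) = 1 - s \<zeta> * w ^ mnorm n" by (simp add: meval_simps wt_const)
    also have "\<dots> = 0" using w[symmetric] s0 by simp
    finally show False using zf1[OF s, of "\<lambda>_. w"] w1 by simp
  qed
  hence "root_of_unity \<zeta>" by (rule kronecker_root_of_unity[OF R(1) zR zI n(1)])
  thus ?thesis using that[OF c0 calg(1) _ n(2,3)] gg1 n(4) by simp
qed

end

lemma height_bound_upper:
  assumes "monom_in m n" "mnorm n \<le> N" shows "weil_height (f n) \<le> height_bound m f N"
proof -
  have "{n. monom_in m n \<and> mnorm n \<le> N} \<subseteq> (\<Union>k\<le>N. mlevel m k)" by (auto simp: mlevel_def)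
  hence "finite {n. monom_in m n \<and> mnorm n \<le> N}" by (rule finite_subset) (auto simp: mlevel_card)
  thus ?thesis unfolding height_bound_def using assms by (intro Max_ge) auto
qed

theorem theorem3p7:
  fixes m :: nat and f :: "monom \<Rightarrow> complex" and P Q :: mpoly
  assumes "m \<ge> 1"
    and f_alg: "\<And>n. monom_in m n \<Longrightarrow> algebraic (f n)"
    and "alg_mpoly_in m P" and "alg_mpoly_in m Q" and "Q \<noteq> 0"
    and rat: "\<And>n. monom_in m n \<Longrightarrow> series_mult_coeff Q f n = Poly_Mapping.lookup P n"
    and "alg_coprime m P Q"
    and small: "(\<lambda>N. height_bound m f N) \<in> o(\<lambda>N. real N)"
  shows "\<forall>g. alg_irreducible m g \<longrightarrow> alg_dvd m g Q \<longrightarrow>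
           (\<exists>c \<zeta> n. c \<noteq> 0 \<and> algebraic c \<and> root_of_unity \<zeta> \<and> monom_in m n \<and> n \<noteq> 0 \<and>
              g = Poly_Mapping.single 0 c * (1 - Poly_Mapping.single 0 \<zeta> * xmon n))"
proof (intro allI impI)
  fix g assume gi: "alg_irreducible m g" and gd: "alg_dvd m g Q"
  have dvd: "alg_dvd m a b \<longleftrightarrow> dvd_in (mp {..<m}) a b" for a b
    by (auto simp: alg_dvd_def dvd_in_def alg_mpoly_in_mp)
  have P: "P \<in> mp {..<m}" and Q: "Q \<in> mp {..<m}" using assms by (simp_all add: alg_mpoly_in_mp)
  have g: "irreducible_in (mp {..<m}) g"
    using gi by (auto simp: alg_irreducible_def irreducible_in_def alg_unit_def dvd alg_mpoly_in_mp)
  have gQ: "dvd_in (mp {..<m}) g Q" using gd by (simp add: dvd)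
  have gP: "\<not> dvd_in (mp {..<m}) g P"
  proof
    assume "dvd_in (mp {..<m}) g P"
    hence "alg_unit m g" using \<open>alg_coprime m P Q\<close> gi gd
      unfolding alg_coprime_def alg_irreducible_def dvd[symmetric] by blast
    thus False using gi by (simp add: alg_irreducible_def)
  qed
  \<comment> \<open>Values of \<open>f\<close> at exponents involving other variables are
    unconstrained, so they are replaced by 0.\<close>
  define f' where "f' n = (if monom_in m n then f n else 0)" for n
  have mQ: "monom_in m k" if "k \<in> keys Q" for k using Q that by (auto simp: mp_def monom_in_def)
  interpret rational_series m P Q f'
  proof
    show "algebraic (f' n)" for n using f_alg by (simp add: f'_def)
    show "series_mult_coeff Q f' n = lookup P n" for n
    proof (cases "monom_in m n")
      case True
      have "series_mult_coeff Q f' n = series_mult_coeff Q f n"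
        unfolding series_mult_coeff_def
        by (intro sum.cong refl) (use True in \<open>auto simp: f'_def monom_le_iff monom_in_add\<close>)
      thus ?thesis using rat[OF True] by simp
    next
      case False
      have "series_mult_coeff Q f' n = 0" unfolding series_mult_coeff_def
        by (intro sum.neutral ballI) (use False mQ in \<open>auto simp: f'_def monom_le_iff monom_in_add\<close>)
      moreover have "lookup P n = 0" using False P by (auto simp: mp_def monom_in_def in_keys_iff)
      ultimately show ?thesis by simp
    qed
  qed (use P Q \<open>Q \<noteq> 0\<close> in \<open>auto simp: f'_def\<close>)
  have H: "\<forall>n N. monom_in m n \<longrightarrow> mnorm n \<le> N \<longrightarrow> weil_height (f' n) \<le> height_bound m f N"
    by (simp add: f'_def height_bound_upper)
  obtain c \<zeta> n where "c \<noteq> 0" "algebraic c" "root_of_unity \<zeta>" "monom_in m n" "n \<noteq> 0"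
    "g = Poly_Mapping.single 0 c * (1 - Poly_Mapping.single n \<zeta>)"
    by (rule irreducible_factor_binomial[OF H small \<open>m \<ge> 1\<close> g gQ gP])
  moreover have "Poly_Mapping.single n \<zeta> = Poly_Mapping.single 0 \<zeta> * xmon n"
    by (simp add: xmon_def mult_single)
  ultimately show "\<exists>c \<zeta> n. c \<noteq> 0 \<and> algebraic c \<and> root_of_unity \<zeta> \<and> monom_in m n \<and> n \<noteq> 0 \<and>
      g = Poly_Mapping.single 0 c * (1 - Poly_Mapping.single 0 \<zeta> * xmon n)" by metis
qed

end
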